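(* Let $R\in C^0([0,1],\mathrm{Sym}_n(\mathbb{R}))$ and let $l_R=-\frac{d^2}{dt^2}+\frac{R(t)}{t^2}$ on $(0,1]$. (1) If $\liminf_{t\to0^+}R(t)>-1/4$, then every self-adjoint extension of (the minimal operator of) $l_R$ has finite Morse index. (2) If $\limsup_{t\to0^+}R(t)<-1/4$, then every self-adjoint extension of (the minimal operator of) $l_R$ has infinite Morse index.
   Context: The minimal operator is the closure of $l_R$ on $C_0^\infty((0,1),\mathbb{R}^n)$ in $L^2((0,1),\mathbb{R}^n)$. For symmetric-matrix-valued $R$: $\liminf_{t\to0^+}R(t)>-1/4$ means that the $\liminf$ of the smallest eigenvalue of $R(t)$ is $>-1/4$; $\limsup_{t\to0^+}R(t)<-1/4$ means that the $\limsup$ of the largest eigenvalue of $R(t)$ is $<-1/4$. The Morse index of a self-adjoint operator is the maximal dimension (possibly $+\infty$) of its negative spectral subspace. *)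

theory Defs
  imports "HOL-Analysis.Analysis"
begin

definition square_integrable :: "(real \<Rightarrow> 'a::euclidean_space) \<Rightarrow> bool" where
  "square_integrable f \<longleftrightarrow>
     f \<in> borel_measurable (lebesgue_on {0<..<1}) \<and>
     integrable (lebesgue_on {0<..<1}) (\<lambda>t. (norm (f t))\<^sup>2)"

definition L2_rel :: "(real \<Rightarrow> 'a::euclidean_space) \<Rightarrow> (real \<Rightarrow> 'a) \<Rightarrow> bool" where
  "L2_rel f g \<longleftrightarrow> square_integrable f \<and> square_integrable g \<and>
     (AE t in lebesgue_on {0<..<1}. f t = g t)"

lemma square_integrable_zero: "square_integrable (\<lambda>_. 0)"
  by (simp add: square_integrable_def)

lemma square_integrable_add:
  assumes "square_integrable f" "square_integrable g"
  shows "square_integrable (\<lambda>t. f t + g t)"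
proof -
  have bound: "(norm (a + b))\<^sup>2 \<le> 2 * (norm a)\<^sup>2 + 2 * (norm b)\<^sup>2" for a b :: 'a
  proof -
    have "(norm (a + b))\<^sup>2 \<le> (norm a + norm b)\<^sup>2"
      by (intro power_mono norm_triangle_ineq) auto
    also have "\<dots> \<le> 2 * (norm a)\<^sup>2 + 2 * (norm b)\<^sup>2"
      using sum_squares_bound[of "norm a" "norm b"] by (simp add: power2_sum)
    finally show ?thesis .
  qed
  have "integrable (lebesgue_on {0<..<1}) (\<lambda>t. (norm (f t + g t))\<^sup>2)"
    by (rule Bochner_Integration.integrable_bound
          [where f = "\<lambda>t. 2 * (norm (f t))\<^sup>2 + 2 * (norm (g t))\<^sup>2"])
       (use assms bound in \<open>auto simp: square_integrable_def\<close>)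
  then show ?thesis
    using assms by (auto simp: square_integrable_def)
qed

lemma square_integrable_scaleR:
  "square_integrable f \<Longrightarrow> square_integrable (\<lambda>t. c *\<^sub>R f t)"
  by (auto simp: square_integrable_def power_mult_distrib)

lemma integrable_inner_square:
  fixes f g :: "real \<Rightarrow> 'a::euclidean_space"
  assumes "square_integrable f" "square_integrable g"
  shows "integrable (lebesgue_on {0<..<1}) (\<lambda>t. inner (f t) (g t))"
proof (rule Bochner_Integration.integrable_bound
    [where f = "\<lambda>t. (norm (f t))\<^sup>2 + (norm (g t))\<^sup>2"])
  have bound: "\<bar>inner a b\<bar> \<le> (norm a)\<^sup>2 + (norm b)\<^sup>2" for a b :: 'a
  proof -
    have "\<bar>inner a b\<bar> \<le> norm a * norm b"
      by (rule Cauchy_Schwarz_ineq2)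
    also have "\<dots> \<le> 2 * norm a * norm b"
      by simp
    also have "\<dots> \<le> (norm a)\<^sup>2 + (norm b)\<^sup>2"
      by (rule sum_squares_bound)
    finally show ?thesis .
  qed
  show "AE t in lebesgue_on {0<..<1}.
      norm (inner (f t) (g t)) \<le> norm ((norm (f t))\<^sup>2 + (norm (g t))\<^sup>2)"
    using bound by (auto intro!: AE_I2)
qed (use assms in \<open>auto simp: square_integrable_def\<close>)

quotient_type (overloaded) 'a L2 = "real \<Rightarrow> 'a::euclidean_space" / partial: L2_rel
  morphisms rep_L2 to_L2
proof (rule part_equivpI)
  show "\<exists>f::real \<Rightarrow> 'a. L2_rel f f"
    by (auto simp: L2_rel_def intro!: exI[of _ "\<lambda>_. 0"] square_integrable_zero)
  show "symp (L2_rel :: (real \<Rightarrow> 'a) \<Rightarrow> _)"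
    by (auto simp: L2_rel_def symp_def)
  show "transp (L2_rel :: (real \<Rightarrow> 'a) \<Rightarrow> _)"
    unfolding L2_rel_def transp_def by (auto elim!: AE_mp)
qed

instantiation L2 :: (euclidean_space) real_vector
begin

lift_definition zero_L2 :: "'a L2" is "\<lambda>_. 0"
  by (simp add: L2_rel_def square_integrable_zero)

lift_definition plus_L2 :: "'a L2 \<Rightarrow> 'a L2 \<Rightarrow> 'a L2" is "\<lambda>f g t. f t + g t"
  unfolding L2_rel_def by (auto simp: square_integrable_add)

lift_definition scaleR_L2 :: "real \<Rightarrow> 'a L2 \<Rightarrow> 'a L2" is "\<lambda>c f t. c *\<^sub>R f t"
  unfolding L2_rel_def by (auto simp: square_integrable_scaleR)

definition uminus_L2 :: "'a L2 \<Rightarrow> 'a L2" where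
  "uminus_L2 f = (-1) *\<^sub>R f"

definition minus_L2 :: "'a L2 \<Rightarrow> 'a L2 \<Rightarrow> 'a L2" where
  "minus_L2 f g = f + - g"

instance
proof
  fix a b c :: "'a L2" and x y :: real
  show "a + b + c = a + (b + c)"
    by transfer (auto simp: L2_rel_def add.assoc intro!: square_integrable_add)
  show "a + b = b + a"
    by transfer (auto simp: L2_rel_def add.commute intro!: square_integrable_add)
  show "0 + a = a"
    by transfer (auto simp: L2_rel_def)
  show "- a + a = 0"
    unfolding uminus_L2_def
    by transfer (auto simp: L2_rel_def square_integrable_zero)
  show "a - b = a + - b"
    by (simp add: minus_L2_def)
  show "x *\<^sub>R (a + b) = x *\<^sub>R a + x *\<^sub>R b"
    by transfer (auto simp: L2_rel_def scaleR_add_right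
        intro!: square_integrable_add square_integrable_scaleR)
  show "(x + y) *\<^sub>R a = x *\<^sub>R a + y *\<^sub>R a"
    by transfer (auto simp: L2_rel_def scaleR_add_left simp flip: scaleR_add_left
        intro!: square_integrable_add square_integrable_scaleR)
  show "x *\<^sub>R y *\<^sub>R a = (x * y) *\<^sub>R a"
    by transfer (auto simp: L2_rel_def intro!: square_integrable_scaleR)
  show "1 *\<^sub>R a = a"
    by transfer (auto simp: L2_rel_def)
qed

end

instantiation L2 :: (euclidean_space) real_inner
begin

lift_definition inner_L2 :: "'a L2 \<Rightarrow> 'a L2 \<Rightarrow> real" is
  "\<lambda>f g. \<integral>t. inner (f t) (g t) \<partial>lebesgue_on {0<..<1}"
  unfolding L2_rel_def square_integrable_def
  by (intro integral_cong_AE) (auto elim: AE_mp)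

definition norm_L2 :: "'a L2 \<Rightarrow> real" where
  "norm_L2 f = sqrt (inner f f)"

definition sgn_L2 :: "'a L2 \<Rightarrow> 'a L2" where
  "sgn_L2 f = inverse (norm f) *\<^sub>R f"

definition dist_L2 :: "'a L2 \<Rightarrow> 'a L2 \<Rightarrow> real" where
  "dist_L2 f g = norm (f - g)"

definition uniformity_L2 :: "('a L2 \<times> 'a L2) filter" where
  "uniformity_L2 = (INF e\<in>{0<..}. principal {(f, g). dist f g < e})"

definition open_L2 :: "'a L2 set \<Rightarrow> bool" where
  "open_L2 U \<longleftrightarrow> (\<forall>f\<in>U. eventually (\<lambda>(f', g). f' = f \<longrightarrow> g \<in> U) uniformity)"

instance
proof
  fix a b c :: "'a L2" and x :: real
  show "dist a b = norm (a - b)"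
    by (rule dist_L2_def)
  show "sgn a = inverse (norm a) *\<^sub>R a"
    by (rule sgn_L2_def)
  show "(uniformity :: ('a L2 \<times> 'a L2) filter)
      = (INF e\<in>{0<..}. principal {(f, g). dist f g < e})"
    by (rule uniformity_L2_def)
  show "open U \<longleftrightarrow> (\<forall>f\<in>U. eventually (\<lambda>(f', g). f' = f \<longrightarrow> g \<in> U) uniformity)"
    for U :: "'a L2 set"
    by (rule open_L2_def)
  show "inner a b = inner b a"
    by transfer (simp add: inner_commute)
  show "inner (a + b) c = inner a c + inner b c"
    by transfer (simp add: L2_rel_def inner_add_left integrable_inner_square)
  show "inner (x *\<^sub>R a) b = x * inner a b"
    by transfer (simp add: L2_rel_def)
  show "0 \<le> inner a a"
    by transfer simp
  show "inner a a = 0 \<longleftrightarrow> a = 0"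
  proof transfer
    fix f :: "real \<Rightarrow> 'a"
    assume f: "L2_rel f f"
    then have "(\<integral>t. inner (f t) (f t) \<partial>lebesgue_on {0<..<1}) = 0
        \<longleftrightarrow> (AE t in lebesgue_on {0<..<1}. inner (f t) (f t) = 0)"
      by (intro integral_nonneg_eq_0_iff_AE integrable_inner_square) (auto simp: L2_rel_def)
    also have "\<dots> \<longleftrightarrow> L2_rel f (\<lambda>_. 0)"
      using f by (auto simp: L2_rel_def square_integrable_zero)
    finally show "(\<integral>t. inner (f t) (f t) \<partial>lebesgue_on {0<..<1}) = 0
        \<longleftrightarrow> L2_rel f (\<lambda>_. 0)" .
  qed
  show "norm a = sqrt (inner a a)"
    by (rule norm_L2_def)
qed

end

text \<open>An unbounded operator is represented by its graph; \<open>Domain\<close> is its domain and inclusion is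
  extension.\<close>

definition linear_operator :: "('h::real_inner \<times> 'h) set \<Rightarrow> bool" where
  "linear_operator A \<longleftrightarrow> subspace A \<and> single_valued A"

definition adjoint_operator :: "('h::real_inner \<times> 'h) set \<Rightarrow> ('h \<times> 'h) set" where
  "adjoint_operator A = {(v, w). \<forall>(u, z)\<in>A. inner z v = inner u w}"

definition self_adjoint :: "('h::real_inner \<times> 'h) set \<Rightarrow> bool" where
  "self_adjoint A \<longleftrightarrow>
     linear_operator A \<and> closure (Domain A) = UNIV \<and> adjoint_operator A = A"

definition self_adjoint_extension ::
    "('h::real_inner \<times> 'h) set \<Rightarrow> ('h \<times> 'h) set \<Rightarrow> bool" where
  "self_adjoint_extension T A \<longleftrightarrow> self_adjoint A \<and> T \<subseteq> A"

definition orthogonal_projection :: "('h::real_inner \<Rightarrow> 'h) \<Rightarrow> bool" where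
  "orthogonal_projection P \<longleftrightarrow>
     linear P \<and> (\<forall>u. P (P u) = P u) \<and> (\<forall>u v. inner (P u) v = inner u (P v))"

definition projection_valued_measure :: "(real set \<Rightarrow> 'h::real_inner \<Rightarrow> 'h) \<Rightarrow> bool" where
  "projection_valued_measure E \<longleftrightarrow>
     (\<forall>B\<in>sets borel. orthogonal_projection (E B)) \<and>
     E {} = (\<lambda>_. 0) \<and> E UNIV = id \<and>
     (\<forall>B\<in>sets borel. \<forall>C\<in>sets borel. E (B \<inter> C) = E B \<circ> E C) \<and>
     (\<forall>B u. range B \<subseteq> sets borel \<longrightarrow> disjoint_family B \<longrightarrow>
        (\<lambda>i::nat. E (B i) u) sums E (\<Union>i. B i) u)"

definition scalar_measure :: "(real set \<Rightarrow> 'h::real_inner \<Rightarrow> 'h) \<Rightarrow> 'h \<Rightarrow> real measure" where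
  "scalar_measure E u = measure_of UNIV (sets borel) (\<lambda>B. ennreal (inner (E B u) u))"

text \<open>For self-adjoint \<open>A\<close> this says that \<open>A\<close> is the integral of the identity function
  against \<open>E\<close>: both operators are symmetric and have the same domain, so by polarization it
  suffices to compare their quadratic forms. The spectral theorem provides a unique such \<open>E\<close>
  (on Borel sets).\<close>

definition spectral_measure_of ::
    "('h::real_inner \<times> 'h) set \<Rightarrow> (real set \<Rightarrow> 'h \<Rightarrow> 'h) \<Rightarrow> bool" where
  "spectral_measure_of A E \<longleftrightarrow>
     projection_valued_measure E \<and>
     Domain A = {u. integrable (scalar_measure E u) (\<lambda>x. x\<^sup>2)} \<and>
     (\<forall>(u, w)\<in>A. inner w u = (\<integral>x. x \<partial>scalar_measure E u))"

text \<open>The library constant \<open>dim\<close> is \<open>0\<close> on infinite-dimensional spaces.\<close>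

definition extended_dim :: "'h::real_vector set \<Rightarrow> enat" where
  "extended_dim V = (SUP B\<in>{B. B \<subseteq> V \<and> finite B \<and> independent B}. enat (card B))"

text \<open>The argument is the spectral measure of the operator; \<open>range (E {..<0})\<close> is the negative
  spectral subspace.\<close>

definition morse_index :: "(real set \<Rightarrow> 'h::real_inner \<Rightarrow> 'h) \<Rightarrow> enat" where
  "morse_index E = extended_dim (range (E {..<0}))"

definition vderiv :: "(real \<Rightarrow> 'a::real_normed_vector) \<Rightarrow> real \<Rightarrow> 'a" where
  "vderiv f = (\<lambda>t. vector_derivative f (at t))"

definition smooth :: "(real \<Rightarrow> 'a::real_normed_vector) \<Rightarrow> bool" where
  "smooth f \<longleftrightarrow> (\<forall>k t. (vderiv ^^ k) f differentiable at t)"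

text \<open>Functions on \<open>(0,1)\<close> with compact support there, extended by zero to the real line.\<close>

definition test_functions :: "(real \<Rightarrow> 'a::real_normed_vector) set" where
  "test_functions =
     {\<phi>. smooth \<phi> \<and> compact (closure {t. \<phi> t \<noteq> 0}) \<and> closure {t. \<phi> t \<noteq> 0} \<subseteq> {0<..<1}}"

definition bessel_expression ::
    "(real \<Rightarrow> real^'n^'n) \<Rightarrow> (real \<Rightarrow> real^'n) \<Rightarrow> real \<Rightarrow> real^'n" where
  "bessel_expression R \<phi> t = - vderiv (vderiv \<phi>) t + (1 / t\<^sup>2) *\<^sub>R (R t *v \<phi> t)"

text \<open>The closure is that of the graph in the product topology. Both entries of each pair are
  square-integrable, so \<open>to_L2\<close> is only applied to functions in its domain.\<close>

definition minimal_operator ::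
    "(real \<Rightarrow> real^'n^'n) \<Rightarrow> ((real^'n) L2 \<times> (real^'n) L2) set" where
  "minimal_operator R =
     closure ((\<lambda>\<phi>. (to_L2 \<phi>, to_L2 (bessel_expression R \<phi>))) ` test_functions)"

definition eigenvalues :: "real^'n^'n \<Rightarrow> real set" where
  "eigenvalues M = {c. \<exists>v. v \<noteq> 0 \<and> M *v v = c *\<^sub>R v}"

definition smallest_eigenvalue :: "real^'n^'n \<Rightarrow> real" where
  "smallest_eigenvalue M = Min (eigenvalues M)"

definition largest_eigenvalue :: "real^'n^'n \<Rightarrow> real" where
  "largest_eigenvalue M = Max (eigenvalues M)"

end

theory Submission
  imports Defs "HOL-Computational_Algebra.Polynomial"
begin

text \<open>The threshold comes from Hardy's inequality: the integral of \<open>\<bar>\<phi>'\<bar>\<^sup>2\<close> is at least that of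
  \<open>\<bar>\<phi>\<bar>\<^sup>2 / (4 t\<^sup>2)\<close>, and the constant \<open>1/4\<close> is sharp. The two halves of the theorem have different proofs.

  Above the threshold, restrict the minimal operator to test functions that vanish at finitely many
  cut points. Near \<open>0\<close> the form is bounded below by a positive constant thanks to Hardy's inequality. Away from \<open>0\<close>
  the potential is bounded, and Poincare's inequality beats it on sufficiently short intervals. So the
  restricted form is coercive (\<open>form_coercive_of_Riccati\<close>). The range of the restricted operator still has
  finite codimension in the following sense: a function orthogonal to it solves the homogeneous equation
  weakly on each of the finitely many intervals, and is determined there by \<open>2 n\<close> numbers
  (\<open>finite_dim_annihilator\<close>). Now let \<open>A\<close> be a
  self-adjoint extension and let \<open>V\<close> be the union of its spectral subspaces for the intervals \<open>[-N, 0)\<close>;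
  the form of \<open>A\<close> is negative on \<open>V\<close> outside \<open>0\<close>. If \<open>A v\<close>, for \<open>v\<close> in \<open>V\<close>, is a limit of values \<open>T \<phi>\<close> of the
  restricted operator, then coercivity and symmetry make the form at \<open>v\<close> a limit of nonnegative numbers
  (\<open>form_nonneg_of_closure_range\<close>), hence \<open>v = 0\<close>. So \<open>A\<close> embeds \<open>V\<close> into a space of finite dimension, and \<open>V\<close>
  is then the whole negative spectral subspace (\<open>finite_morse_index\<close>). The extension enters
  through its symmetry and its spectral measure alone, whatever its boundary condition. Completeness of \<open>L\<^sup>2\<close> enters when
  the closure of the range is identified with its biorthogonal.

  Below the threshold, the substitution \<open>t = exp s\<close>, \<open>\<phi> = sqrt t \<cdot> h (s)\<close> turns the scalar form with potential
  \<open>c / t\<^sup>2\<close> into the form of \<open>- h'' + (c + 1/4) h\<close>, which is negative for slowly varying \<open>h\<close>. Translations in \<open>s\<close>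
  produce infinitely many test functions near \<open>0\<close> with disjoint supports and negative form. If the negative
  spectral subspace had finite dimension, some nonzero combination of them would be orthogonal to it,
  and the form would be nonnegative there (\<open>infinite_morse_index\<close>).\<close>

section \<open>Spectral measures\<close>

lemma orthogonal_projectionD:
  assumes "orthogonal_projection P"
  shows "linear P" "P (P u) = P u" "inner (P u) v = inner u (P v)" "inner (P u) u = (norm (P u))\<^sup>2"
  using assms unfolding orthogonal_projection_def power2_norm_eq_inner by metis+

context
  fixes E :: "real set \<Rightarrow> 'h::real_inner \<Rightarrow> 'h"
  assumes E: "projection_valued_measure E"
begin

lemma pvm_projection: "B \<in> sets borel \<Longrightarrow> orthogonal_projection (E B)"
  using E by (simp add: projection_valued_measure_def)

lemma pvm_Int: "B \<in> sets borel \<Longrightarrow> C \<in> sets borel \<Longrightarrow> E (B \<inter> C) u = E B (E C u)"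
  using E by (simp add: projection_valued_measure_def)

lemma pvm_empty: "E {} u = 0" and pvm_UNIV: "E UNIV u = u"
  using E by (simp_all add: projection_valued_measure_def)

lemma pvm_sums:
  "range B \<subseteq> sets borel \<Longrightarrow> disjoint_family B \<Longrightarrow> (\<lambda>i::nat. E (B i) u) sums E (\<Union>i. B i) u"
  using E by (simp add: projection_valued_measure_def)

lemma pvm_inner_nonneg: "B \<in> sets borel \<Longrightarrow> 0 \<le> inner (E B u) u"
  by (simp add: orthogonal_projectionD(4)[OF pvm_projection])

lemma space_scalar_measure [simp]: "space (scalar_measure E u) = UNIV"
  by (simp add: scalar_measure_def space_measure_of_conv)

lemma sets_scalar_measure [simp]: "sets (scalar_measure E u) = sets borel"
  using sets.sigma_sets_eq[of "borel :: real measure"]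
  by (simp add: scalar_measure_def sets_measure_of_conv)

lemma emeasure_scalar_measure:
  assumes B: "B \<in> sets borel"
  shows "emeasure (scalar_measure E u) B = ennreal (inner (E B u) u)"
  unfolding scalar_measure_def
proof (rule emeasure_measure_of_sigma)
  show "sigma_algebra UNIV (sets (borel :: real measure))"
    using sets.sigma_algebra_axioms[of "borel :: real measure"] by simp
  show "positive (sets borel) (\<lambda>B. ennreal (inner (E B u) u))"
    by (simp add: positive_def pvm_empty)
  show "countably_additive (sets borel) (\<lambda>B. ennreal (inner (E B u) u))"
  proof (rule countably_additiveI)
    fix C :: "nat \<Rightarrow> real set"
    assume C: "range C \<subseteq> sets borel" "disjoint_family C"
    have "(\<lambda>i. inner (E (C i) u) u) sums inner (E (\<Union>i. C i) u) u"
      by (rule bounded_linear.sums[OF bounded_linear_inner_left pvm_sums[OF C]])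
    moreover have "\<And>i. 0 \<le> inner (E (C i) u) u"
      using C by (auto intro: pvm_inner_nonneg)
    ultimately show "(\<Sum>i. ennreal (inner (E (C i) u) u)) = ennreal (inner (E (\<Union>i. C i) u) u)"
      by (simp add: suminf_ennreal2 sums_iff)
  qed
qed (use B in auto)

lemma finite_measure_scalar_measure: "finite_measure (scalar_measure E u)"
  by (rule finite_measureI) (simp add: emeasure_scalar_measure)

lemma pvm_Compl_eq_0:
  assumes "B \<in> sets borel" "C \<in> sets borel" "B \<inter> C = {}" "E C u = u"
  shows "E B u = 0"
  using pvm_Int[OF assms(1,2)] assms(3,4) pvm_empty by metis

lemma AE_scalar_measure:
  assumes "B \<in> sets borel" "E B u = 0"
  shows "AE x in scalar_measure E u. x \<notin> B"
  by (rule AE_I[where N = B]) (use assms in \<open>auto simp: emeasure_scalar_measure\<close>)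

text \<open>Truncating at \<open>-N\<close> exhausts the negative half-line, so countable additivity gives strong
  convergence of the spectral projections.\<close>

lemma pvm_negative_tendsto:
  "(\<lambda>N. E {- real N..<0} u) \<longlonglongrightarrow> E {..<0} u"
proof -
  define C where "C = (\<lambda>i::nat. {- real (Suc i)..<- real i})"
  have C_borel: "range C \<subseteq> sets borel" by (auto simp: C_def)
  have "disjoint_family C"
    unfolding disjoint_family_on_def
  proof (intro ballI impI)
    fix i j :: nat assume "i \<noteq> j"
    then have "real i \<ge> real j + 1 \<or> real j \<ge> real i + 1"
      by linarith
    then show "C i \<inter> C j = {}" by (auto simp: C_def)
  qed
  moreover have "(\<Union>i. C i) = {..<0}"
  proof (safe)
    fix x :: real assume x: "x < 0"
    obtain n :: nat where n: "- x \<le> real n" using real_arch_simple by blast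
    define m where "m = (LEAST n. - x \<le> real n)"
    have m: "- x \<le> real m" unfolding m_def by (rule LeastI[where P = "\<lambda>n. - x \<le> real n", OF n])
    with x obtain k where k: "m = Suc k" by (cases m) auto
    have "\<not> - x \<le> real k" by (rule not_less_Least) (simp add: k flip: m_def)
    then show "x \<in> (\<Union>i. C i)" using m k by (intro UN_I[of k]) (auto simp: C_def)
  qed (auto simp: C_def)
  ultimately have sums: "(\<lambda>i. E (C i) u) sums E {..<0} u"
    using pvm_sums[OF C_borel, of u] by simp
  have "E {- real N..<0} u = (\<Sum>i<N. E (C i) u)" for N
  proof (induction N)
    case 0
    then show ?case by (simp add: pvm_empty)
  next
    case (Suc N)
    \<comment> \<open>finite additivity for two disjoint sets, from the countable one padded with empty sets\<close>
    define D where "D = (\<lambda>i::nat. if i = 0 then {- real N..<0} else if i = 1 then C N else {})"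
    have "disjoint_family D"
      by (auto simp: disjoint_family_on_def D_def C_def)
    moreover have "D i \<in> sets borel" for i
      using range_subsetD[OF C_borel, of N] by (simp add: D_def)
    ultimately have s1: "(\<lambda>i. E (D i) u) sums E (\<Union>i. D i) u" by (intro pvm_sums image_subsetI)
    have s2: "(\<lambda>i. E (D i) u) sums (\<Sum>i\<in>{0,1}. E (D i) u)"
      by (rule sums_finite) (auto simp: D_def pvm_empty)
    have s3: "(\<Union>i. D i) = {- real (Suc N)..<0}"
    proof -
      have "(\<Union>i. D i) = {- real N..<0} \<union> C N"
        by (auto simp: D_def split: if_splits)
      also have "\<dots> = {- real (Suc N)..<0}" by (auto simp: C_def)
      finally show ?thesis .
    qed
    have "E {- real (Suc N)..<0} u = (\<Sum>i\<in>{0,1}. E (D i) u)"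
      using sums_unique2[OF s1 s2] by (simp only: s3)
    then show ?case using Suc by (simp add: D_def)
  qed
  then show ?thesis using sums by (simp add: sums_def)
qed

end

lemma scalar_integral_nonneg:
  assumes "projection_valued_measure E" "E {..<0} u = 0"
  shows "0 \<le> (\<integral>x. x \<partial>scalar_measure E u)"
proof (rule integral_nonneg_AE)
  show "AE x in scalar_measure E u. 0 \<le> x"
    using AE_scalar_measure[OF assms(1) _ assms(2)] by (auto simp: not_less)
qed

text \<open>A negative spectral vector need not lie in the domain of the operator, so its form
  need not make sense. Vectors supported on a bounded part of the spectrum avoid this.\<close>

lemma
  assumes E: "projection_valued_measure E" and u: "E {- real N..<0} u = u"
  shows truncated_in_domain: "integrable (scalar_measure E u) (\<lambda>x. x\<^sup>2)"
    and truncated_integral_neg: "u \<noteq> 0 \<Longrightarrow> (\<integral>x. x \<partial>scalar_measure E u) < 0"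
proof -
  interpret finite_measure "scalar_measure E u"
    by (rule finite_measure_scalar_measure[OF E])
  have meas: "borel_measurable (scalar_measure E u) = borel_measurable borel"
    by (rule measurable_cong_sets) (simp_all add: E)
  have "E (- {- real N..<0}) u = 0"
    by (rule pvm_Compl_eq_0[OF E _ _ _ u]) auto
  then have AE: "AE x in scalar_measure E u. - real N \<le> x \<and> x < 0"
    using AE_scalar_measure[OF E, of "- {- real N..<0}" u] by auto
  have "AE x in scalar_measure E u. norm (x\<^sup>2) \<le> (real N)\<^sup>2"
    using AE by eventually_elim (simp add: abs_le_square_iff[symmetric])
  then show "integrable (scalar_measure E u) (\<lambda>x. x\<^sup>2)"
    by (intro integrable_const_bound) (auto simp: meas)
  have "AE x in scalar_measure E u. norm x \<le> real N"
    using AE by eventually_elim simp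
  then have int: "integrable (scalar_measure E u) (\<lambda>x. - x)"
    by (intro integrable_const_bound[where B = "real N"]) (auto simp: meas)
  assume "u \<noteq> 0"
  have nn: "AE x in scalar_measure E u. 0 \<le> - x"
    using AE by eventually_elim simp
  have "(\<integral>x. - x \<partial>scalar_measure E u) \<noteq> 0"
  proof
    assume "(\<integral>x. - x \<partial>scalar_measure E u) = 0"
    then have "AE x in scalar_measure E u. - x = 0"
      using integral_nonneg_eq_0_iff_AE[OF int nn] by simp
    with AE have "AE x in scalar_measure E u. False" by eventually_elim simp
    then have "emeasure (scalar_measure E u) UNIV = 0"
      using E by (simp add: AE_iff_measurable[OF _ refl])
    then show False
      using \<open>u \<noteq> 0\<close> by (simp add: E emeasure_scalar_measure[OF E] pvm_UNIV[OF E])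
  qed
  moreover have "(\<integral>x. - x \<partial>scalar_measure E u) \<ge> 0"
    using nn by (rule integral_nonneg_AE)
  ultimately show "(\<integral>x. x \<partial>scalar_measure E u) < 0" by simp
qed

section \<open>Finite-dimensional spans and the extended dimension\<close>

lemma extended_dim_lt_infinity:
  assumes "finite C" "V \<subseteq> span C"
  shows "extended_dim V < \<infinity>"
proof -
  have "card B \<le> card C" if "B \<subseteq> V" "independent B" for B
    using independent_span_bound[OF assms(1) that(2)] that(1) assms(2) by auto
  then have "extended_dim V \<le> enat (card C)"
    unfolding extended_dim_def by (intro SUP_least) auto
  then show ?thesis using enat_ord_code(4) le_less_trans by blast
qed

text \<open>The relation is between members of a family, which may repeat: distinct test functions may well
  have the same projection to the negative spectral subspace.\<close>

lemma finite_extended_dim_relation: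
  assumes fin: "extended_dim V \<noteq> \<infinity>" and V: "\<And>k. x k \<in> V"
  obtains a :: "nat \<Rightarrow> real" and N where "(\<Sum>k<N. a k *\<^sub>R x k) = 0" "\<exists>k<N. a k \<noteq> 0"
proof -
  obtain m where m: "extended_dim V = enat m" using fin by auto
  have bd: "card B \<le> m" if "B \<subseteq> V" "finite B" "independent B" for B
  proof -
    have "enat (card B) \<le> extended_dim V"
      unfolding extended_dim_def by (rule SUP_upper) (use that in auto)
    then show ?thesis by (simp add: m)
  qed
  define N where "N = Suc m"
  show thesis
  proof (cases "inj_on x {..<N}")
    case False
    then obtain i j where ij: "i < N" "j < N" "i \<noteq> j" "x i = x j" by (auto simp: inj_on_def)
    show thesis
    proof (rule that[of "\<lambda>k. (if k = i then 1 else 0) - (if k = j then 1 else 0)" N])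
      have "(\<Sum>k<N. ((if k = i then 1 else 0) - (if k = j then 1 else 0)) *\<^sub>R x k)
          = (\<Sum>k<N. if k = i then x k else 0) - (\<Sum>k<N. if k = j then x k else 0)"
        unfolding sum_subtractf[symmetric] by (rule sum.cong) (auto simp: algebra_simps)
      then show "(\<Sum>k<N. ((if k = i then 1 else 0) - (if k = j then 1 else 0)) *\<^sub>R x k) = 0"
        using ij by simp
    qed (use ij in auto)
  next
    case True
    have "\<not> independent (x ` {..<N})"
      using bd[of "x ` {..<N}"] V card_image[OF True] by (auto simp: N_def)
    then obtain u where u: "\<exists>v\<in>x ` {..<N}. u v \<noteq> 0" "(\<Sum>v\<in>x ` {..<N}. u v *\<^sub>R v) = 0"
      using dependent_finite[of "x ` {..<N}"] by auto
    show thesis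
      by (rule that[of "\<lambda>k. u (x k)" N]) (use u True in \<open>auto simp: sum.reindex\<close>)
  qed
qed

text \<open>Rank-nullity for a linear relation \<open>Z\<close>, which need not be single valued: a linear
  parametrisation of vectors by data from a finite-dimensional space is finite-dimensional as soon
  as its vectors with zero data are.\<close>

lemma finite_dim_of_linear_relation:
  assumes Z: "subspace Z" and B: "finite B" "{u. (u, 0) \<in> Z} \<subseteq> span B"
    and C: "finite C" "snd ` Z \<subseteq> span C"
  obtains B' where "finite B'" "fst ` Z \<subseteq> span B'"
proof -
  obtain D where D: "D \<subseteq> snd ` Z" "independent D" "snd ` Z \<subseteq> span D"
    using maximal_independent_subset[of "snd ` Z"] by auto
  have finD: "finite D"
    using independent_span_bound[OF C(1) D(2)] D(1) C(2) by auto
  obtain g where g: "\<And>d. d \<in> D \<Longrightarrow> (g d, d) \<in> Z"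
  proof -
    have "\<exists>v. (v, d) \<in> Z" if "d \<in> D" for d using that D(1) by (force simp: subset_iff image_iff)
    then show thesis using that by metis
  qed
  show thesis
  proof (rule that[of "B \<union> g ` D"])
    show "fst ` Z \<subseteq> span (B \<union> g ` D)"
    proof safe
      fix u w assume uw: "(u, w) \<in> Z"
      then have "w \<in> span D" using D(3) by force
      then obtain a where a: "w = (\<Sum>d\<in>D. a d *\<^sub>R d)"
        unfolding span_finite[OF finD] by auto
      have "(\<Sum>d\<in>D. a d *\<^sub>R (g d, d)) \<in> Z"
        by (intro subspace_sum subspace_mul Z g)
      then have "((\<Sum>d\<in>D. a d *\<^sub>R g d), w) \<in> Z"
        by (simp add: a scaleR_Pair sum_prod)
      then have "(u - (\<Sum>d\<in>D. a d *\<^sub>R g d), 0) \<in> Z"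
        using subspace_diff[OF Z uw] by fastforce
      then have "u - (\<Sum>d\<in>D. a d *\<^sub>R g d) \<in> span (B \<union> g ` D)"
        using B(2) span_mono[of B "B \<union> g ` D"] by auto
      moreover have "(\<Sum>d\<in>D. a d *\<^sub>R g d) \<in> span (B \<union> g ` D)"
        by (intro span_sum span_scale span_base) auto
      ultimately have "(u - (\<Sum>d\<in>D. a d *\<^sub>R g d)) + (\<Sum>d\<in>D. a d *\<^sub>R g d) \<in> span (B \<union> g ` D)"
        by (rule span_add)
      then show "fst (u, w) \<in> span (B \<union> g ` D)" by simp
    qed
  qed (use finD B(1) in auto)
qed

section \<open>Orthogonal complements\<close>

text \<open>The projection theorem. A sequence in \<open>S\<close> minimising the distance to \<open>y\<close> is Cauchy by the
  parallelogram law; for its limit \<open>p\<close>, the difference \<open>y - p\<close> is orthogonal to \<open>S\<close>, hence to \<open>y\<close> and to \<open>p\<close>.\<close>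

lemma biorthogonal_in_closure:
  fixes S :: "'h::{real_inner,complete_space} set"
  assumes S: "subspace S"
    and y: "\<And>k. (\<And>s. s \<in> S \<Longrightarrow> inner k s = 0) \<Longrightarrow> inner y k = 0"
  shows "y \<in> closure S"
proof -
  have ne: "S \<noteq> {}" using subspace_0[OF S] by auto
  define d where "d = infdist y S"
  have lower: "d \<le> norm (y - s)" if "s \<in> S" for s
    using infdist_le[OF that, of y] by (simp add: d_def dist_norm)
  have "\<exists>s\<in>S. norm (y - s) < d + 1 / Suc n" for n :: nat
  proof -
    have "infdist y S < d + 1 / Suc n" by (simp add: d_def)
    moreover have "bdd_below (dist y ` S)" by (rule bdd_belowI2[where m = 0]) simp
    ultimately show ?thesis
      using cINF_less_iff[OF ne, of "dist y" "d + 1 / Suc n"] ne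
      by (simp add: infdist_notempty dist_norm)
  qed
  then obtain s where s: "\<And>n. s n \<in> S" "\<And>n::nat. norm (y - s n) < d + 1 / Suc n"
    by metis
  have d0: "d \<ge> 0" by (simp add: d_def infdist_nonneg)
  \<comment> \<open>parallelogram law at the midpoint of two members of the minimising sequence\<close>
  have par: "(norm (s m - s n))\<^sup>2 \<le> 2 * (norm (y - s m))\<^sup>2 + 2 * (norm (y - s n))\<^sup>2 - 4 * d\<^sup>2" for m n
  proof -
    have "(1/2) *\<^sub>R (s m + s n) \<in> S"
      by (intro subspace_mul subspace_add S s)
    from lower[OF this] have "d\<^sup>2 \<le> (norm (y - (1/2) *\<^sub>R (s m + s n)))\<^sup>2"
      using d0 by (simp add: power_mono)
    then show ?thesis
      by (simp add: power2_norm_eq_inner algebra_simps inner_commute)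
  qed
  have lim: "(\<lambda>n. norm (y - s n)) \<longlonglongrightarrow> d"
  proof (rule real_tendsto_sandwich[OF _ _ tendsto_const])
    show "(\<lambda>n. d + 1 / real (Suc n)) \<longlonglongrightarrow> d"
      using tendsto_add[OF tendsto_const LIMSEQ_Suc[OF lim_1_over_n], of d] by simp
    show "\<forall>\<^sub>F n in sequentially. d \<le> norm (y - s n)"
      using lower[OF s(1)] by (simp add: always_eventually)
    show "\<forall>\<^sub>F n in sequentially. norm (y - s n) \<le> d + 1 / real (Suc n)"
      using s(2) by (intro always_eventually allI less_imp_le)
  qed
  have "Cauchy s"
  proof (rule metric_CauchyI)
    fix e :: real assume e: "e > 0"
    have "(\<lambda>n. (norm (y - s n))\<^sup>2) \<longlonglongrightarrow> d\<^sup>2" by (intro tendsto_power lim)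
    then have "\<forall>\<^sub>F n in sequentially. (norm (y - s n))\<^sup>2 < d\<^sup>2 + e\<^sup>2 / 4"
      using e by (intro order_tendstoD) auto
    then obtain M where M: "\<And>n. n \<ge> M \<Longrightarrow> (norm (y - s n))\<^sup>2 < d\<^sup>2 + e\<^sup>2 / 4"
      by (auto simp: eventually_sequentially)
    have "dist (s m) (s n) < e" if "m \<ge> M" "n \<ge> M" for m n
    proof -
      have "(norm (s m - s n))\<^sup>2 < e\<^sup>2"
        using par[of m n] M[OF that(1)] M[OF that(2)] by linarith
      then show ?thesis using e by (simp add: dist_norm power2_less_imp_less)
    qed
    then show "\<exists>M. \<forall>m\<ge>M. \<forall>n\<ge>M. dist (s m) (s n) < e" by blast
  qed
  then obtain p where p: "s \<longlonglongrightarrow> p" using Cauchy_convergent_iff convergent_def by blast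
  have pcl: "p \<in> closure S" using s(1) p closure_sequential by blast
  have np: "norm (y - p) = d"
    using tendsto_norm[OF tendsto_diff[OF tendsto_const p]] lim LIMSEQ_unique by blast
  have orth: "inner (y - p) t = 0" if "t \<in> S" for t
  proof (rule ccontr)
    assume ne0: "inner (y - p) t \<noteq> 0"
    then have t0: "inner t t > 0" by auto
    define a where "a = inner (y - p) t / inner t t"
    have "(\<lambda>n. norm (y - (s n + a *\<^sub>R t))) \<longlonglongrightarrow> norm (y - (p + a *\<^sub>R t))"
      by (intro tendsto_intros p)
    moreover have "d \<le> norm (y - (s n + a *\<^sub>R t))" for n
      by (intro lower subspace_add subspace_mul S s that)
    ultimately have "d \<le> norm (y - (p + a *\<^sub>R t))"
      by (intro LIMSEQ_le_const) auto
    then have "d\<^sup>2 \<le> (norm ((y - p) - a *\<^sub>R t))\<^sup>2" using d0 by (simp add: power_mono algebra_simps)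
    also have "\<dots> = d\<^sup>2 - 2 * a * inner (y - p) t + a\<^sup>2 * inner t t"
      unfolding np[symmetric] power2_norm_eq_inner
      by (simp add: inner_diff_left inner_diff_right inner_commute power2_eq_square algebra_simps)
    also have "\<dots> = d\<^sup>2 - (inner (y - p) t)\<^sup>2 / inner t t"
      using t0 by (simp add: a_def power2_eq_square field_simps)
    finally show False using ne0 t0 by (simp add: zero_le_divide_iff divide_le_0_iff)
  qed
  have "inner y (y - p) = 0" by (rule y) (rule orth)
  moreover have "inner (y - p) p = 0"
  proof (rule LIMSEQ_unique)
    show "(\<lambda>n. inner (y - p) (s n)) \<longlonglongrightarrow> inner (y - p) p" by (intro tendsto_intros p)
    show "(\<lambda>n. inner (y - p) (s n)) \<longlonglongrightarrow> 0" using orth[OF s(1)] by simp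
  qed
  ultimately have "inner (y - p) (y - p) = 0"
    by (simp add: inner_diff_left inner_diff_right inner_commute)
  then show ?thesis using pcl by simp
qed

section \<open>A bound on the Morse index\<close>

lemma self_adjoint_symmetric:
  assumes "self_adjoint A" "(u, w) \<in> A" "(u', w') \<in> A"
  shows "inner w u' = inner u w'"
  using assms unfolding self_adjoint_def adjoint_operator_def by blast

text \<open>If \<open>(v, w)\<close> were in the closure of \<open>T\<close>, the form would be nonnegative at \<open>v\<close> by continuity. In fact it
  suffices that \<open>w\<close> is a limit of values \<open>T \<phi>\<close>: then \<open>z = v - \<phi>\<close> stays bounded, \<open>A z\<close> tends to \<open>0\<close>, and
  symmetry of \<open>A\<close> shows that \<open>\<phi>\<close> and \<open>v\<close> have the same form in the limit.\<close>

lemma form_nonneg_of_closure_range: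
  fixes A T :: "('h::real_inner \<times> 'h) set"
  assumes A: "self_adjoint A" and T: "subspace T" "T \<subseteq> A"
    and coercive: "c > 0" "\<And>u w. (u, w) \<in> T \<Longrightarrow> c * (norm u)\<^sup>2 \<le> inner w u"
    and v: "(v, w) \<in> A" and w: "w \<in> closure (snd ` T)"
  shows "0 \<le> inner w v"
proof -
  note sym = self_adjoint_symmetric[OF A]
  have subA: "subspace A" using A by (simp add: self_adjoint_def linear_operator_def)
  obtain s where s: "\<And>n::nat. s n \<in> snd ` T" "s \<longlonglongrightarrow> w" using w unfolding closure_sequential by blast
  have "\<exists>\<phi>. (\<phi>, s n) \<in> T" for n using s(1)[of n] by auto
  then obtain \<phi> where \<phi>: "\<And>n. (\<phi> n, s n) \<in> T" by metis
  have "norm (\<phi> n) \<le> norm (s n) / c" for n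
  proof (cases "\<phi> n = 0")
    case False
    have "c * (norm (\<phi> n))\<^sup>2 \<le> inner (s n) (\<phi> n)" by (rule coercive(2)[OF \<phi>])
    also have "\<dots> \<le> norm (s n) * norm (\<phi> n)" by (rule norm_cauchy_schwarz)
    finally have "c * norm (\<phi> n) \<le> norm (s n)"
      using False by (simp add: power2_eq_square)
    then show ?thesis using coercive(1) by (simp add: field_simps)
  qed (use coercive in auto)
  moreover obtain C where C: "\<And>n. norm (s n) \<le> C"
    using Bseq_def[of s] convergent_imp_Bseq[of s] s(2) convergent_def by blast
  ultimately have phib: "norm (\<phi> n) \<le> C / c" for n
    using coercive(1) by (meson divide_right_mono less_imp_le order_trans)
  define z where "z = (\<lambda>n. v - \<phi> n)"
  have zA: "(z n, w - s n) \<in> A" for n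
    using subspace_diff[OF subA v] \<phi>[of n] T(2) unfolding z_def by fastforce
  have zb: "norm (z n) \<le> norm v + C / c" for n
    unfolding z_def using norm_triangle_ineq4[of v "\<phi> n"] phib[of n] by linarith
  have "inner w v - 2 * inner v (w - s n) + inner (w - s n) (z n) \<ge> 0" for n
  proof -
    have "0 \<le> c * (norm (\<phi> n))\<^sup>2" using coercive(1) by simp
    also have "\<dots> \<le> inner (s n) (\<phi> n)" by (rule coercive(2)[OF \<phi>])
    also have "inner (s n) (\<phi> n) = inner (w - (w - s n)) (v - z n)" by (simp add: z_def)
    also have "\<dots> = inner w v - inner w (z n) - inner (w - s n) v + inner (w - s n) (z n)"
      unfolding inner_diff_left[of w "w - s n"] inner_diff_right by (simp only: algebra_simps)
    also have "inner w (z n) = inner v (w - s n)" by (rule sym[OF v zA])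
    finally show ?thesis by (simp add: inner_commute)
  qed
  moreover have "(\<lambda>n. inner w v - 2 * inner v (w - s n) + inner (w - s n) (z n))
      \<longlonglongrightarrow> inner w v - 2 * inner v (w - w) + 0"
  proof (intro tendsto_intros s(2))
    have "(\<lambda>n. norm (w - s n) * (norm v + C / c)) \<longlonglongrightarrow> norm (w - w) * (norm v + C / c)"
      by (intro tendsto_intros s(2))
    then have null: "(\<lambda>n. norm (w - s n) * (norm v + C / c)) \<longlonglongrightarrow> 0" by simp
    show "(\<lambda>n. inner (w - s n) (z n)) \<longlonglongrightarrow> 0"
    proof (rule Lim_null_comparison[OF _ null])
      show "\<forall>\<^sub>F n in sequentially. norm (inner (w - s n) (z n)) \<le> norm (w - s n) * (norm v + C / c)"
      proof (intro always_eventually allI)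
        fix n
        have "norm (inner (w - s n) (z n)) \<le> norm (w - s n) * norm (z n)"
          by (simp add: Cauchy_Schwarz_ineq2)
        also have "\<dots> \<le> norm (w - s n) * (norm v + C / c)"
          by (intro mult_left_mono zb) auto
        finally show "norm (inner (w - s n) (z n)) \<le> norm (w - s n) * (norm v + C / c)" .
      qed
    qed
  qed
  ultimately have "0 \<le> inner w v - 2 * inner v (w - w) + 0"
    by (intro LIMSEQ_le_const) auto
  then show ?thesis by simp
qed

text \<open>The operator \<open>T\<close> stands for a restriction of the minimal operator that is coercive and whose range
  has a finite-dimensional orthogonal complement. On the union \<open>V\<close> of the spectral subspaces of
  \<open>[-N, 0)\<close> the form is negative, which by \<open>form_nonneg_of_closure_range\<close> prevents \<open>A\<close> from mapping a nonzero
  vector of \<open>V\<close> into the closure of the range of \<open>T\<close>. So \<open>A\<close> embeds \<open>V\<close> into the dual of the complement.\<close>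

lemma finite_morse_index:
  fixes A T :: "('h::{real_inner,complete_space} \<times> 'h) set"
  assumes A: "self_adjoint A" and E: "spectral_measure_of A E"
    and T: "subspace T" "T \<subseteq> A"
    and coercive: "c > 0" "\<And>u w. (u, w) \<in> T \<Longrightarrow> c * (norm u)\<^sup>2 \<le> inner w u"
    and B: "finite B" "{k. \<forall>(u, w)\<in>T. inner k w = 0} \<subseteq> span B"
  shows "morse_index E < \<infinity>"
proof -
  have pvm: "projection_valued_measure E"
    and dom: "\<And>u. u \<in> Domain A \<longleftrightarrow> integrable (scalar_measure E u) (\<lambda>x. x\<^sup>2)"
    and form: "\<And>u w. (u, w) \<in> A \<Longrightarrow> inner w u = (\<integral>x. x \<partial>scalar_measure E u)"
    using E unfolding spectral_measure_of_def by auto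
  note proj = pvm_projection[OF pvm]
  have subA: "subspace A" and svA: "single_valued A"
    using A by (auto simp: self_adjoint_def linear_operator_def)
  define W where "W = (\<lambda>N. range (E {- real N..<0}))"
  have W_iff: "u \<in> W N \<longleftrightarrow> E {- real N..<0} u = u" for u N
  proof -
    have "E {- real N..<0} (E {- real N..<0} v) = E {- real N..<0} v" for v
      by (rule orthogonal_projectionD(2)[OF proj]) simp
    then show ?thesis unfolding W_def by (metis rangeE rangeI)
  qed
  have W_mono: "W M \<subseteq> W N" if "M \<le> N" for M N
  proof
    fix u assume u: "u \<in> W M"
    have "{- real N..<0} \<inter> {- real M..<0} = {- real M..<0}" using that by auto
    then show "u \<in> W N"
      using pvm_Int[OF pvm, of "{- real N..<0}" "{- real M..<0}" u] u unfolding W_iff by simp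
  qed
  define V where "V = (\<Union>N. W N)"
  have W_sub: "subspace (W N)" for N
    unfolding W_def by (intro linear_subspace_image orthogonal_projectionD(1) proj) auto
  have V_sub: "subspace V"
  proof (rule subspaceI)
    show "0 \<in> V" using W_sub[of 0] by (auto simp: V_def dest: subspace_0)
  next
    fix x y assume "x \<in> V" "y \<in> V"
    then obtain M N where "x \<in> W M" "y \<in> W N" by (auto simp: V_def)
    then have "x \<in> W (max M N)" "y \<in> W (max M N)"
      using W_mono[of M "max M N"] W_mono[of N "max M N"] by auto
    then show "x + y \<in> V" using W_sub subspace_add unfolding V_def by blast
  next
    fix c x assume "x \<in> V" then show "c *\<^sub>R x \<in> V" using W_sub subspace_mul unfolding V_def by blast
  qed
  have V_dom: "\<exists>w. (v, w) \<in> A" if "v \<in> V" for v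
    using that truncated_in_domain[OF pvm] dom[of v] by (auto simp: V_def W_iff)
  have V_neg: "inner w v < 0" if "v \<in> V" "(v, w) \<in> A" "v \<noteq> 0" for v w
    using that truncated_integral_neg[OF pvm] form[OF that(2)] by (auto simp: V_def W_iff)
  \<comment> \<open>the key point: on \<open>V\<close> the operator is injective modulo the closure of the range of \<open>T\<close>\<close>
  have key: "v = 0" if v: "v \<in> V" "(v, w) \<in> A" and wB: "\<And>b. b \<in> span B \<Longrightarrow> inner w b = 0" for v w
  proof (rule ccontr)
    assume "v \<noteq> 0"
    define S where "S = snd ` T"
    have "subspace S" unfolding S_def by (intro linear_subspace_image linear_snd T)
    then have "w \<in> closure S"
    proof (rule biorthogonal_in_closure)
      fix k assume "\<And>s. s \<in> S \<Longrightarrow> inner k s = 0"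
      then have "k \<in> span B" using B(2) by (force simp: S_def)
      then show "inner w k = 0" by (rule wB)
    qed
    then have "inner w v \<ge> 0"
      unfolding S_def by (intro form_nonneg_of_closure_range[OF A T coercive(1) _ v(2)] coercive(2))
    then show False using V_neg[OF v(1,2) \<open>v \<noteq> 0\<close>] by simp
  qed
  \<comment> \<open>hence \<open>V\<close> embeds in the dual of \<open>span B\<close>; one element of \<open>B\<close> is removed at a time\<close>
  have "\<exists>C. finite C \<and> {v \<in> V. \<exists>w. (v, w) \<in> A \<and> (\<forall>b\<in>B - D. inner w b = 0)} \<subseteq> span C"
    if "finite D" for D
    using that
  proof (induction D)
    case empty
    have "inner w b = 0" if "\<forall>b\<in>B. inner w b = 0" "b \<in> span B" for w b
      using span_induct[OF that(2), where P = "\<lambda>b. inner w b = 0"] that(1)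
      by (auto simp: subspace_def inner_add_right)
    then have "{v \<in> V. \<exists>w. (v, w) \<in> A \<and> (\<forall>b\<in>B - {}. inner w b = 0)} \<subseteq> span {}"
      using key by auto
    then show ?case by blast
  next
    case (insert d D)
    then obtain C where C: "finite C"
      "{v \<in> V. \<exists>w. (v, w) \<in> A \<and> (\<forall>b\<in>B - D. inner w b = 0)} \<subseteq> span C" by auto
    define Z where "Z = {(v, r :: real). v \<in> V \<and> (\<exists>w. (v, w) \<in> A \<and> r = inner w d \<and>
        (\<forall>b\<in>B - insert d D. inner w b = 0))}"
    have "subspace Z"
    proof (rule subspaceI)
      show "0 \<in> Z" using subspace_0[OF V_sub] subspace_0[OF subA]
        by (auto simp: Z_def zero_prod_def intro!: exI[of _ 0])
    next
      fix x y assume "x \<in> Z" "y \<in> Z"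
      then obtain v w v' w' where *: "x = (v, inner w d)" "y = (v', inner w' d)" "v \<in> V" "v' \<in> V"
        "(v, w) \<in> A" "(v', w') \<in> A" "\<forall>b\<in>B - insert d D. inner w b = 0"
        "\<forall>b\<in>B - insert d D. inner w' b = 0"
        by (auto simp: Z_def)
      moreover from *(7,8) have "\<forall>b\<in>B - insert d D. inner (w + w') b = 0"
        by (simp add: inner_add_left)
      ultimately show "x + y \<in> Z"
        using subspace_add[OF V_sub, of v v'] subspace_add[OF subA, of "(v, w)" "(v', w')"]
        unfolding Z_def by (auto simp: inner_add_left[of w w' d] intro!: exI[of _ "w + w'"])
    next
      fix a x assume "x \<in> Z"
      then obtain v w where *: "x = (v, inner w d)" "v \<in> V"
        "(v, w) \<in> A" "\<forall>b\<in>B - insert d D. inner w b = 0"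
        by (auto simp: Z_def)
      then show "a *\<^sub>R x \<in> Z"
        using subspace_mul[OF V_sub, of v a] subspace_mul[OF subA, of "(v, w)" a]
        by (auto simp: Z_def intro!: exI[of _ "a *\<^sub>R w"])
    qed
    moreover have "{u. (u, 0) \<in> Z} \<subseteq> span C"
    proof (rule subset_trans[OF _ C(2)])
      show "{u. (u, 0) \<in> Z} \<subseteq> {v \<in> V. \<exists>w. (v, w) \<in> A \<and> (\<forall>b\<in>B - D. inner w b = 0)}"
        by (auto simp: Z_def)
    qed
    moreover have "finite (Basis :: real set)" "snd ` Z \<subseteq> span Basis" by (simp_all only: span_Basis finite_Basis subset_UNIV)
    ultimately obtain B' where B': "finite B'" "fst ` Z \<subseteq> span B'"
      by (rule finite_dim_of_linear_relation[OF _ C(1)])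
    have "{v \<in> V. \<exists>w. (v, w) \<in> A \<and> (\<forall>b\<in>B - insert d D. inner w b = 0)} \<subseteq> fst ` Z"
      by (force simp: Z_def)
    then show ?case using B' by (meson subset_trans)
  qed
  from this[OF B(1)] obtain C where C: "finite C" "V \<subseteq> span C"
    using V_dom by fastforce
  \<comment> \<open>a finite-dimensional increasing union is stationary, so truncation is already exact\<close>
  obtain D where D: "D \<subseteq> V" "independent D" "V \<subseteq> span D"
    using maximal_independent_subset[of V] by auto
  have finD: "finite D" using independent_span_bound[OF C(1) D(2)] D(1) C(2) by auto
  have "\<exists>N. D \<subseteq> W N" using finD D(1)
  proof (induction D)
    case (insert d D)
    then obtain M N where "D \<subseteq> W N" "d \<in> W M" by (auto simp: V_def)
    then have "insert d D \<subseteq> W (max M N)"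
      using W_mono[of M "max M N"] W_mono[of N "max M N"] by auto
    then show ?case by blast
  qed auto
  then obtain N where N: "D \<subseteq> W N" by blast
  have VW: "V \<subseteq> W N" using D(3) span_minimal[OF N W_sub] by blast
  have "range (E {..<0}) \<subseteq> V"
  proof safe
    fix x
    have "E {- real M..<0} x = E {- real N..<0} x" if "M \<ge> N" for M
    proof -
      have "E {- real M..<0} x \<in> W N"
        by (rule subsetD[OF VW]) (auto simp: V_def W_def)
      then have "E {- real M..<0} x = E {- real N..<0} (E {- real M..<0} x)" by (simp add: W_iff)
      also have "\<dots> = E ({- real N..<0} \<inter> {- real M..<0}) x" by (rule pvm_Int[OF pvm, symmetric]) auto
      also have "{- real N..<0} \<inter> {- real M..<0} = {- real N..<0}" using that by auto
      finally show ?thesis .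
    qed
    then have "(\<lambda>M. E {- real M..<0} x) \<longlonglongrightarrow> E {- real N..<0} x"
      by (intro tendsto_eventually eventually_sequentiallyI)
    then have "E {..<0} x = E {- real N..<0} x"
      using pvm_negative_tendsto[OF pvm] LIMSEQ_unique by blast
    then show "E {..<0} x \<in> V" by (auto simp: V_def W_def)
  qed
  then show ?thesis
    unfolding morse_index_def using C by (intro extended_dim_lt_infinity[of C]) auto
qed

text \<open>Conversely, if the negative spectral subspace is finite-dimensional, some combination
  of the infinitely many vectors \<open>u k\<close> is orthogonal to it, and there the form is nonnegative.\<close>

lemma infinite_morse_index:
  fixes A :: "('h::real_inner \<times> 'h) set"
  assumes A: "self_adjoint A" and E: "spectral_measure_of A E"
    and uw: "\<And>k::nat. (u k, w k) \<in> A"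
    and neg: "\<And>k. inner (w k) (u k) < 0"
    and orth: "\<And>j k. j \<noteq> k \<Longrightarrow> inner (w j) (u k) = 0"
  shows "morse_index E = \<infinity>"
proof (rule ccontr)
  assume "morse_index E \<noteq> \<infinity>"
  then have fin: "extended_dim (range (E {..<0})) \<noteq> \<infinity>" by (simp add: morse_index_def)
  have pvm: "projection_valued_measure E"
    and form: "\<And>u w. (u, w) \<in> A \<Longrightarrow> inner w u = (\<integral>x. x \<partial>scalar_measure E u)"
    using E unfolding spectral_measure_of_def by auto
  have lin: "linear (E {..<0})" by (intro orthogonal_projectionD(1) pvm_projection[OF pvm]) auto
  obtain a :: "nat \<Rightarrow> real" and N where a: "(\<Sum>k<N. a k *\<^sub>R E {..<0} (u k)) = 0" "\<exists>k<N. a k \<noteq> 0"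
    using finite_extended_dim_relation[OF fin, of "\<lambda>k. E {..<0} (u k)"] by auto
  define U where "U = (\<Sum>k<N. a k *\<^sub>R u k)"
  define W where "W = (\<Sum>k<N. a k *\<^sub>R w k)"
  have "(\<Sum>k<N. a k *\<^sub>R (u k, w k)) \<in> A"
    using A uw by (intro subspace_sum subspace_mul) (auto simp: self_adjoint_def linear_operator_def)
  then have UW: "(U, W) \<in> A" by (simp add: U_def W_def scaleR_Pair sum_prod)
  have "E {..<0} U = 0"
    using a(1) by (simp add: U_def linear_sum[OF lin] linear_scale[OF lin])
  then have "0 \<le> inner W U"
    using form[OF UW] scalar_integral_nonneg[OF pvm] by simp
  also have "inner W U = (\<Sum>j<N. \<Sum>k<N. a j * a k * inner (w j) (u k))"
    by (subst sum.swap) (simp add: U_def W_def inner_sum_left inner_sum_right sum_distrib_left mult_ac)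
  also have "\<dots> = (\<Sum>j<N. \<Sum>k<N. if k = j then (a j)\<^sup>2 * inner (w j) (u j) else 0)"
    by (intro sum.cong refl) (auto simp: orth power2_eq_square)
  also have "\<dots> = (\<Sum>j<N. (a j)\<^sup>2 * inner (w j) (u j))" by simp
  also have "\<dots> < 0"
  proof -
    obtain k where k: "k < N" "a k \<noteq> 0" using a(2) by blast
    have "(\<Sum>j<N. (a j)\<^sup>2 * inner (w j) (u j)) < (\<Sum>j<N. 0)"
    proof (rule sum_strict_mono_ex1)
      show "\<forall>j\<in>{..<N}. (a j)\<^sup>2 * inner (w j) (u j) \<le> 0"
        using neg by (intro ballI mult_nonneg_nonpos) (auto intro: less_imp_le)
      show "\<exists>j\<in>{..<N}. (a j)\<^sup>2 * inner (w j) (u j) < 0"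
        using k neg by (auto intro!: bexI[of _ k] mult_pos_neg)
    qed auto
    then show ?thesis by simp
  qed
  finally show False by simp
qed

section \<open>Completeness of $L^2$\<close>

abbreviation unit_interval :: "real measure" where
  "unit_interval \<equiv> lebesgue_on {0<..<1}"

lemma finite_measure_unit_interval: "finite_measure unit_interval"
  by (rule finite_measure_lebesgue_on) simp

lemma measure_unit_interval: "measure unit_interval (space unit_interval) = 1"
  by (simp add: measure_restrict_space)

lemma L2_rel_refl: "square_integrable f \<Longrightarrow> L2_rel f f"
  by (simp add: L2_rel_def)

lemma square_integrable_rep: "square_integrable (rep_L2 u)"
  using Quotient_rep_reflp[OF Quotient_L2, of u] by (simp add: L2_rel_def)

lemma to_L2_rep: "to_L2 (rep_L2 u) = u"
  by (rule Quotient_abs_rep[OF Quotient_L2])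

lemma to_L2_eq_iff:
  "square_integrable f \<Longrightarrow> square_integrable g \<Longrightarrow>
    to_L2 f = to_L2 g \<longleftrightarrow> (AE t in unit_interval. f t = g t)"
  using Quotient_rel[OF Quotient_L2, of f g] by (auto simp: L2_rel_def)

lemma rep_to_L2: "square_integrable f \<Longrightarrow> AE t in unit_interval. rep_L2 (to_L2 f) t = f t"
  using to_L2_eq_iff[OF square_integrable_rep, of f "to_L2 f"] by (simp add: to_L2_rep)

lemma inner_to_L2:
  "square_integrable f \<Longrightarrow> square_integrable g \<Longrightarrow>
    inner (to_L2 f) (to_L2 g) = (\<integral>t. inner (f t) (g t) \<partial>unit_interval)"
  by (rule inner_L2.abs_eq) (simp_all add: L2_rel_refl)

lemma add_to_L2:
  "square_integrable f \<Longrightarrow> square_integrable g \<Longrightarrow>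
    to_L2 f + to_L2 g = to_L2 (\<lambda>t. f t + g t)"
  by (rule plus_L2.abs_eq) (simp_all add: L2_rel_refl)

lemma scaleR_to_L2:
  "square_integrable f \<Longrightarrow> c *\<^sub>R to_L2 f = to_L2 (\<lambda>t. c *\<^sub>R f t)"
  by (rule scaleR_L2.abs_eq) (simp_all add: L2_rel_refl)

lemma zero_to_L2: "0 = to_L2 (\<lambda>_. 0)"
  by (simp add: zero_L2_def)

lemma diff_to_L2:
  assumes "square_integrable f" "square_integrable g"
  shows "to_L2 f - to_L2 g = to_L2 (\<lambda>t. f t - g t)"
proof -
  have "to_L2 f - to_L2 g = to_L2 f + (-1) *\<^sub>R to_L2 g" by simp
  also have "\<dots> = to_L2 (\<lambda>t. f t + (-1) *\<^sub>R g t)"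
    by (simp only: scaleR_to_L2 add_to_L2 assms square_integrable_scaleR)
  finally show ?thesis by simp
qed

lemma square_integrable_diff:
  "square_integrable f \<Longrightarrow> square_integrable g \<Longrightarrow> square_integrable (\<lambda>t. f t - g t)"
  using square_integrable_add[OF _ square_integrable_scaleR, of f g "-1"] by simp

lemma norm_to_L2: "square_integrable f \<Longrightarrow> (norm (to_L2 f))\<^sup>2 = (\<integral>t. (norm (f t))\<^sup>2 \<partial>unit_interval)"
  by (simp add: power2_norm_eq_inner inner_to_L2)

lemma square_integrable_integrable:
  assumes "square_integrable f"
  shows "integrable unit_interval f"
proof (rule Bochner_Integration.integrable_bound)
  interpret finite_measure unit_interval by (rule finite_measure_unit_interval)
  show "integrable unit_interval (\<lambda>t. 1 + (norm (f t))\<^sup>2)"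
    using assms by (simp add: square_integrable_def)
  have "norm (f t) \<le> 1 + (norm (f t))\<^sup>2" for t
    using sum_squares_bound[of 1 "norm (f t)"] norm_ge_zero[of "f t"] unfolding one_power2 by linarith
  then show "AE t in unit_interval. norm (f t) \<le> norm (1 + (norm (f t))\<^sup>2)" by simp
qed (use assms in \<open>simp add: square_integrable_def\<close>)

text \<open>Cauchy-Schwarz against the constant function \<open>1\<close>, in the form of the inequality
  \<open>2 x \<le> N + x\<^sup>2 / N\<close> with \<open>N\<close> the $L^2$ norm.\<close>

lemma integral_norm_le_L2:
  assumes f: "square_integrable f"
  shows "(\<integral>t. norm (f t) \<partial>unit_interval) \<le> norm (to_L2 f)"
proof (cases "to_L2 f = 0")
  case False
  define a where "a = norm (to_L2 f)"
  have a: "a > 0" using False by (simp add: a_def)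
  interpret finite_measure unit_interval by (rule finite_measure_unit_interval)
  have "norm (f t) \<le> (a + (norm (f t))\<^sup>2 / a) / 2" for t
  proof -
    have "norm (f t) * (2 * a) \<le> a * a + (norm (f t))\<^sup>2"
      using sum_squares_bound[of a "norm (f t)"] by (simp add: power2_eq_square mult_ac)
    then have "norm (f t) \<le> (a * a + (norm (f t))\<^sup>2) / (2 * a)"
      using a by (simp add: pos_le_divide_eq)
    also have "\<dots> = (a + (norm (f t))\<^sup>2 / a) / 2" using a by (simp add: add_divide_distrib)
    finally show ?thesis .
  qed
  note bd = this
  have i0: "integrable unit_interval (\<lambda>t. (norm (f t))\<^sup>2)"
    using f by (simp add: square_integrable_def)
  have i1: "integrable unit_interval (\<lambda>t. norm (f t))"
    by (rule integrable_norm[OF square_integrable_integrable[OF f]])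
  have i2: "integrable unit_interval (\<lambda>t. (a + (norm (f t))\<^sup>2 / a) / 2)"
    by (intro integrable_divide Bochner_Integration.integrable_add integrable_const i0)
  have "(\<integral>t. norm (f t) \<partial>unit_interval) \<le> (\<integral>t. (a + (norm (f t))\<^sup>2 / a) / 2 \<partial>unit_interval)"
    by (rule integral_mono[OF i1 i2 bd])
  also have "\<dots> = ((\<integral>t. a \<partial>unit_interval) + (\<integral>t. (norm (f t))\<^sup>2 / a \<partial>unit_interval)) / 2"
    using i0 by (subst Bochner_Integration.integral_divide_zero, subst Bochner_Integration.integral_add) auto
  also have "\<dots> = (a + (norm (to_L2 f))\<^sup>2 / a) / 2"
    using measure_unit_interval by (simp only: norm_to_L2[OF f] lebesgue_integral_const integral_divide_zero) simp
  also have "\<dots> = a" using a by (simp add: a_def power2_eq_square)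
  finally show ?thesis by (simp add: a_def)
next
  case True
  then have "AE t in unit_interval. norm (f t) = 0"
    using f by (simp add: zero_to_L2 to_L2_eq_iff square_integrable_zero)
  then have "(\<integral>t. norm (f t) \<partial>unit_interval) = (\<integral>t. 0 \<partial>unit_interval)"
    using f by (intro integral_cong_AE) (auto simp: square_integrable_def)
  then show ?thesis by simp
qed

text \<open>On a space of finite measure an $L^2$-Cauchy sequence is $L^1$-Cauchy, hence has a subsequence
  converging almost everywhere; Fatou's lemma identifies the limit.\<close>

instance L2 :: (euclidean_space) complete_space
proof
  fix X :: "nat \<Rightarrow> 'a L2"
  assume X: "Cauchy X"
  define f where "f n = rep_L2 (X n)" for n
  have sq: "square_integrable (f n)" and Xf: "X n = to_L2 (f n)" for n
    by (simp_all add: f_def square_integrable_rep to_L2_rep)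
  have meas[measurable]: "f n \<in> borel_measurable unit_interval" for n
    using sq[of n] by (simp add: square_integrable_def)
  have dist_eq: "norm (X m - X n) = norm (to_L2 (\<lambda>t. f m t - f n t))" for m n
    by (simp add: Xf diff_to_L2 sq)
  obtain r where r: "strict_mono r" "AE t in unit_interval. Cauchy (\<lambda>n. f (r n) t)"
  proof (rule cauchy_L1_AE_cauchy_subseq[of unit_interval f])
    show "integrable unit_interval (f n)" for n
      by (rule square_integrable_integrable[OF sq])
    fix e :: real assume "e > 0"
    then obtain N where "\<forall>i\<ge>N. \<forall>j\<ge>N. norm (X i - X j) < e"
      using X CauchyD by blast
    then show "\<exists>N. \<forall>i\<ge>N. \<forall>j\<ge>N. (\<integral>t. norm (f i t - f j t) \<partial>unit_interval) < e"
      using integral_norm_le_L2[OF square_integrable_diff[OF sq sq]] unfolding dist_eq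
      by (meson le_less_trans)
  qed (use that in blast)
  define g where "g t = lim (\<lambda>n. f (r n) t)" for t
  have [measurable]: "g \<in> borel_measurable unit_interval"
    unfolding g_def by measurable
  have lim: "AE t in unit_interval. (\<lambda>n. f (r n) t) \<longlonglongrightarrow> g t"
    using r(2) by eventually_elim (simp add: g_def Cauchy_convergent_iff convergent_LIMSEQ_iff)
  \<comment> \<open>the Cauchy bound passes to the limit in one of the two indices\<close>
  have fatou: "(\<integral>\<^sup>+t. ennreal ((norm (f m t - g t))\<^sup>2) \<partial>unit_interval) \<le> ennreal (e\<^sup>2)"
    if e: "e > 0" "\<And>n. n \<ge> N \<Longrightarrow> norm (X m - X n) < e" for e m N
  proof -
    have bd: "(\<integral>\<^sup>+t. ennreal ((norm (f m t - f (r n) t))\<^sup>2) \<partial>unit_interval) \<le> ennreal (e\<^sup>2)" if "n \<ge> N" for n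
    proof -
      have sd: "square_integrable (\<lambda>t. f m t - f (r n) t)" by (rule square_integrable_diff[OF sq sq])
      have "(\<integral>\<^sup>+t. ennreal ((norm (f m t - f (r n) t))\<^sup>2) \<partial>unit_interval)
          = ennreal ((norm (X m - X (r n)))\<^sup>2)"
        using sd unfolding dist_eq norm_to_L2[OF sd]
        by (intro nn_integral_eq_integral) (auto simp: square_integrable_def)
      also have "\<dots> \<le> ennreal (e\<^sup>2)"
        using e(2)[of "r n"] seq_suble[OF r(1), of n] that
        by (intro ennreal_leI power_mono) auto
      finally show ?thesis .
    qed
    have "(\<integral>\<^sup>+t. ennreal ((norm (f m t - g t))\<^sup>2) \<partial>unit_interval)
        = (\<integral>\<^sup>+t. liminf (\<lambda>n. ennreal ((norm (f m t - f (r n) t))\<^sup>2)) \<partial>unit_interval)"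
    proof (rule nn_integral_cong_AE)
      show "AE t in unit_interval. ennreal ((norm (f m t - g t))\<^sup>2)
          = liminf (\<lambda>n. ennreal ((norm (f m t - f (r n) t))\<^sup>2))"
        using lim
      proof eventually_elim
        case (elim t)
        have "(\<lambda>n. ennreal ((norm (f m t - f (r n) t))\<^sup>2)) \<longlonglongrightarrow> ennreal ((norm (f m t - g t))\<^sup>2)"
          by (intro tendsto_intros tendsto_ennrealI elim)
        then show ?case by (rule lim_imp_Liminf[symmetric, rotated]) simp
      qed
    qed
    also have "\<dots> \<le> liminf (\<lambda>n. \<integral>\<^sup>+t. ennreal ((norm (f m t - f (r n) t))\<^sup>2) \<partial>unit_interval)"
      by (rule nn_integral_liminf) measurable
    also have "\<dots> \<le> liminf (\<lambda>n. ennreal (e\<^sup>2))"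
      using bd by (intro Liminf_mono eventually_sequentiallyI)
    finally show ?thesis by (simp add: Liminf_const)
  qed
  have sqd: "square_integrable (\<lambda>t. f m t - g t)"
    if "e > 0" "\<And>n. n \<ge> N \<Longrightarrow> norm (X m - X n) < e" for e m N
    unfolding square_integrable_def
  proof
    show "integrable unit_interval (\<lambda>t. (norm (f m t - g t))\<^sup>2)"
    proof (rule integrableI_bounded)
      show "(\<integral>\<^sup>+t. ennreal (norm ((norm (f m t - g t))\<^sup>2)) \<partial>unit_interval) < \<infinity>"
        using le_less_trans[OF fatou[OF that] ennreal_less_top] by simp
    qed measurable
  qed measurable
  obtain N1 where N1: "\<And>m n. m \<ge> N1 \<Longrightarrow> n \<ge> N1 \<Longrightarrow> norm (X m - X n) < 1"
    using CauchyD[OF X, of 1] by auto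
  have "square_integrable (\<lambda>t. f N1 t - (f N1 t - g t))"
    by (rule square_integrable_diff[OF sq sqd[of 1 N1]]) (use N1 in auto)
  then have sg: "square_integrable g" by simp
  have "X \<longlonglongrightarrow> to_L2 g"
  proof (rule metric_LIMSEQ_I)
    fix e :: real assume e: "e > 0"
    obtain N where N: "\<And>m n. m \<ge> N \<Longrightarrow> n \<ge> N \<Longrightarrow> norm (X m - X n) < e / 2"
      using CauchyD[OF X, of "e / 2"] e by auto
    have "dist (X m) (to_L2 g) < e" if m: "m \<ge> N" for m
    proof -
      have sd: "square_integrable (\<lambda>t. f m t - g t)" by (rule square_integrable_diff[OF sq sg])
      have "ennreal ((norm (X m - to_L2 g))\<^sup>2) = (\<integral>\<^sup>+t. ennreal ((norm (f m t - g t))\<^sup>2) \<partial>unit_interval)"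
        using sd unfolding Xf diff_to_L2[OF sq sg] norm_to_L2[OF sd]
        by (intro nn_integral_eq_integral[symmetric]) (auto simp: square_integrable_def)
      also have "\<dots> \<le> ennreal ((e / 2)\<^sup>2)"
        by (rule fatou[of "e/2" N m]) (use e N m in auto)
      finally have "(norm (X m - to_L2 g))\<^sup>2 \<le> (e / 2)\<^sup>2"
        by (subst (asm) ennreal_le_iff) auto
      then have "norm (X m - to_L2 g) \<le> e / 2"
        by (rule power2_le_imp_le) (use e in simp)
      then show ?thesis using e by (simp add: dist_norm)
    qed
    then show "\<exists>N. \<forall>n\<ge>N. dist (X n) (to_L2 g) < e" by blast
  qed
  then show "convergent X" by (rule convergentI)
qed

section \<open>Extreme eigenvalues of symmetric matrices\<close>

lemma inner_symmetric_matrix: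
  fixes M :: "real^'n^'n"
  assumes "transpose M = M"
  shows "inner (M *v x) y = inner x (M *v y)"
  by (metis assms dot_lmul_matrix transpose_matrix_vector)

text \<open>Eigenvectors for different eigenvalues are orthogonal, hence linearly independent. Finiteness is
  what makes the minimum and maximum of the set of eigenvalues meaningful.\<close>

lemma finite_eigenvalues:
  fixes M :: "real^'n^'n"
  assumes M: "transpose M = M"
  shows "finite (eigenvalues M)"
proof -
  obtain v where v: "\<And>c. c \<in> eigenvalues M \<Longrightarrow> v c \<noteq> 0 \<and> M *v v c = c *\<^sub>R v c"
  proof -
    have "\<exists>v. v \<noteq> 0 \<and> M *v v = c *\<^sub>R v" if "c \<in> eigenvalues M" for c
      using that by (simp add: eigenvalues_def)
    then show thesis using that by metis
  qed
  have orth: "inner (v c) (v d) = 0" if "c \<in> eigenvalues M" "d \<in> eigenvalues M" "c \<noteq> d" for c d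
  proof -
    have "c * inner (v c) (v d) = d * inner (v c) (v d)"
      using inner_symmetric_matrix[OF M, of "v c" "v d"] v[OF that(1)] v[OF that(2)] by simp
    then show ?thesis using that(3) by simp
  qed
  have "independent (v ` eigenvalues M)"
    by (rule pairwise_orthogonal_independent)
      (use orth v in \<open>force simp: pairwise_def orthogonal_def\<close>)+
  then have "finite (v ` eigenvalues M)" using independent_bound by blast
  moreover have "inj_on v (eigenvalues M)"
    using orth v by (intro inj_onI) (metis inner_eq_zero_iff)
  ultimately show ?thesis by (rule finite_imageD)
qed

text \<open>The Rayleigh quotient attains its minimum on the unit sphere, and at a minimiser the first
  variation vanishes, which is the eigenvalue equation.\<close>

lemma eigenvalue_le_Rayleigh:
  fixes M :: "real^'n^'n"
  assumes M: "transpose M = M"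
  obtains c where "c \<in> eigenvalues M" "\<And>v. c * (norm v)\<^sup>2 \<le> inner (M *v v) v"
proof -
  have cont: "continuous_on (sphere 0 1) (\<lambda>v. inner (M *v v) v)"
    by (intro continuous_intros linear_continuous_on matrix_vector_mul_bounded_linear)
  have "sphere (0 :: real^'n) 1 \<noteq> {}" by simp
  then obtain v0 where v0: "norm v0 = 1"
    and min: "\<And>v. norm v = 1 \<Longrightarrow> inner (M *v v0) v0 \<le> inner (M *v v) v"
    using continuous_attains_inf[OF compact_sphere _ cont] by auto
  define c where "c = inner (M *v v0) v0"
  have Rayleigh: "c * (norm v)\<^sup>2 \<le> inner (M *v v) v" for v
  proof (cases "v = 0")
    case False
    have "c \<le> inner (M *v (v /\<^sub>R norm v)) (v /\<^sub>R norm v)"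
      unfolding c_def by (rule min) (use False in simp)
    also have "\<dots> = inner (M *v v) v / (norm v)\<^sup>2"
      by (simp add: matrix_vector_mult_scaleR power2_eq_square field_simps)
    finally show ?thesis using False by (simp add: field_simps)
  qed simp
  define r where "r = M *v v0 - c *\<^sub>R v0"
  have "r = 0"
  proof (rule ccontr)
    assume "r \<noteq> 0"
    then have r: "inner r r > 0" by simp
    define b where "b = inner (M *v r) r - c * inner r r"
    have b: "b \<ge> 0" using Rayleigh[of r] by (simp add: b_def power2_norm_eq_inner)
    define s where "s = inner r r / (b + 1)"
    have s: "s > 0" using r b by (simp add: s_def)
    have "0 \<le> inner (M *v (v0 - s *\<^sub>R r)) (v0 - s *\<^sub>R r) - c * inner (v0 - s *\<^sub>R r) (v0 - s *\<^sub>R r)"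
      using Rayleigh[of "v0 - s *\<^sub>R r"] by (simp add: power2_norm_eq_inner)
    also have "\<dots> = inner (M *v v0) v0 - c * inner v0 v0 - 2 * s * (inner (M *v v0) r - c * inner v0 r)
        + s\<^sup>2 * b"
      using inner_symmetric_matrix[OF M, of r v0]
      by (simp add: b_def matrix_vector_mult_diff_distrib matrix_vector_mult_scaleR inner_diff_left
          inner_diff_right power2_eq_square algebra_simps inner_commute)
    also have "inner (M *v v0) r - c * inner v0 r = inner r r"
      by (simp add: r_def inner_diff_left)
    also have "inner (M *v v0) v0 - c * inner v0 v0 = 0"
      using v0 by (simp add: c_def power2_norm_eq_inner[symmetric])
    finally have "0 \<le> s * (s * b - 2 * inner r r)" by (simp add: power2_eq_square algebra_simps)
    then have "2 * inner r r \<le> s * b" using s by (simp add: zero_le_mult_iff)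
    also have "s * b \<le> inner r r" using r b by (simp add: s_def field_simps)
    finally show False using r by simp
  qed
  then have "c \<in> eigenvalues M"
    using v0 by (auto simp: eigenvalues_def r_def intro!: exI[of _ v0])
  then show thesis using Rayleigh that by blast
qed

lemma smallest_eigenvalue_le:
  fixes M :: "real^'n^'n"
  assumes M: "transpose M = M"
  shows "smallest_eigenvalue M * (norm v)\<^sup>2 \<le> inner (M *v v) v"
proof -
  obtain c where c: "c \<in> eigenvalues M" "\<And>v. c * (norm v)\<^sup>2 \<le> inner (M *v v) v"
    using eigenvalue_le_Rayleigh[OF M] by blast
  have "smallest_eigenvalue M \<le> c"
    unfolding smallest_eigenvalue_def by (rule Min_le[OF finite_eigenvalues[OF M] c(1)])
  then have "smallest_eigenvalue M * (norm v)\<^sup>2 \<le> c * (norm v)\<^sup>2" by (rule mult_right_mono) simp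
  then show ?thesis using c(2)[of v] by linarith
qed

lemma largest_eigenvalue_ge:
  fixes M :: "real^'n^'n"
  assumes M: "transpose M = M"
  shows "inner (M *v v) v \<le> largest_eigenvalue M * (norm v)\<^sup>2"
proof -
  have neg: "(- M) *v x = - (M *v x)" for x
    using matrix_vector_mult_diff_rdistrib[of 0 M x] by simp
  have "transpose (- M) = - M" using M by (simp add: transpose_def vec_eq_iff)
  then obtain c where c: "c \<in> eigenvalues (- M)" "\<And>v. c * (norm v)\<^sup>2 \<le> inner ((- M) *v v) v"
    using eigenvalue_le_Rayleigh by blast
  obtain x where "x \<noteq> 0" "- (M *v x) = c *\<^sub>R x"
    using c(1) by (auto simp: eigenvalues_def neg)
  then have "x \<noteq> 0 \<and> M *v x = (- c) *\<^sub>R x" by (metis minus_minus scaleR_minus_left)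
  then have "- c \<in> eigenvalues M" unfolding eigenvalues_def by blast
  then have "- c \<le> largest_eigenvalue M"
    unfolding largest_eigenvalue_def by (rule Max_ge[OF finite_eigenvalues[OF M]])
  then have "- c * (norm v)\<^sup>2 \<le> largest_eigenvalue M * (norm v)\<^sup>2" by (rule mult_right_mono) simp
  then show ?thesis using c(2)[of v] by (simp add: neg)
qed

section \<open>Smooth functions\<close>

lemma vderiv_eq:
  assumes "\<And>t. (f has_vector_derivative f' t) (at t)"
  shows "vderiv f = f'"
  unfolding vderiv_def by (rule ext) (rule vector_derivative_at[OF assms])

text \<open>A class of functions that is closed under differentiation consists of smooth functions. Smoothness
  is always proved below by exhibiting such a class.\<close>

lemma smooth_coinduct:
  assumes f: "f \<in> S"
    and step: "\<And>g. g \<in> S \<Longrightarrow> \<exists>g'\<in>S. \<forall>t. (g has_vector_derivative g' t) (at t)"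
  shows "smooth f"
proof -
  have vS: "vderiv g \<in> S" "g differentiable at t" if "g \<in> S" for g t
    using step[OF that] vderiv_eq by (auto simp: has_vector_derivative_def differentiable_def)
  have "(vderiv ^^ k) f \<in> S" for k
    by (induction k) (use f vS in auto)
  then show ?thesis unfolding smooth_def using vS(2) by blast
qed

lemma smooth_vderiv: "smooth f \<Longrightarrow> smooth (vderiv f)"
  unfolding smooth_def
proof (intro allI)
  fix k t assume "\<forall>k t. (vderiv ^^ k) f differentiable at t"
  then have "(vderiv ^^ Suc k) f differentiable at t" by blast
  then show "(vderiv ^^ k) (vderiv f) differentiable at t" by (simp add: funpow_swap1)
qed

lemma smooth_has_vector_derivative:
  assumes "smooth f"
  shows "(f has_vector_derivative vderiv f t) (at t within A)"
proof -
  have "(vderiv ^^ 0) f differentiable at t" using assms unfolding smooth_def by blast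
  then have "(f has_vector_derivative vderiv f t) (at t)"
    by (simp add: vderiv_def flip: vector_derivative_works)
  then show ?thesis by (rule has_vector_derivative_at_within)
qed

lemma smooth_continuous_on: "smooth f \<Longrightarrow> continuous_on A f"
  by (rule continuous_on_vector_derivative[of A f "vderiv f"]) (rule smooth_has_vector_derivative)

lemma vderiv_eq_0_outside:
  assumes "\<And>t. t \<notin> {a..b} \<Longrightarrow> f t = 0" "t \<notin> {a..b}"
  shows "vderiv f t = 0"
proof -
  have "((\<lambda>_. 0) has_vector_derivative 0) (at t)" by simp
  then have "(f has_vector_derivative 0) (at t)"
    by (rule has_vector_derivative_transform_within_open[of _ _ _ "- {a..b}"])
      (use assms in \<open>auto simp: closed_Compl\<close>)
  then show ?thesis unfolding vderiv_def by (rule vector_derivative_at)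
qed

lemma vderiv_bounded_linear:
  "bounded_linear h \<Longrightarrow> smooth f \<Longrightarrow> vderiv (\<lambda>t. h (f t)) = (\<lambda>t. h (vderiv f t))"
  by (rule vderiv_eq, rule bounded_linear.has_vector_derivative, assumption,
      rule smooth_has_vector_derivative)

lemma smooth_bounded_linear:
  assumes "bounded_linear h" "smooth f"
  shows "smooth (\<lambda>t. h (f t))"
proof (rule smooth_coinduct[of _ "{\<lambda>t. h (f t) | f. smooth f}"])
  fix g assume "g \<in> {\<lambda>t. h (f t) | f. smooth f}"
  then obtain f where f: "g = (\<lambda>t. h (f t))" "smooth f" by blast
  then have "\<forall>t. (g has_vector_derivative h (vderiv f t)) (at t)"
    using bounded_linear.has_vector_derivative[OF assms(1)] smooth_has_vector_derivative by blast
  then show "\<exists>g'\<in>{\<lambda>t. h (f t) | f. smooth f}. \<forall>t. (g has_vector_derivative g' t) (at t)"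
    using smooth_vderiv[OF f(2)] by (intro bexI[of _ "\<lambda>t. h (vderiv f t)"]) auto
next
  show "(\<lambda>t. h (f t)) \<in> {\<lambda>t. h (f t) | f. smooth f}"
    unfolding mem_Collect_eq by (intro exI[of _ f] conjI refl assms(2))
qed

lemma smooth_zero: "smooth (\<lambda>_. 0)"
  by (rule smooth_coinduct[of _ "{\<lambda>_. 0}"]) auto

lemma vderiv_add: "smooth f \<Longrightarrow> smooth g \<Longrightarrow> vderiv (\<lambda>t. f t + g t) = (\<lambda>t. vderiv f t + vderiv g t)"
  by (rule vderiv_eq) (intro has_vector_derivative_add smooth_has_vector_derivative)

lemma smooth_add:
  assumes "smooth f" "smooth g"
  shows "smooth (\<lambda>t. f t + g t)"
proof (rule smooth_coinduct[of _ "{\<lambda>t. f t + g t | f g. smooth f \<and> smooth g}"])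
  fix h :: "real \<Rightarrow> 'a" assume "h \<in> {\<lambda>t. f t + g t | f g. smooth f \<and> smooth g}"
  then obtain f g where h: "h = (\<lambda>t. f t + g t)" "smooth f" "smooth g" by blast
  then have "\<forall>t. (h has_vector_derivative vderiv f t + vderiv g t) (at t)"
    by (auto intro!: has_vector_derivative_add smooth_has_vector_derivative)
  then show "\<exists>h'\<in>{\<lambda>t. f t + g t | f g. smooth f \<and> smooth g}. \<forall>t. (h has_vector_derivative h' t) (at t)"
    using smooth_vderiv[OF h(2)] smooth_vderiv[OF h(3)]
    by (intro bexI[of _ "\<lambda>t. vderiv f t + vderiv g t"]) auto
next
  show "(\<lambda>t. f t + g t) \<in> {\<lambda>t. f t + g t | f g. smooth f \<and> smooth g}"
    unfolding mem_Collect_eq by (intro exI[of _ f] exI[of _ g] conjI refl assms)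
qed

text \<open>The class of products is not closed under differentiation, by the product rule; the class of sums
  of products is.\<close>

inductive_set product_sums :: "(real \<Rightarrow> real) set" where
  product: "smooth f \<Longrightarrow> smooth g \<Longrightarrow> (\<lambda>t. f t * g t) \<in> product_sums"
| plus: "f \<in> product_sums \<Longrightarrow> g \<in> product_sums \<Longrightarrow> (\<lambda>t. f t + g t) \<in> product_sums"

lemma smooth_mult:
  fixes f g :: "real \<Rightarrow> real"
  assumes "smooth f" "smooth g"
  shows "smooth (\<lambda>t. f t * g t)"
proof (rule smooth_coinduct[of _ product_sums])
  fix h assume "h \<in> product_sums"
  then show "\<exists>h'\<in>product_sums. \<forall>t. (h has_vector_derivative h' t) (at t)"
  proof induction
    case (product f g)
    have "((\<lambda>t. f t * g t) has_vector_derivative f t * vderiv g t + vderiv f t * g t) (at t)" for t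
      by (intro has_vector_derivative_mult smooth_has_vector_derivative product)
    then show ?case
      by (intro bexI[of _ "\<lambda>t. f t * vderiv g t + vderiv f t * g t"] allI
          product_sums.intros smooth_vderiv product)
  next
    case (plus f g)
    then obtain f' g' where "f' \<in> product_sums" "g' \<in> product_sums"
      "\<forall>t. (f has_vector_derivative f' t) (at t)" "\<forall>t. (g has_vector_derivative g' t) (at t)" by blast
    then show ?case
      by (intro bexI[of _ "\<lambda>t. f' t + g' t"] allI has_vector_derivative_add product_sums.plus) auto
  qed
qed (intro product_sums.intros assms)

lemma smooth_affine:
  fixes f :: "real \<Rightarrow> real"
  assumes "smooth f"
  shows "smooth (\<lambda>t. f (a * t + b))"
proof (rule smooth_coinduct[of _ "{\<lambda>t. c * f (a * t + b) | c f. smooth f}"])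
  show "(\<lambda>t. f (a * t + b)) \<in> {\<lambda>t. c * f (a * t + b) | c f. smooth f}"
    using assms by (auto intro!: exI[of _ 1] exI[of _ f])
next
  fix h :: "real \<Rightarrow> real" assume "h \<in> {\<lambda>t. c * f (a * t + b) | c f. smooth f}"
  then obtain c and f :: "real \<Rightarrow> real" where h: "h = (\<lambda>t. c * f (a * t + b))" "smooth f" by blast
  have "(h has_vector_derivative (c * a) * vderiv f (a * t + b)) (at t)" for t
  proof -
    have "(f has_field_derivative vderiv f (a * t + b)) (at (a * t + b))"
      using smooth_has_vector_derivative[OF h(2)] by (simp add: has_real_derivative_iff_has_vector_derivative)
    moreover have "((\<lambda>t. a * t + b) has_field_derivative a) (at t)"
      by (auto intro!: derivative_eq_intros)
    ultimately have "((\<lambda>t. f (a * t + b)) has_field_derivative vderiv f (a * t + b) * a) (at t)"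
      by (rule DERIV_chain2)
    then have "((\<lambda>t. c * f (a * t + b)) has_field_derivative c * (vderiv f (a * t + b) * a)) (at t)"
      by (rule DERIV_cmult)
    then show ?thesis
      by (simp add: h(1) has_real_derivative_iff_has_vector_derivative mult_ac)
  qed
  then show "\<exists>g'\<in>{\<lambda>t. c * f (a * t + b) | c f. smooth f}. \<forall>t. (h has_vector_derivative g' t) (at t)"
    using smooth_vderiv[OF h(2)] by (intro bexI[of _ "\<lambda>t. (c * a) * vderiv f (a * t + b)"]) auto
qed

definition flat_exp :: "real \<Rightarrow> real" where
  "flat_exp x = (if x > 0 then exp (- 1 / x) else 0)"

text \<open>Every derivative of \<open>exp (- 1 / x)\<close> is a polynomial in \<open>1 / x\<close> times \<open>exp (- 1 / x)\<close>, and
  the exponential beats every polynomial at \<open>0\<close>.\<close>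

lemma poly_exp_tendsto_0: "((\<lambda>y. poly p y * exp (- y)) \<longlongrightarrow> (0::real)) at_top"
proof -
  have "((\<lambda>y. \<Sum>i\<le>degree p. coeff p i * (y ^ i / exp y)) \<longlongrightarrow> (\<Sum>i\<le>degree p. coeff p i * (0::real))) at_top"
    by (intro tendsto_intros tendsto_power_div_exp_0)
  then show ?thesis
    by (simp add: poly_altdef exp_minus field_simps sum_distrib_left sum_divide_distrib)
qed

lemma smooth_flat_exp: "smooth flat_exp"
proof -
  define F where "F p x = (if x > 0 then poly p (1 / x) * exp (- 1 / x) else 0 :: real)" for p x
  show ?thesis
  proof (rule smooth_coinduct[of _ "range F"])
    have "flat_exp = F 1" by (auto simp: flat_exp_def F_def)
    then show "flat_exp \<in> range F" by simp
  next
    fix g assume "g \<in> range F"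
    then obtain p where g: "g = F p" by blast
    define p' where "p' = monom 1 2 * (p - pderiv p)"
    have "(F p has_field_derivative F p' x) (at x)" for x
    proof (cases x "0 :: real" rule: linorder_cases)
      case less
      have "((\<lambda>_. 0) has_field_derivative 0) (at x)" by simp
      then have "(F p has_field_derivative 0) (at x)"
        by (rule DERIV_cong_ev[THEN iffD1, rotated -1])
          (use less in \<open>auto simp: F_def intro!: eventually_mono[OF eventually_nhds_in_open[of "{..<0}" x]]\<close>)
      then show ?thesis using less by (simp add: F_def)
    next
      case greater
      have "((\<lambda>x. poly p (1 / x) * exp (- 1 / x)) has_field_derivative F p' x) (at x)"
        using greater
        by (auto intro!: derivative_eq_intros simp: F_def p'_def poly_monom field_simps power2_eq_square)
      then show ?thesis
        by (rule DERIV_cong_ev[THEN iffD1, rotated -1])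
          (use greater in \<open>auto simp: F_def intro!: eventually_mono[OF eventually_nhds_in_open[of "{0<..}" x]]\<close>)
    next
      case equal
      have "((\<lambda>h. F p h / h) \<longlongrightarrow> 0) (at_right 0)"
      proof -
        have "((\<lambda>x. poly (pCons 0 p) (inverse x) * exp (- inverse x)) \<longlongrightarrow> 0) (at_right (0::real))"
          by (rule filterlim_compose[OF poly_exp_tendsto_0 filterlim_inverse_at_top_right])
        then show ?thesis
          by (rule Lim_transform_eventually)
            (auto simp: eventually_at_right_field F_def field_simps intro!: exI[of _ 1])
      qed
      moreover have "((\<lambda>h. F p h / h) \<longlongrightarrow> 0) (at_left 0)"
        by (rule tendsto_eventually) (auto simp: eventually_at_left_field F_def intro!: exI[of _ "-1"])
      ultimately have "((\<lambda>h. F p h / h) \<longlongrightarrow> 0) (at 0)"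
        by (simp add: filterlim_split_at_real)
      then show ?thesis using equal by (simp add: has_field_derivative_iff F_def)
    qed
    then show "\<exists>g'\<in>range F. \<forall>t. (g has_vector_derivative g' t) (at t)"
      by (auto simp: g has_real_derivative_iff_has_vector_derivative)
  qed
qed

text \<open>As \<open>m\<close> grows, these functions increase to the indicator of the interval from \<open>c\<close> to \<open>d\<close>; they
  serve as smooth cutoffs.\<close>

definition bump :: "real \<Rightarrow> real \<Rightarrow> real \<Rightarrow> real \<Rightarrow> real" where
  "bump m c d t = flat_exp (m * (t - c)) * flat_exp (m * (d - t))"

lemma smooth_bump: "smooth (bump m c d)"
proof -
  have "smooth (\<lambda>t. flat_exp (m * t + (- m * c)) * flat_exp (- m * t + m * d))"
    by (intro smooth_mult smooth_affine smooth_flat_exp)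
  then show ?thesis by (simp add: bump_def[abs_def] algebra_simps)
qed

lemma bump_eq_0: "m > 0 \<Longrightarrow> t \<le> c \<or> d \<le> t \<Longrightarrow> bump m c d t = 0"
  unfolding bump_def flat_exp_def
  using mult_nonneg_nonpos[of m "t - c"] mult_nonneg_nonpos[of m "d - t"] by (auto simp: not_less)

lemma bump_pos: "m > 0 \<Longrightarrow> c < t \<Longrightarrow> t < d \<Longrightarrow> 0 < bump m c d t"
  by (auto simp: bump_def flat_exp_def)

lemma flat_exp_bounds: "0 \<le> flat_exp x" "flat_exp x \<le> 1"
  by (auto simp: flat_exp_def)

lemma bump_bounds: "0 \<le> bump m c d t" "bump m c d t \<le> 1"
  unfolding bump_def by (intro mult_nonneg_nonneg mult_le_one flat_exp_bounds)+

lemma bump_tendsto_indicator: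
  "(\<lambda>n. bump (real (Suc n)) c d t) \<longlonglongrightarrow> indicator {c<..<d} t"
proof (cases "t \<in> {c<..<d}")
  case True
  have lim: "(\<lambda>n. flat_exp (real (Suc n) * x)) \<longlonglongrightarrow> 1" if "x > 0" for x
  proof -
    have "(\<lambda>n. exp (- (1 / real (Suc n)) * (1 / x))) \<longlonglongrightarrow> exp (- 0 * (1 / x))"
      by (intro tendsto_intros LIMSEQ_Suc[OF lim_1_over_n])
    then show ?thesis using that by (simp add: flat_exp_def)
  qed
  have "(\<lambda>n. bump (real (Suc n)) c d t) \<longlonglongrightarrow> 1 * 1"
    unfolding bump_def by (intro tendsto_mult lim) (use True in auto)
  then show ?thesis using True by simp
next
  case False
  then have "bump (real (Suc n)) c d t = 0" for n by (intro bump_eq_0) auto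
  then show ?thesis using False by simp
qed

section \<open>Test functions\<close>

lemma test_functionI:
  assumes "smooth \<phi>" "0 < a" "b < 1" "\<And>t. \<phi> t \<noteq> 0 \<Longrightarrow> a \<le> t \<and> t \<le> b"
  shows "\<phi> \<in> test_functions"
proof -
  have "closure {t. \<phi> t \<noteq> 0} \<subseteq> {a..b}"
    by (rule closure_minimal) (use assms(4) in auto)
  moreover from this have "compact (closure {t. \<phi> t \<noteq> 0})"
    by (metis closed_closure compact_Icc compact_Int_closed inf.absorb_iff2)
  ultimately show ?thesis using assms by (force simp: test_functions_def)
qed

lemma test_function_support:
  assumes "\<phi> \<in> test_functions"
  obtains a b where "0 < a" "a < b" "b < 1" "\<And>t. t \<notin> {a..b} \<Longrightarrow> \<phi> t = 0"
proof (cases "closure {t. \<phi> t \<noteq> 0} = {}")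
  case True
  then have "{t. \<phi> t \<noteq> 0} = {}" by simp
  then show ?thesis by (intro that[of "1/3" "1/2"]) auto
next
  case False
  let ?S = "closure {t. \<phi> t \<noteq> 0}"
  have S: "compact ?S" "?S \<subseteq> {0<..<1}" using assms by (auto simp: test_functions_def)
  obtain a where a: "a \<in> ?S" "\<And>t. t \<in> ?S \<Longrightarrow> a \<le> t" using compact_attains_inf[OF S(1) False] by blast
  obtain b where b: "b \<in> ?S" "\<And>t. t \<in> ?S \<Longrightarrow> t \<le> b" using compact_attains_sup[OF S(1) False] by blast
  have ab: "0 < a" "a < 1" "0 < b" "b < 1" "a \<le> b" using a b S(2) by auto
  show ?thesis
  proof (rule that[of a "(b + 1) / 2"])
    fix t assume "t \<notin> {a..(b + 1) / 2}"
    then have "t \<notin> ?S" using a(2) b(2) ab by force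
    then show "\<phi> t = 0" using closure_subset[of "{t. \<phi> t \<noteq> 0}"] by auto
  qed (use ab in auto)
qed

lemma test_function_smooth: "\<phi> \<in> test_functions \<Longrightarrow> smooth \<phi>"
  by (simp add: test_functions_def)

lemma test_function_bounded_linear:
  assumes "bounded_linear h" "\<phi> \<in> test_functions"
  shows "(\<lambda>t. h (\<phi> t)) \<in> test_functions"
proof -
  obtain a b where ab: "0 < a" "a < b" "b < 1" "\<And>t. t \<notin> {a..b} \<Longrightarrow> \<phi> t = 0"
    using test_function_support[OF assms(2)] by blast
  show ?thesis
  proof (rule test_functionI[OF smooth_bounded_linear[OF assms(1) test_function_smooth[OF assms(2)]] ab(1,3)])
    fix t assume "h (\<phi> t) \<noteq> 0"
    then have "\<phi> t \<noteq> 0" using linear_0[OF bounded_linear.linear[OF assms(1)]] by metis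
    then show "a \<le> t \<and> t \<le> b" using ab(4)[of t] by (cases "t \<in> {a..b}") auto
  qed
qed

lemma test_function_add:
  assumes "\<phi> \<in> test_functions" "\<psi> \<in> test_functions"
  shows "(\<lambda>t. \<phi> t + \<psi> t) \<in> test_functions"
proof -
  obtain a b where ab: "0 < a" "a < b" "b < 1" "\<And>t. t \<notin> {a..b} \<Longrightarrow> \<phi> t = 0"
    using test_function_support[OF assms(1)] by blast
  obtain c d where cd: "0 < c" "c < d" "d < 1" "\<And>t. t \<notin> {c..d} \<Longrightarrow> \<psi> t = 0"
    using test_function_support[OF assms(2)] by blast
  have "smooth (\<lambda>t. \<phi> t + \<psi> t)" by (intro smooth_add test_function_smooth assms)
  then show ?thesis
  proof (rule test_functionI[of _ "min a c" "max b d"])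
    fix t assume "\<phi> t + \<psi> t \<noteq> 0"
    then have "\<phi> t \<noteq> 0 \<or> \<psi> t \<noteq> 0" by auto
    then have "t \<in> {a..b} \<or> t \<in> {c..d}" using ab(4) cd(4) by blast
    then show "min a c \<le> t \<and> t \<le> max b d" by auto
  qed (use ab(1-3) cd(1-3) in auto)
qed

section \<open>The differential operator on test functions\<close>

lemma continuous_on_matrix_vector_mult:
  fixes A :: "'a::topological_space \<Rightarrow> real^'n^'m"
  assumes "continuous_on S A" "continuous_on S f"
  shows "continuous_on S (\<lambda>x. A x *v f x)"
  unfolding matrix_vector_mult_def by (intro continuous_intros assms)

text \<open>The map \<open>(t, v) \<mapsto> R t *v v\<close> is continuous on the compact product of the interval and the unit sphere.\<close>

lemma matrix_norm_bound:
  fixes R :: "real \<Rightarrow> real^'n^'n"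
  assumes "continuous_on {0..1} R"
  obtains M where "M \<ge> 0" "\<And>t v. t \<in> {0..1} \<Longrightarrow> norm (R t *v v) \<le> M * norm v"
proof -
  have "continuous_on ({0..1} \<times> sphere 0 1) (\<lambda>p. R (fst p))"
    by (rule continuous_on_compose2[OF assms continuous_on_fst[OF continuous_on_id]]) auto
  then have "continuous_on ({0..1} \<times> sphere 0 1) (\<lambda>p. R (fst p) *v snd p)"
    by (rule continuous_on_matrix_vector_mult) (intro continuous_intros)
  then have "compact ((\<lambda>p. R (fst p) *v snd p) ` ({0..1} \<times> sphere 0 1))"
    by (intro compact_continuous_image compact_Times) auto
  then have "\<exists>M. \<forall>x\<in>(\<lambda>p. R (fst p) *v snd p) ` ({0..1} \<times> sphere 0 1). norm x \<le> M"
    unfolding bounded_iff[symmetric] by (rule compact_imp_bounded)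
  then obtain M where M: "\<And>t v. t \<in> {0..1} \<Longrightarrow> norm v = 1 \<Longrightarrow> norm (R t *v v) \<le> M"
    by force
  show thesis
  proof (rule that[of "\<bar>M\<bar>"])
    fix t :: real and v :: "real^'n" assume t: "t \<in> {0..1}"
    show "norm (R t *v v) \<le> \<bar>M\<bar> * norm v"
    proof (cases "v = 0")
      case False
      have "norm (R t *v (v /\<^sub>R norm v)) \<le> M"
        by (rule M) (use t False in auto)
      then have "norm (R t *v v) \<le> M * norm v"
        using False by (simp add: matrix_vector_mult_scaleR field_simps)
      also have "\<dots> \<le> \<bar>M\<bar> * norm v" by (intro mult_right_mono) auto
      finally show ?thesis .
    qed simp
  qed simp
qed

lemma continuous_on_Icc_bounded:
  fixes f :: "real \<Rightarrow> 'a::real_normed_vector"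
  assumes "continuous_on {a..b} f"
  obtains B where "\<And>t. t \<in> {a..b} \<Longrightarrow> norm (f t) \<le> B"
proof -
  have "\<exists>B. \<forall>x\<in>f ` {a..b}. norm x \<le> B"
    unfolding bounded_iff[symmetric]
    by (rule compact_imp_bounded[OF compact_continuous_image[OF assms compact_Icc]])
  then show thesis using that by blast
qed

lemma square_integrable_compact_support:
  fixes f :: "real \<Rightarrow> 'a::euclidean_space"
  assumes cont: "continuous_on {0<..<1} f"
    and supp: "0 < a" "b < 1" "\<And>t. t \<notin> {a..b} \<Longrightarrow> f t = 0"
  shows "square_integrable f"
proof -
  interpret finite_measure unit_interval by (rule finite_measure_unit_interval)
  have meas: "f \<in> borel_measurable unit_interval"
    by (rule continuous_imp_measurable_on_sets_lebesgue[OF cont]) simp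
  have "continuous_on {a..b} f" by (rule continuous_on_subset[OF cont]) (use supp in auto)
  then obtain B where B: "\<And>t. t \<in> {a..b} \<Longrightarrow> norm (f t) \<le> B"
    using continuous_on_Icc_bounded by blast
  have "norm (f t) \<le> \<bar>B\<bar>" for t
    using B[of t] supp(3)[of t] by (cases "t \<in> {a..b}") auto
  then have "(norm (f t))\<^sup>2 \<le> \<bar>B\<bar>\<^sup>2" for t
    by (rule power_mono) simp
  then have "AE t in unit_interval. norm ((norm (f t))\<^sup>2) \<le> \<bar>B\<bar>\<^sup>2"
    by simp
  then have "integrable unit_interval (\<lambda>t. (norm (f t))\<^sup>2)"
    using meas by (intro integrable_const_bound) auto
  then show ?thesis using meas by (simp add: square_integrable_def)
qed

lemma square_integrable_test_function:
  fixes \<phi> :: "real \<Rightarrow> 'a::euclidean_space"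
  assumes "\<phi> \<in> test_functions"
  shows "square_integrable \<phi>"
proof -
  obtain a b where "0 < a" "a < b" "b < 1" "\<And>t. t \<notin> {a..b} \<Longrightarrow> \<phi> t = 0"
    using test_function_support[OF assms] by blast
  then show ?thesis
    using smooth_continuous_on[OF test_function_smooth[OF assms]]
    by (intro square_integrable_compact_support[of \<phi> a b])
qed

lemma bessel_expression_outside_support:
  assumes "\<And>t. t \<notin> {a..b} \<Longrightarrow> \<phi> t = 0" "t \<notin> {a..b}"
  shows "bessel_expression R \<phi> t = 0"
proof -
  have "vderiv (vderiv \<phi>) t = 0"
    by (rule vderiv_eq_0_outside[OF vderiv_eq_0_outside[OF assms(1)] assms(2)])
  then show ?thesis using assms(1)[OF assms(2)] by (simp add: bessel_expression_def)
qed

lemma continuous_on_bessel_expression: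
  assumes R: "continuous_on {0..1} R" and \<phi>: "smooth \<phi>" and A: "A \<subseteq> {0<..1}"
  shows "continuous_on A (bessel_expression R \<phi>)"
proof -
  have "continuous_on A R" by (rule continuous_on_subset[OF R]) (use A in auto)
  then have "continuous_on A (\<lambda>t. R t *v \<phi> t)"
    by (rule continuous_on_matrix_vector_mult) (rule smooth_continuous_on[OF \<phi>])
  then show ?thesis
    unfolding bessel_expression_def[abs_def] using A
    by (intro continuous_on_add continuous_on_minus continuous_on_scaleR
        smooth_continuous_on[OF smooth_vderiv[OF smooth_vderiv[OF \<phi>]]] continuous_intros) auto
qed

lemma square_integrable_bessel_expression:
  assumes R: "continuous_on {0..1} R" and \<phi>: "\<phi> \<in> test_functions"
  shows "square_integrable (bessel_expression R \<phi>)"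
proof -
  obtain a b where ab: "0 < a" "a < b" "b < 1" "\<And>t. t \<notin> {a..b} \<Longrightarrow> \<phi> t = 0"
    using test_function_support[OF \<phi>] by blast
  have "continuous_on {0<..<1} (bessel_expression R \<phi>)"
    by (rule continuous_on_bessel_expression[OF R test_function_smooth[OF \<phi>]]) auto
  then show ?thesis
    by (rule square_integrable_compact_support[OF _ ab(1,3)])
      (rule bessel_expression_outside_support[OF ab(4)])
qed

lemma bessel_expression_add:
  "smooth \<phi> \<Longrightarrow> smooth \<psi> \<Longrightarrow>
    bessel_expression R (\<lambda>t. \<phi> t + \<psi> t) = (\<lambda>t. bessel_expression R \<phi> t + bessel_expression R \<psi> t)"
  unfolding bessel_expression_def
  by (rule ext) (simp add: vderiv_add[of \<phi> \<psi>] vderiv_add[OF smooth_vderiv smooth_vderiv, of \<phi> \<psi>]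
      matrix_vector_right_distrib algebra_simps)

lemma bessel_expression_scaleR:
  "smooth \<phi> \<Longrightarrow> bessel_expression R (\<lambda>t. c *\<^sub>R \<phi> t) = (\<lambda>t. c *\<^sub>R bessel_expression R \<phi> t)"
  unfolding bessel_expression_def
  by (simp add: vderiv_bounded_linear[OF bounded_linear_scaleR_right, of \<phi> c]
      vderiv_bounded_linear[OF bounded_linear_scaleR_right smooth_vderiv, of \<phi> c]
      matrix_vector_mult_scaleR scaleR_diff_right mult.commute)

text \<open>The zeros on \<open>P\<close> decouple the pieces into which \<open>P\<close> cuts the interval: the form splits into forms
  on the pieces, while only finitely many dimensions of the minimal operator are lost.\<close>

definition test_graph ::
  "(real \<Rightarrow> real^'n^'n) \<Rightarrow> real set \<Rightarrow> ((real^'n) L2 \<times> (real^'n) L2) set" where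
  "test_graph R P =
    (\<lambda>\<phi>. (to_L2 \<phi>, to_L2 (bessel_expression R \<phi>))) ` {\<phi> \<in> test_functions. \<forall>t\<in>P. \<phi> t = 0}"

lemma test_graphI:
  "\<phi> \<in> test_functions \<Longrightarrow> (\<And>t. t \<in> P \<Longrightarrow> \<phi> t = 0) \<Longrightarrow>
    (to_L2 \<phi>, to_L2 (bessel_expression R \<phi>)) \<in> test_graph R P"
  unfolding test_graph_def by (rule image_eqI[OF refl]) simp

lemma test_graph_subset_minimal_operator: "test_graph R P \<subseteq> minimal_operator R"
  unfolding test_graph_def minimal_operator_def
  by (rule subset_trans[OF image_mono closure_subset]) (rule Collect_restrict)

lemma subspace_test_graph:
  fixes R :: "real \<Rightarrow> real^'n^'n"
  assumes R: "continuous_on {0..1} R"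
  shows "subspace (test_graph R P)"
proof -
  note simps = square_integrable_test_function square_integrable_bessel_expression[OF R]
  show ?thesis
  proof (rule subspaceI)
    have "(\<lambda>_. 0) \<in> (test_functions :: (real \<Rightarrow> real^'n) set)"
      by (rule test_functionI[of _ "1/3" "1/2"]) (auto simp: smooth_zero)
    then have "(to_L2 (\<lambda>_. 0), to_L2 (bessel_expression R (\<lambda>_. 0))) \<in> test_graph R P"
      by (rule test_graphI) simp
    moreover have "vderiv (\<lambda>_. 0 :: real^'n) = (\<lambda>_. 0)" by (rule vderiv_eq) simp
    then have "bessel_expression R (\<lambda>_. 0) = (\<lambda>_. 0)"
      by (intro ext) (simp add: bessel_expression_def)
    ultimately show "0 \<in> test_graph R P" by (simp add: zero_prod_def zero_to_L2)
  next
    fix x y assume "x \<in> test_graph R P" "y \<in> test_graph R P"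
    then obtain \<phi> \<psi> where xy: "x = (to_L2 \<phi>, to_L2 (bessel_expression R \<phi>))"
      "y = (to_L2 \<psi>, to_L2 (bessel_expression R \<psi>))"
      "\<phi> \<in> test_functions" "\<psi> \<in> test_functions" "\<forall>t\<in>P. \<phi> t = 0" "\<forall>t\<in>P. \<psi> t = 0"
      unfolding test_graph_def by blast
    have "x + y = (to_L2 (\<lambda>t. \<phi> t + \<psi> t), to_L2 (bessel_expression R (\<lambda>t. \<phi> t + \<psi> t)))"
      by (simp add: xy add_to_L2 simps bessel_expression_add test_function_smooth)
    also have "\<dots> \<in> test_graph R P"
      by (rule test_graphI[OF test_function_add]) (use xy in auto)
    finally show "x + y \<in> test_graph R P" .
  next
    fix c x assume "x \<in> test_graph R P"
    then obtain \<phi> where x: "x = (to_L2 \<phi>, to_L2 (bessel_expression R \<phi>))"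
      "\<phi> \<in> test_functions" "\<forall>t\<in>P. \<phi> t = 0"
      unfolding test_graph_def by blast
    have "c *\<^sub>R x = (to_L2 (\<lambda>t. c *\<^sub>R \<phi> t), to_L2 (bessel_expression R (\<lambda>t. c *\<^sub>R \<phi> t)))"
      by (simp add: x scaleR_to_L2 simps bessel_expression_scaleR test_function_smooth)
    also have "\<dots> \<in> test_graph R P"
      by (rule test_graphI[OF test_function_bounded_linear[OF bounded_linear_scaleR_right]])
        (use x in auto)
    finally show "c *\<^sub>R x \<in> test_graph R P" .
  qed
qed

section \<open>Lower bounds for the quadratic form\<close>

text \<open>Completing the square: \<open>\<bar>\<phi>' - w \<phi>\<bar>\<^sup>2 \<ge> 0\<close> gives \<open>\<bar>\<phi>'\<bar>\<^sup>2 \<ge> (w \<bar>\<phi>\<bar>\<^sup>2)' - (w' + w\<^sup>2) \<bar>\<phi>\<bar>\<^sup>2\<close>, so a function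
  \<open>w\<close> satisfying a Riccati inequality bounds the form on functions vanishing at the endpoints. Hardy's
  inequality is the case \<open>w = 1 / (2 t)\<close>, Poincare's the case of affine \<open>w\<close>.\<close>

lemma form_nonneg_of_Riccati:
  fixes R :: "real \<Rightarrow> real^'n^'n"
  assumes R: "continuous_on {0..1} R" and \<phi>: "smooth \<phi>"
    and xy: "0 < x" "x \<le> y" "y \<le> 1" "\<phi> x = 0" "\<phi> y = 0"
    and w: "\<And>t. t \<in> {x..y} \<Longrightarrow> (w has_real_derivative w' t) (at t)"
    and Riccati: "\<And>t v. t \<in> {x..y} \<Longrightarrow> (c + w' t + (w t)\<^sup>2) * (norm v)\<^sup>2 \<le> inner (R t *v v) v / t\<^sup>2"
  shows "0 \<le> integral {x..y} (\<lambda>t. inner (bessel_expression R \<phi> t) (\<phi> t) - c * (norm (\<phi> t))\<^sup>2)"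
proof -
  define D where "D t = w t * inner (\<phi> t) (\<phi> t) - inner (vderiv \<phi> t) (\<phi> t)" for t
  define D' where "D' t = w' t * inner (\<phi> t) (\<phi> t) + w t * (2 * inner (vderiv \<phi> t) (\<phi> t))
    - (inner (vderiv (vderiv \<phi>) t) (\<phi> t) + inner (vderiv \<phi> t) (vderiv \<phi> t))" for t
  have inner_deriv: "((\<lambda>t. inner (f t) (g t)) has_real_derivative
      (inner (f t) (vderiv g t) + inner (vderiv f t) (g t))) (at t)"
    if "smooth f" "smooth g" for f g :: "real \<Rightarrow> real^'n" and t
    unfolding has_real_derivative_iff_has_vector_derivative
    by (intro bounded_bilinear.has_vector_derivative[OF bounded_bilinear_inner]
        smooth_has_vector_derivative that)
  have "(D has_real_derivative D' t) (at t)" if "t \<in> {x..y}" for t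
  proof -
    have "(D has_real_derivative (w' t * inner (\<phi> t) (\<phi> t)
        + (inner (\<phi> t) (vderiv \<phi> t) + inner (vderiv \<phi> t) (\<phi> t)) * w t)
        - (inner (vderiv \<phi> t) (vderiv \<phi> t) + inner (vderiv (vderiv \<phi>) t) (\<phi> t))) (at t)"
      unfolding D_def
      by (intro DERIV_diff DERIV_mult w[OF that] inner_deriv \<phi> smooth_vderiv)
    then show ?thesis by (simp add: D'_def inner_commute algebra_simps)
  qed
  then have "(D' has_integral (D y - D x)) {x..y}"
    by (intro fundamental_theorem_of_calculus xy)
      (auto simp flip: has_real_derivative_iff_has_vector_derivative intro: has_field_derivative_at_within)
  then have D': "(D' has_integral 0) {x..y}" by (simp add: D_def xy)
  have "continuous_on {x..y} (\<lambda>t. inner (bessel_expression R \<phi> t) (\<phi> t) - c * (norm (\<phi> t))\<^sup>2)"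
    by (intro continuous_intros continuous_on_bessel_expression[OF R \<phi>] smooth_continuous_on \<phi>)
      (use xy in auto)
  then have "(\<lambda>t. inner (bessel_expression R \<phi> t) (\<phi> t) - c * (norm (\<phi> t))\<^sup>2) integrable_on {x..y}"
    by (rule integrable_continuous_real)
  then show ?thesis
  proof (rule has_integral_le[OF D' integrable_integral])
    fix t assume t: "t \<in> {x..y}"
    have "0 \<le> inner (vderiv \<phi> t - w t *\<^sub>R \<phi> t) (vderiv \<phi> t - w t *\<^sub>R \<phi> t)" by simp
    also have "\<dots> = inner (vderiv \<phi> t) (vderiv \<phi> t) - 2 * w t * inner (vderiv \<phi> t) (\<phi> t)
        + (w t)\<^sup>2 * inner (\<phi> t) (\<phi> t)"
      by (simp add: inner_diff_left inner_diff_right inner_commute power2_eq_square algebra_simps)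
    finally have sq: "2 * w t * inner (vderiv \<phi> t) (\<phi> t) - (w t)\<^sup>2 * inner (\<phi> t) (\<phi> t)
        \<le> inner (vderiv \<phi> t) (vderiv \<phi> t)" by simp
    have "inner (bessel_expression R \<phi> t) (\<phi> t)
        = - inner (vderiv (vderiv \<phi>) t) (\<phi> t) + inner (R t *v \<phi> t) (\<phi> t) / t\<^sup>2"
      by (simp add: bessel_expression_def inner_add_left inner_diff_left)
    moreover have "(c + w' t + (w t)\<^sup>2) * inner (\<phi> t) (\<phi> t) \<le> inner (R t *v \<phi> t) (\<phi> t) / t\<^sup>2"
      using Riccati[OF t, of "\<phi> t"] by (simp add: power2_norm_eq_inner)
    ultimately show "D' t \<le> inner (bessel_expression R \<phi> t) (\<phi> t) - c * (norm (\<phi> t))\<^sup>2"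
      using sq unfolding D'_def power2_norm_eq_inner by (simp add: algebra_simps)
  qed
qed

text \<open>The weights \<open>w\<close> on different intervals need not match, because \<open>\<phi>\<close> vanishes at the points \<open>\<tau> i\<close>. A
  weight on the first interval may be singular at \<open>0\<close>, because the support of \<open>\<phi>\<close> stays away from \<open>0\<close>.\<close>

lemma form_coercive_of_Riccati:
  fixes R :: "real \<Rightarrow> real^'n^'n" and \<tau> :: "nat \<Rightarrow> real"
  assumes R: "continuous_on {0..1} R" and \<phi>: "\<phi> \<in> test_functions"
    and \<tau>: "\<tau> 0 = 0" "\<tau> N = 1" "\<And>i. i < N \<Longrightarrow> \<tau> i < \<tau> (Suc i)"
    and zero: "\<And>i. i \<le> N \<Longrightarrow> \<phi> (\<tau> i) = 0"
    and Riccati: "\<And>i. i < N \<Longrightarrow> \<exists>w w'. \<forall>t. \<tau> i \<le> t \<longrightarrow> t \<le> \<tau> (Suc i) \<longrightarrow> 0 < t \<longrightarrow>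
        (w has_real_derivative w' t) (at t) \<and>
        (\<forall>v. (c + w' t + (w t)\<^sup>2) * (norm v)\<^sup>2 \<le> inner (R t *v v) v / t\<^sup>2)"
  shows "c * (norm (to_L2 \<phi>))\<^sup>2 \<le> inner (to_L2 (bessel_expression R \<phi>)) (to_L2 \<phi>)"
proof -
  note sm = test_function_smooth[OF \<phi>]
  note sq = square_integrable_test_function[OF \<phi>] square_integrable_bessel_expression[OF R \<phi>]
  define f where "f t = inner (bessel_expression R \<phi> t) (\<phi> t) - c * (norm (\<phi> t))\<^sup>2" for t
  obtain a b where ab: "0 < a" "a < b" "b < 1" "\<And>t. t \<notin> {a..b} \<Longrightarrow> \<phi> t = 0"
    using test_function_support[OF \<phi>] by blast
  have N: "0 < N" using \<tau>(1,2) by (metis gr0I zero_neq_one)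
  have mono: "\<tau> i \<le> \<tau> j" if "i \<le> j" "j \<le> N" for i j
    using that
  proof (induction j rule: dec_induct)
    case (step j)
    then show ?case using \<tau>(3)[of j] by simp
  qed simp
  \<comment> \<open>integration starts at a positive point \<open>x\<close> to the left of the support\<close>
  define x where "x = min (a / 2) (\<tau> 1)"
  have x: "0 < x" "x < a" "x \<le> \<tau> 1" using ab \<tau>(1) \<tau>(3)[OF N] by (auto simp: x_def)
  have \<phi>x: "\<phi> x = 0" by (rule ab(4)) (use x in auto)
  have int: "f integrable_on {s..t}" if "0 < s" "t \<le> 1" for s t
    unfolding f_def
    by (intro integrable_continuous_real continuous_intros continuous_on_bessel_expression[OF R sm]
        smooth_continuous_on sm) (use that in auto)
  have step: "0 \<le> integral {s..\<tau> (Suc i)} f" if i: "i < N" and s: "0 < s" "\<tau> i \<le> s" "s \<le> \<tau> (Suc i)" "\<phi> s = 0" for i s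
  proof -
    obtain w w' where w: "\<And>t. \<tau> i \<le> t \<Longrightarrow> t \<le> \<tau> (Suc i) \<Longrightarrow> 0 < t \<Longrightarrow>
        (w has_real_derivative w' t) (at t) \<and>
        (\<forall>v. (c + w' t + (w t)\<^sup>2) * (norm v)\<^sup>2 \<le> inner (R t *v v) v / t\<^sup>2)"
      using Riccati[OF i] by blast
    show ?thesis
      unfolding f_def
    proof (rule form_nonneg_of_Riccati[OF R sm, of s "\<tau> (Suc i)" w w'])
      show "\<tau> (Suc i) \<le> 1" using mono[of "Suc i" N] i \<tau>(2) by simp
      show "(w has_real_derivative w' t) (at t)" if "t \<in> {s..\<tau> (Suc i)}" for t
        using w[of t] that s by auto
      show "(c + w' t + (w t)\<^sup>2) * (norm v)\<^sup>2 \<le> inner (R t *v v) v / t\<^sup>2"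
        if "t \<in> {s..\<tau> (Suc i)}" for t v
        using w[of t] that s by auto
    qed (use i s zero[of "Suc i"] in auto)
  qed
  have "0 \<le> integral {x..\<tau> (Suc i)} f" if "i < N" for i
    using that
  proof (induction i)
    case 0
    show ?case by (rule step) (use 0 x \<phi>x \<tau>(1) in auto)
  next
    case (Suc i)
    have le: "\<tau> (Suc i) \<le> \<tau> (Suc (Suc i))" "\<tau> 1 \<le> \<tau> (Suc i)" "\<tau> (Suc (Suc i)) \<le> 1"
      using mono[of "Suc i" "Suc (Suc i)"] mono[of 1 "Suc i"] mono[of "Suc (Suc i)" N] Suc(2) \<tau>(2) by auto
    have "0 \<le> integral {\<tau> (Suc i)..\<tau> (Suc (Suc i))} f"
      by (rule step) (use Suc le x zero in auto)
    moreover have "integral {x..\<tau> (Suc i)} f + integral {\<tau> (Suc i)..\<tau> (Suc (Suc i))} f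
        = integral {x..\<tau> (Suc (Suc i))} f"
      by (rule Henstock_Kurzweil_Integration.integral_combine) (use le x int in auto)
    ultimately show ?case using Suc by simp
  qed
  from this[of "N - 1"] have "0 \<le> integral {x..1} f" using N \<tau>(2) by simp
  also have "\<dots> = integral {0<..<1} f"
  proof (rule integral_spike_set)
    have "{t \<in> {x..1} - {0<..<1}. f t \<noteq> 0} \<subseteq> {1}" using x by auto
    then show "negligible {t \<in> {x..1} - {0<..<1}. f t \<noteq> 0}"
      using negligible_subset[OF negligible_sing] by blast
    have "f t = 0" if "t < x" for t
      using ab(4)[of t] x(2) that by (simp add: f_def)
    then have "{t \<in> {0<..<1} - {x..1}. f t \<noteq> 0} = {}" by force
    then show "negligible {t \<in> {0<..<1} - {x..1}. f t \<noteq> 0}" by (simp only: negligible_empty)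
  qed
  also have "\<dots> = (\<integral>t. f t \<partial>unit_interval)"
    unfolding f_def using sq
    by (intro lebesgue_integral_eq_integral[symmetric] Bochner_Integration.integrable_diff
        integrable_inner_square integrable_mult_right) (auto simp: square_integrable_def)
  also have "\<dots> = (\<integral>t. inner (bessel_expression R \<phi> t) (\<phi> t) \<partial>unit_interval)
      - (\<integral>t. c * (norm (\<phi> t))\<^sup>2 \<partial>unit_interval)"
    unfolding f_def using sq
    by (intro Bochner_Integration.integral_diff integrable_inner_square integrable_mult_right)
      (auto simp: square_integrable_def)
  also have "\<dots> = inner (to_L2 (bessel_expression R \<phi>)) (to_L2 \<phi>) - c * (norm (to_L2 \<phi>))\<^sup>2"
    using sq by (simp add: inner_to_L2 norm_to_L2)
  finally show ?thesis by simp
qed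

section \<open>Weak solutions\<close>

text \<open>Vanishing is required at \<open>c\<close> and \<open>d\<close> themselves, so that primitives of such functions are constant
  on the closed rays outside the interval from \<open>c\<close> to \<open>d\<close>.\<close>

definition interval_test :: "real \<Rightarrow> real \<Rightarrow> (real \<Rightarrow> real) set" where
  "interval_test a b =
    {\<psi>. smooth \<psi> \<and> (\<exists>c d. a < c \<and> c < d \<and> d < b \<and> (\<forall>t. t \<notin> {c<..<d} \<longrightarrow> \<psi> t = 0))}"

lemma interval_testI:
  "smooth \<psi> \<Longrightarrow> a < c \<Longrightarrow> c < d \<Longrightarrow> d < b \<Longrightarrow> (\<And>t. t \<notin> {c<..<d} \<Longrightarrow> \<psi> t = 0) \<Longrightarrow>
    \<psi> \<in> interval_test a b"
  unfolding interval_test_def by blast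

lemma interval_testE:
  assumes "\<psi> \<in> interval_test a b"
  obtains c d where "smooth \<psi>" "a < c" "c < d" "d < b" "\<And>t. t \<notin> {c<..<d} \<Longrightarrow> \<psi> t = 0"
  using assms unfolding interval_test_def by blast

lemma smooth_interval_test: "\<psi> \<in> interval_test a b \<Longrightarrow> smooth \<psi>"
  by (simp add: interval_test_def)

lemma interval_test_outside:
  assumes "\<psi> \<in> interval_test a b" "t \<notin> {a<..<b}"
  shows "\<psi> t = 0"
proof -
  obtain c d where cd: "a < c" "c < d" "d < b" "\<And>t. t \<notin> {c<..<d} \<Longrightarrow> \<psi> t = 0"
    using interval_testE[OF assms(1)] by blast
  show ?thesis by (rule cd(4)) (use cd(1-3) assms(2) in auto)
qed

lemma interval_test_add_scale:
  assumes "\<psi> \<in> interval_test a b" "\<eta> \<in> interval_test a b"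
  shows "(\<lambda>t. \<psi> t + r * \<eta> t) \<in> interval_test a b"
proof -
  obtain c d where cd: "smooth \<psi>" "a < c" "c < d" "d < b" "\<And>t. t \<notin> {c<..<d} \<Longrightarrow> \<psi> t = 0"
    using interval_testE[OF assms(1)] by blast
  obtain c' d' where cd': "smooth \<eta>" "a < c'" "c' < d'" "d' < b" "\<And>t. t \<notin> {c'<..<d'} \<Longrightarrow> \<eta> t = 0"
    using interval_testE[OF assms(2)] by blast
  show ?thesis
  proof (rule interval_testI[of _ _ "min c c'" "max d d'"])
    show "smooth (\<lambda>t. \<psi> t + r * \<eta> t)"
      by (rule smooth_add[OF cd(1) smooth_bounded_linear[OF bounded_linear_mult_right cd'(1)]])
    fix t assume "t \<notin> {min c c'<..<max d d'}"
    then have "t \<notin> {c<..<d}" "t \<notin> {c'<..<d'}" by auto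
    then show "\<psi> t + r * \<eta> t = 0" using cd(5) cd'(5) by simp
  qed (use cd(2-4) cd'(2-4) in auto)
qed

lemma vderiv_add_scale:
  fixes f g :: "real \<Rightarrow> real"
  assumes "smooth f" "smooth g"
  shows "vderiv (\<lambda>t. f t + r * g t) = (\<lambda>t. vderiv f t + r * vderiv g t)"
  using vderiv_add[OF assms(1) smooth_bounded_linear[OF bounded_linear_mult_right assms(2)], of r]
    vderiv_bounded_linear[OF bounded_linear_mult_right assms(2), of r] by simp

lemma interval_test_vderiv:
  assumes "\<psi> \<in> interval_test a b"
  shows "vderiv \<psi> \<in> interval_test a b"
proof -
  obtain c d where cd: "smooth \<psi>" "a < c" "c < d" "d < b" "\<And>t. t \<notin> {c<..<d} \<Longrightarrow> \<psi> t = 0"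
    using interval_testE[OF assms(1)] by blast
  show ?thesis
  proof (rule interval_testI[of _ _ "(a + c) / 2" "(d + b) / 2"])
    fix t assume t: "t \<notin> {(a + c) / 2<..<(d + b) / 2}"
    have "t \<notin> {c..d}" using t cd(2-4) by auto
    then show "vderiv \<psi> t = 0" by (intro vderiv_eq_0_outside[of c d]) (auto intro: cd(5))
  qed (use cd in \<open>auto intro: smooth_vderiv\<close>)
qed

lemma interval_test_bump:
  "a < c \<Longrightarrow> c < d \<Longrightarrow> d < b \<Longrightarrow> m > 0 \<Longrightarrow> bump m c d \<in> interval_test a b"
  by (rule interval_testI[OF smooth_bump, of _ c d]) (auto intro!: bump_eq_0)

lemma
  fixes f :: "real \<Rightarrow> 'a::euclidean_space"
  assumes "continuous_on {a..b} f"
  shows integrable_continuous_open: "integrable (lebesgue_on {a<..<b}) f"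
    and integral_continuous_open: "(\<integral>t. f t \<partial>lebesgue_on {a<..<b}) = integral {a..b} f"
proof -
  interpret finite_measure "lebesgue_on {a<..<b}" by (rule finite_measure_lebesgue_on) simp
  obtain B where B: "\<And>t. t \<in> {a..b} \<Longrightarrow> norm (f t) \<le> B"
    using continuous_on_Icc_bounded[OF assms] by blast
  show int: "integrable (lebesgue_on {a<..<b}) f"
  proof (rule integrable_const_bound)
    show "AE t in lebesgue_on {a<..<b}. norm (f t) \<le> B"
      by (rule AE_I2) (use B in auto)
    show "f \<in> borel_measurable (lebesgue_on {a<..<b})"
      by (rule continuous_imp_measurable_on_sets_lebesgue[OF continuous_on_subset[OF assms]]) auto
  qed
  show "(\<integral>t. f t \<partial>lebesgue_on {a<..<b}) = integral {a..b} f"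
    using lebesgue_integral_eq_integral[OF int] by (simp add: integral_open_interval_real)
qed

lemma integrable_continuous_scaleR:
  fixes h :: "real \<Rightarrow> 'a::euclidean_space" and p :: "real \<Rightarrow> real"
  assumes p: "continuous_on {a..b} p" and h: "integrable (lebesgue_on {a<..<b}) h"
  shows "integrable (lebesgue_on {a<..<b}) (\<lambda>t. p t *\<^sub>R h t)"
proof -
  obtain B where B: "\<And>t. t \<in> {a..b} \<Longrightarrow> norm (p t) \<le> B"
    using continuous_on_Icc_bounded[OF p] by blast
  have pm: "p \<in> borel_measurable (lebesgue_on {a<..<b})"
    by (rule borel_measurable_integrable[OF integrable_continuous_open[OF p]])
  show ?thesis
  proof (rule Bochner_Integration.integrable_bound)
    show "integrable (lebesgue_on {a<..<b}) (\<lambda>t. B *\<^sub>R norm (h t))"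
      using h by simp
    show "AE t in lebesgue_on {a<..<b}. norm (p t *\<^sub>R h t) \<le> norm (B *\<^sub>R norm (h t))"
    proof (rule AE_I2)
      fix t assume "t \<in> space (lebesgue_on {a<..<b})"
      then have "norm (p t) \<le> \<bar>B\<bar>" using B[of t] by simp
      then show "norm (p t *\<^sub>R h t) \<le> norm (B *\<^sub>R norm (h t))"
        by (simp add: abs_mult mult_right_mono)
    qed
  qed (use h pm in simp)
qed

text \<open>The fundamental lemma of the calculus of variations: bump functions approximate indicators of
  intervals, so all integrals of \<open>h\<close> over intervals vanish, and Lebesgue differentiation applies.\<close>

lemma AE_zero_of_orthogonal_tests:
  fixes h :: "real \<Rightarrow> 'a::euclidean_space"
  assumes h: "integrable (lebesgue_on {a<..<b}) h"
    and orth: "\<And>\<psi>. \<psi> \<in> interval_test a b \<Longrightarrow> (\<integral>t. \<psi> t *\<^sub>R h t \<partial>lebesgue_on {a<..<b}) = 0"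
  shows "AE t in lebesgue_on {a<..<b}. h t = 0"
proof -
  let ?M = "lebesgue_on {a<..<b}"
  define f where "f t = (if t \<in> {a<..<b} then h t else 0)" for t
  have hm: "h \<in> borel_measurable ?M" using h by simp
  have int0: "integral {c..d} f = 0" if cd: "a < c" "c < d" "d < b" for c d
  proof -
    let ?g = "\<lambda>t. indicat_real {c<..<d} t *\<^sub>R h t"
    have bm: "bump (real (Suc n)) c d \<in> borel_measurable ?M" for n
      by (rule continuous_imp_measurable_on_sets_lebesgue[OF smooth_continuous_on[OF smooth_bump]]) simp
    have im: "(\<lambda>t. indicat_real {c<..<d} t) \<in> borel_measurable ?M"
      by (intro borel_measurable_indicator) (use cd in \<open>auto simp: sets_restrict_space_iff\<close>)
    have "(\<lambda>n. \<integral>t. bump (real (Suc n)) c d t *\<^sub>R h t \<partial>?M) \<longlonglongrightarrow> (\<integral>t. ?g t \<partial>?M)"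
    proof (rule integral_dominated_convergence)
      show "integrable ?M (\<lambda>t. norm (h t))" using h by simp
      show "AE t in ?M. (\<lambda>n. bump (real (Suc n)) c d t *\<^sub>R h t) \<longlonglongrightarrow> ?g t"
        by (intro AE_I2 tendsto_scaleR tendsto_const bump_tendsto_indicator)
      show "AE t in ?M. norm (bump (real (Suc n)) c d t *\<^sub>R h t) \<le> norm (h t)" for n
        using bump_bounds[of "real (Suc n)" c d] by (intro AE_I2) (simp add: mult_left_le_one_le)
    qed (use hm bm im in \<open>auto intro!: borel_measurable_scaleR\<close>)
    moreover have "(\<integral>t. bump (real (Suc n)) c d t *\<^sub>R h t \<partial>?M) = 0" for n
      by (rule orth[OF interval_test_bump[OF cd]]) simp
    ultimately have g0: "(\<integral>t. ?g t \<partial>?M) = 0"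
      using LIMSEQ_unique[OF tendsto_const[of 0]] by simp
    have "integrable ?M ?g"
    proof (rule Bochner_Integration.integrable_bound[OF h])
      show "?g \<in> borel_measurable ?M" by (intro borel_measurable_scaleR im hm)
      show "AE t in ?M. norm (?g t) \<le> norm (h t)"
        by (rule AE_I2) (simp add: indicator_def)
    qed
    then have "integral {a<..<b} ?g = 0"
      using lebesgue_integral_eq_integral[of "{a<..<b}" ?g] g0 by simp
    also have "integral {a<..<b} ?g = integral {a<..<b} (\<lambda>t. if t \<in> {c<..<d} then f t else 0)"
      by (rule Henstock_Kurzweil_Integration.integral_cong) (auto simp: f_def indicator_def)
    also have "\<dots> = integral {c<..<d} f"
      using integral_restrict_Int[of "{a<..<b}" "{c<..<d}" f] cd
      by (simp add: Int_absorb1 greaterThanLessThan_subseteq_greaterThanLessThan)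
    finally show ?thesis by (simp add: integral_open_interval_real)
  qed
  have "integrable lebesgue (\<lambda>t. indicat_real {a<..<b} t *\<^sub>R h t)"
    using h integrable_restrict_space[of "{a<..<b}" lebesgue h] by simp
  then have "integrable lebesgue f"
    by (simp add: f_def[abs_def] indicator_scaleR_eq_if)
  then have "f absolutely_integrable_on cbox x y" for x y
    by (intro set_integrable_subset[of lebesgue UNIV f "cbox x y"]) (auto simp: set_integrable_def)
  then have "f integrable_on cbox x y" for x y
    by (rule set_lebesgue_integral_eq_integral(1))
  then obtain N where N: "negligible N" "\<And>x e. \<lbrakk>x \<notin> N; 0 < e\<rbrakk> \<Longrightarrow>
      \<exists>d>0. \<forall>r. 0 < r \<and> r < d \<longrightarrow> norm (integral (cbox x (x + r *\<^sub>R One)) f /\<^sub>R r ^ DIM(real) - f x) < e"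
    using integrable_ccontinuous_explicit[of f] by metis
  have zero: "h t = 0" if t: "t \<in> {a<..<b}" "t \<notin> N" for t
  proof (rule ccontr)
    assume "h t \<noteq> 0"
    then have "f t \<noteq> 0" using t by (simp add: f_def)
    then obtain d where d: "d > 0" "\<forall>r. 0 < r \<and> r < d \<longrightarrow>
        norm (integral (cbox t (t + r *\<^sub>R One)) f /\<^sub>R r ^ DIM(real) - f t) < norm (f t)"
      using N(2)[OF t(2), of "norm (f t)"] by auto
    define r where "r = min (d / 2) ((b - t) / 2)"
    have r: "0 < r" "r < d" "t + r < b" using d(1) t by (auto simp: r_def min_def field_simps)
    have "integral {t..t + r} f = 0" by (rule int0) (use t r in auto)
    then show False using d(2) r by auto
  qed
  show ?thesis
    unfolding AE_restrict_space_iff[of "{a<..<b}" lebesgue, simplified] eventually_ae_filter_negligible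
    using N(1) zero by (intro exI[of _ N]) auto
qed

lemma interval_test_primitive:
  assumes \<psi>: "\<psi> \<in> interval_test a b" and int: "integral {a..b} \<psi> = 0"
  obtains \<Psi> where "\<Psi> \<in> interval_test a b" "vderiv \<Psi> = \<psi>"
proof -
  obtain c d where cd: "smooth \<psi>" "a < c" "c < d" "d < b" "\<And>t. t \<notin> {c<..<d} \<Longrightarrow> \<psi> t = 0"
    using interval_testE[OF \<psi>] by blast
  have cont: "continuous_on A \<psi>" for A by (rule smooth_continuous_on[OF cd(1)])
  define \<Psi> where "\<Psi> t = integral {a..t} \<psi>" for t
  have zero: "integral {x..y} \<psi> = 0" if "y \<le> c \<or> d \<le> x" for x y
  proof -
    have "integral {x..y} \<psi> = integral {x..y} (\<lambda>_. 0)"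
      by (rule Henstock_Kurzweil_Integration.integral_cong) (use that cd(5) in auto)
    then show ?thesis by simp
  qed
  have low: "\<Psi> t = 0" if "t \<le> c" for t
    unfolding \<Psi>_def by (rule zero) (use that in simp)
  have split: "integral {a..t} \<psi> = integral {a..d} \<psi>" if "t \<ge> d" for t
    using Henstock_Kurzweil_Integration.integral_combine[of a d t \<psi>] zero[of t d] cd that
    by (simp add: integrable_continuous_real cont)
  have high: "\<Psi> t = 0" if "t \<ge> d" for t
    using split[OF that] split[of b] int cd(4) unfolding \<Psi>_def by simp
  have deriv: "(\<Psi> has_vector_derivative \<psi> t) (at t)" for t
  proof -
    consider "t < c" | "t > d" | "a < t" "t < b" using cd by linarith
    then show ?thesis
    proof cases
      case 1
      have "((\<lambda>_. 0) has_vector_derivative 0) (at t)" by simp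
      then have "(\<Psi> has_vector_derivative 0) (at t)"
        by (rule has_vector_derivative_transform_within_open[of _ _ _ "{..<c}"]) (use 1 low in auto)
      then show ?thesis using cd(5)[of t] 1 by simp
    next
      case 2
      have "((\<lambda>_. 0) has_vector_derivative 0) (at t)" by simp
      then have "(\<Psi> has_vector_derivative 0) (at t)"
        by (rule has_vector_derivative_transform_within_open[of _ _ _ "{d<..}"]) (use 2 high in auto)
      then show ?thesis using cd(5)[of t] 2 by simp
    next
      case 3
      then have "(\<Psi> has_vector_derivative \<psi> t) (at t within {a..b})"
        unfolding \<Psi>_def by (intro integral_has_vector_derivative cont) auto
      then show ?thesis using 3 by (simp add: at_within_Icc_at)
    qed
  qed
  have vd: "vderiv \<Psi> = \<psi>" by (rule vderiv_eq[OF deriv])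
  have "smooth \<Psi>"
    by (rule smooth_coinduct[of \<Psi> "insert \<Psi> (Collect smooth)"])
      (use deriv cd(1) smooth_vderiv smooth_has_vector_derivative in blast)+
  then have "\<Psi> \<in> interval_test a b"
    by (rule interval_testI[OF _ cd(2,3,4)]) (use low high in force)
  then show thesis using vd that by blast
qed

lemma interval_test_integral_by_parts:
  assumes \<psi>: "\<psi> \<in> interval_test a b" and "a < b"
  shows "integral {a..b} \<psi> = - integral {a..b} (\<lambda>t. t * vderiv \<psi> t)"
proof -
  have sm: "smooth \<psi>" by (rule smooth_interval_test[OF \<psi>])
  have z: "\<psi> a = 0" "\<psi> b = 0" by (rule interval_test_outside[OF \<psi>]; simp)+
  have "((\<lambda>t. t * \<psi> t) has_vector_derivative (t * vderiv \<psi> t + 1 * \<psi> t)) (at t within {a..b})" for t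
    by (intro has_vector_derivative_mult smooth_has_vector_derivative sm has_vector_derivative_id)
  then have "((\<lambda>t. t * vderiv \<psi> t + 1 * \<psi> t) has_integral (b * \<psi> b - a * \<psi> a)) {a..b}"
    using assms by (intro fundamental_theorem_of_calculus) auto
  then have "integral {a..b} (\<lambda>t. t * vderiv \<psi> t + \<psi> t) = 0"
    using z by (simp add: integral_unique)
  moreover have "integral {a..b} (\<lambda>t. t * vderiv \<psi> t + \<psi> t)
      = integral {a..b} (\<lambda>t. t * vderiv \<psi> t) + integral {a..b} \<psi>"
    by (intro Henstock_Kurzweil_Integration.integral_add integrable_continuous_real
        continuous_on_mult continuous_on_id smooth_continuous_on smooth_vderiv sm)
  ultimately show ?thesis by simp
qed

lemma normalised_interval_test:
  assumes "a < b"
  obtains \<eta> where "\<eta> \<in> interval_test a b" "integral {a..b} \<eta> = 1"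
proof -
  define c where "c = (2 * a + b) / 3"
  define d where "d = (a + 2 * b) / 3"
  have cd: "a < c" "c < d" "d < b" using assms by (simp_all add: c_def d_def)
  define f where "f = bump 1 c d"
  have f: "f \<in> interval_test a b" unfolding f_def by (rule interval_test_bump[OF cd]) simp
  have cont: "continuous_on {a..b} f" by (rule smooth_continuous_on[OF smooth_interval_test[OF f]])
  have nn: "f t \<ge> 0" for t unfolding f_def by (rule bump_bounds)
  have "integral {a..b} f \<noteq> 0"
  proof
    assume "integral {a..b} f = 0"
    then have "\<And>t. t \<in> {a..b} \<Longrightarrow> f t = 0"
      using integral_eq_0_iff[OF cont] nn assms by auto
    then have "f ((c + d) / 2) = 0" using cd by auto
    moreover have "f ((c + d) / 2) > 0" unfolding f_def by (rule bump_pos) (use cd in auto)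
    ultimately show False by simp
  qed
  moreover have "(\<lambda>t. f t + (inverse (integral {a..b} f) - 1) * f t) \<in> interval_test a b"
    by (rule interval_test_add_scale[OF f f])
  then have "(\<lambda>t. inverse (integral {a..b} f) * f t) \<in> interval_test a b"
    by (simp add: algebra_simps)
  ultimately show thesis using that[of "\<lambda>t. inverse (integral {a..b} f) * f t"] by simp
qed

text \<open>A test function is the derivative of a test function precisely when its mean vanishes, so a fixed
  \<open>\<eta>\<close> of mean one measures the obstruction.\<close>

lemma interval_test_primitive_modulo:
  assumes \<psi>: "\<psi> \<in> interval_test a b" and \<eta>: "\<eta> \<in> interval_test a b" "integral {a..b} \<eta> = 1"
  obtains \<Psi> where "\<Psi> \<in> interval_test a b"
    "vderiv \<Psi> = (\<lambda>t. \<psi> t + (- integral {a..b} \<psi>) * \<eta> t)"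
proof -
  define r where "r = integral {a..b} \<psi>"
  have test: "(\<lambda>t. \<psi> t + (- r) * \<eta> t) \<in> interval_test a b"
    by (rule interval_test_add_scale[OF \<psi> \<eta>(1)])
  have "integral {a..b} (\<lambda>t. \<psi> t + (- r) * \<eta> t)
      = integral {a..b} \<psi> + integral {a..b} (\<lambda>t. (- r) * \<eta> t)"
    by (intro Henstock_Kurzweil_Integration.integral_add integrable_continuous_real
        continuous_on_mult continuous_on_const smooth_continuous_on[OF smooth_interval_test[OF \<psi>]]
        smooth_continuous_on[OF smooth_interval_test[OF \<eta>(1)]])
  then have "integral {a..b} (\<lambda>t. \<psi> t + (- r) * \<eta> t) = 0" using \<eta>(2) by (simp add: r_def)
  then show thesis using interval_test_primitive[OF test] that unfolding r_def by blast
qed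

text \<open>The two du Bois-Reymond lemmas: a function annihilating all first (second) derivatives of test
  functions is constant (affine). A test function is a derivative of one up to a multiple of a fixed
  normalised \<open>\<eta>\<close>.\<close>

lemma du_Bois_Reymond_1:
  fixes h :: "real \<Rightarrow> 'a::euclidean_space"
  assumes ab: "a < b" and h: "integrable (lebesgue_on {a<..<b}) h"
    and orth: "\<And>\<psi>. \<psi> \<in> interval_test a b \<Longrightarrow> (\<integral>t. vderiv \<psi> t *\<^sub>R h t \<partial>lebesgue_on {a<..<b}) = 0"
  obtains c where "AE t in lebesgue_on {a<..<b}. h t = c"
proof -
  let ?M = "lebesgue_on {a<..<b}"
  obtain \<eta> where \<eta>: "\<eta> \<in> interval_test a b" "integral {a..b} \<eta> = 1"
    using normalised_interval_test[OF ab] by blast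
  define C where "C = (\<integral>t. \<eta> t *\<^sub>R h t \<partial>?M)"
  have ci: "continuous_on {a..b} \<psi>" if "\<psi> \<in> interval_test a b" for \<psi>
    by (rule smooth_continuous_on[OF smooth_interval_test[OF that]])
  have const: "integrable ?M (\<lambda>_. C)" by (rule integrable_continuous_open) simp
  have "AE t in ?M. h t - C = 0"
  proof (rule AE_zero_of_orthogonal_tests)
    show "integrable ?M (\<lambda>t. h t - C)" by (rule Bochner_Integration.integrable_diff[OF h const])
    fix \<psi> assume \<psi>: "\<psi> \<in> interval_test a b"
    define r where "r = integral {a..b} \<psi>"
    obtain \<Psi> where \<Psi>: "\<Psi> \<in> interval_test a b" "vderiv \<Psi> = (\<lambda>t. \<psi> t + (- r) * \<eta> t)"
      using interval_test_primitive_modulo[OF \<psi> \<eta>] unfolding r_def by blast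
    note i1 = integrable_continuous_scaleR[OF ci[OF \<psi>] h]
      and i2 = integrable_continuous_scaleR[OF ci[OF \<eta>(1)] h]
    have "0 = (\<integral>t. \<psi> t *\<^sub>R h t - r *\<^sub>R (\<eta> t *\<^sub>R h t) \<partial>?M)"
      using orth[OF \<Psi>(1)] by (simp add: \<Psi>(2) scaleR_left_diff_distrib)
    also have "\<dots> = (\<integral>t. \<psi> t *\<^sub>R h t \<partial>?M) - r *\<^sub>R C"
      using i1 i2 by (simp add: C_def del: scaleR_scaleR)
    also have "r *\<^sub>R C = (\<integral>t. \<psi> t *\<^sub>R C \<partial>?M)"
      using integrable_continuous_open[OF ci[OF \<psi>]] integral_continuous_open[OF ci[OF \<psi>]]
      by (simp add: r_def)
    also have "(\<integral>t. \<psi> t *\<^sub>R h t \<partial>?M) - (\<integral>t. \<psi> t *\<^sub>R C \<partial>?M) = (\<integral>t. \<psi> t *\<^sub>R (h t - C) \<partial>?M)"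
      using i1 integrable_continuous_scaleR[OF ci[OF \<psi>] const] by (simp add: scaleR_right_diff_distrib)
    finally show "(\<integral>t. \<psi> t *\<^sub>R (h t - C) \<partial>?M) = 0" by simp
  qed
  then have "AE t in ?M. h t = C" by simp
  then show thesis by (rule that)
qed

lemma du_Bois_Reymond_2:
  fixes h :: "real \<Rightarrow> 'a::euclidean_space"
  assumes ab: "a < b" and h: "integrable (lebesgue_on {a<..<b}) h"
    and orth: "\<And>\<psi>. \<psi> \<in> interval_test a b \<Longrightarrow>
      (\<integral>t. vderiv (vderiv \<psi>) t *\<^sub>R h t \<partial>lebesgue_on {a<..<b}) = 0"
  obtains c d where "AE t in lebesgue_on {a<..<b}. h t = c + t *\<^sub>R d"
proof -
  let ?M = "lebesgue_on {a<..<b}"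
  obtain \<eta> where \<eta>: "\<eta> \<in> interval_test a b" "integral {a..b} \<eta> = 1"
    using normalised_interval_test[OF ab] by blast
  define C where "C = (\<integral>t. vderiv \<eta> t *\<^sub>R h t \<partial>?M)"
  have ci: "continuous_on {a..b} \<psi>" if "\<psi> \<in> interval_test a b" for \<psi>
    by (rule smooth_continuous_on[OF smooth_interval_test[OF that]])
  have lin: "integrable ?M (\<lambda>t. t *\<^sub>R C)"
    by (rule integrable_continuous_open) (intro continuous_intros)
  obtain c where c: "AE t in ?M. h t + t *\<^sub>R C = c"
  proof (rule du_Bois_Reymond_1[OF ab])
    show "integrable ?M (\<lambda>t. h t + t *\<^sub>R C)" by (rule Bochner_Integration.integrable_add[OF h lin])
    fix \<psi> assume \<psi>: "\<psi> \<in> interval_test a b"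
    define r where "r = integral {a..b} \<psi>"
    obtain \<Psi> where \<Psi>: "\<Psi> \<in> interval_test a b" "vderiv \<Psi> = (\<lambda>t. \<psi> t + (- r) * \<eta> t)"
      using interval_test_primitive_modulo[OF \<psi> \<eta>] unfolding r_def by blast
    have dd: "vderiv (vderiv \<Psi>) = (\<lambda>t. vderiv \<psi> t + (- r) * vderiv \<eta> t)"
      unfolding \<Psi>(2) by (intro vderiv_add_scale smooth_interval_test[OF \<psi>] smooth_interval_test[OF \<eta>(1)])
    note \<psi>' = interval_test_vderiv[OF \<psi>] and \<eta>' = interval_test_vderiv[OF \<eta>(1)]
    note i1 = integrable_continuous_scaleR[OF ci[OF \<psi>'] h]
      and i2 = integrable_continuous_scaleR[OF ci[OF \<eta>'] h]
    have "0 = (\<integral>t. vderiv \<psi> t *\<^sub>R h t - r *\<^sub>R (vderiv \<eta> t *\<^sub>R h t) \<partial>?M)"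
      using orth[OF \<Psi>(1)] by (simp add: dd scaleR_left_diff_distrib)
    also have "\<dots> = (\<integral>t. vderiv \<psi> t *\<^sub>R h t \<partial>?M) - r *\<^sub>R C"
      using i1 i2 by (simp add: C_def del: scaleR_scaleR)
    also have "r *\<^sub>R C = - (\<integral>t. vderiv \<psi> t *\<^sub>R (t *\<^sub>R C) \<partial>?M)"
    proof -
      have "continuous_on {a..b} (\<lambda>t. t * vderiv \<psi> t)" by (intro continuous_on_mult continuous_on_id ci \<psi>')
      from integrable_continuous_open[OF this] integral_continuous_open[OF this]
      have "(\<integral>t. (t * vderiv \<psi> t) *\<^sub>R C \<partial>?M) = integral {a..b} (\<lambda>t. t * vderiv \<psi> t) *\<^sub>R C" by simp
      then show ?thesis
        using interval_test_integral_by_parts[OF \<psi> ab] by (simp add: r_def mult.commute)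
    qed
    also have "(\<integral>t. vderiv \<psi> t *\<^sub>R h t \<partial>?M) - - (\<integral>t. vderiv \<psi> t *\<^sub>R (t *\<^sub>R C) \<partial>?M)
        = (\<integral>t. vderiv \<psi> t *\<^sub>R (h t + t *\<^sub>R C) \<partial>?M)"
      using i1 integrable_continuous_scaleR[OF ci[OF \<psi>'] lin] by (simp add: scaleR_right_distrib)
    finally show "(\<integral>t. vderiv \<psi> t *\<^sub>R (h t + t *\<^sub>R C) \<partial>?M) = 0" by simp
  qed
  have "AE t in ?M. h t = c + t *\<^sub>R (- C)"
    using c by eventually_elim (simp add: eq_diff_eq)
  then show thesis by (rule that)
qed

text \<open>Formally the solution \<open>G\<close> of \<open>G'' = q\<close> with \<open>G\<close> and \<open>G'\<close> vanishing at the right endpoint \<open>b\<close>. The base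
  point is \<open>b\<close> because the potential may fail to be integrable at the left endpoint only.\<close>

definition second_primitive :: "real \<Rightarrow> real \<Rightarrow> (real \<Rightarrow> 'a::euclidean_space) \<Rightarrow> real \<Rightarrow> 'a" where
  "second_primitive a b q s = (\<integral>t. max 0 (t - s) *\<^sub>R q t \<partial>lebesgue_on {a<..<b})"

text \<open>Fubini's theorem for the bounded kernel \<open>max 0 (t - s)\<close>. Against \<open>p = \<psi>''\<close> it replaces two
  integrations by parts, in which \<open>G'\<close> would only be absolutely continuous.\<close>

lemma
  fixes q :: "real \<Rightarrow> 'a::euclidean_space"
  assumes q: "integrable (lebesgue_on {a<..<b}) q" and p: "continuous_on {a..b} p"
  shows integrable_second_primitive: "integrable (lebesgue_on {a<..<b}) (second_primitive a b q)"
    and integral_second_primitive: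
      "(\<integral>s. p s *\<^sub>R second_primitive a b q s \<partial>lebesgue_on {a<..<b})
        = (\<integral>t. (\<integral>s. max 0 (t - s) * p s \<partial>lebesgue_on {a<..<b}) *\<^sub>R q t \<partial>lebesgue_on {a<..<b})"
proof -
  let ?M = "lebesgue_on {a<..<b}"
  interpret finite_measure ?M by (rule finite_measure_lebesgue_on) simp
  interpret pair_sigma_finite ?M ?M by standard
  have id: "(\<lambda>x. x) \<in> borel_measurable ?M"
    by (rule continuous_imp_measurable_on_sets_lebesgue) (auto intro: continuous_intros)
  have qm: "q \<in> borel_measurable ?M" using q by simp
  have key: "integrable (?M \<Otimes>\<^sub>M ?M) (\<lambda>(s, t). (f s * max 0 (t - s)) *\<^sub>R q t)"
    if f: "continuous_on {a..b} f" for f :: "real \<Rightarrow> real"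
  proof -
    have fm: "f \<in> borel_measurable ?M"
      by (rule borel_measurable_integrable[OF integrable_continuous_open[OF f]])
    obtain B where B: "\<And>t. t \<in> {a..b} \<Longrightarrow> norm (f t) \<le> B"
      using continuous_on_Icc_bounded[OF f] by blast
    have m[measurable]: "(\<lambda>z. f (fst z)) \<in> borel_measurable (?M \<Otimes>\<^sub>M ?M)"
      "(\<lambda>z. fst z) \<in> borel_measurable (?M \<Otimes>\<^sub>M ?M)"
      "(\<lambda>z. snd z) \<in> borel_measurable (?M \<Otimes>\<^sub>M ?M)"
      "(\<lambda>z. q (snd z)) \<in> borel_measurable (?M \<Otimes>\<^sub>M ?M)"
      by (rule measurable_compose[OF measurable_fst fm] measurable_compose[OF measurable_fst id]
          measurable_compose[OF measurable_snd id] measurable_compose[OF measurable_snd qm])+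
    have iq: "integrable (?M \<Otimes>\<^sub>M ?M) (\<lambda>z. q (snd z))"
    proof -
      have "integrable (?M \<Otimes>\<^sub>M ?M) (\<lambda>(s, t). q t)"
      proof (rule Fubini_integrable)
        show "(\<lambda>(s, t). q t) \<in> borel_measurable (?M \<Otimes>\<^sub>M ?M)"
          using m(4) by (simp add: case_prod_beta)
      qed (use q in auto)
      then show ?thesis unfolding case_prod_beta .
    qed
    have "integrable (?M \<Otimes>\<^sub>M ?M) (\<lambda>z. (f (fst z) * max 0 (snd z - fst z)) *\<^sub>R q (snd z))"
    proof (rule Bochner_Integration.integrable_bound)
      show "integrable (?M \<Otimes>\<^sub>M ?M) (\<lambda>z. (\<bar>B\<bar> * \<bar>b - a\<bar>) * norm (q (snd z)))"
        using iq by (intro integrable_mult_right integrable_norm)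
      show "AE z in ?M \<Otimes>\<^sub>M ?M. norm ((f (fst z) * max 0 (snd z - fst z)) *\<^sub>R q (snd z))
          \<le> norm ((\<bar>B\<bar> * \<bar>b - a\<bar>) * norm (q (snd z)))"
      proof (rule AE_I2)
        fix z assume "z \<in> space (?M \<Otimes>\<^sub>M ?M)"
        then have z: "fst z \<in> {a<..<b}" "snd z \<in> {a<..<b}"
          by (auto simp: space_pair_measure)
        have "\<bar>f (fst z)\<bar> \<le> \<bar>B\<bar>" using B[of "fst z"] z(1) by simp
        moreover have "\<bar>max 0 (snd z - fst z)\<bar> \<le> \<bar>b - a\<bar>" using z by auto
        ultimately have "\<bar>f (fst z)\<bar> * \<bar>max 0 (snd z - fst z)\<bar> \<le> \<bar>B\<bar> * \<bar>b - a\<bar>"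
          by (intro mult_mono) auto
        then show "norm ((f (fst z) * max 0 (snd z - fst z)) *\<^sub>R q (snd z))
          \<le> norm ((\<bar>B\<bar> * \<bar>b - a\<bar>) * norm (q (snd z)))"
          by (simp add: abs_mult mult_right_mono)
      qed
    qed measurable
    then show ?thesis unfolding case_prod_beta .
  qed
  show "integrable ?M (second_primitive a b q)"
    using integrable_fst[OF key[of "\<lambda>_. 1"]] by (simp add: second_primitive_def[abs_def])
  have "(\<integral>s. p s *\<^sub>R second_primitive a b q s \<partial>?M)
      = (\<integral>s. (\<integral>t. (p s * max 0 (t - s)) *\<^sub>R q t \<partial>?M) \<partial>?M)"
    by (simp add: second_primitive_def flip: scaleR_scaleR)
  also have "\<dots> = (\<integral>t. (\<integral>s. (p s * max 0 (t - s)) *\<^sub>R q t \<partial>?M) \<partial>?M)"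
    by (rule Fubini_integral[OF key[OF p], symmetric])
  also have "\<dots> = (\<integral>t. (\<integral>s. max 0 (t - s) * p s \<partial>?M) *\<^sub>R q t \<partial>?M)"
  proof (intro Bochner_Integration.integral_cong refl)
    fix t
    have "continuous_on {a..b} (\<lambda>s. max 0 (t - s) * p s)" by (intro continuous_intros p)
    from integrable_continuous_open[OF this]
    show "(\<integral>s. (p s * max 0 (t - s)) *\<^sub>R q t \<partial>?M) = (\<integral>s. max 0 (t - s) * p s \<partial>?M) *\<^sub>R q t"
      by (simp add: mult.commute)
  qed
  finally show "(\<integral>s. p s *\<^sub>R second_primitive a b q s \<partial>?M)
      = (\<integral>t. (\<integral>s. max 0 (t - s) * p s \<partial>?M) *\<^sub>R q t \<partial>?M)" .
qed

lemma integral_positive_part_kernel: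
  fixes p P :: "real \<Rightarrow> real"
  assumes t: "t \<in> {a<..<b}" and p: "continuous_on {a..b} p"
    and P: "\<And>s. s \<in> {a..t} \<Longrightarrow> (P has_real_derivative (t - s) * p s) (at s)"
  shows "(\<integral>s. max 0 (t - s) * p s \<partial>lebesgue_on {a<..<b}) = P t - P a"
proof -
  have cont: "continuous_on {a..b} (\<lambda>s. max 0 (t - s) * p s)" by (intro continuous_intros p)
  have "(\<integral>s. max 0 (t - s) * p s \<partial>lebesgue_on {a<..<b}) = integral {a..b} (\<lambda>s. max 0 (t - s) * p s)"
    by (rule integral_continuous_open[OF cont])
  also have "\<dots> = integral {a..t} (\<lambda>s. max 0 (t - s) * p s) + integral {t..b} (\<lambda>s. max 0 (t - s) * p s)"
    using t by (intro Henstock_Kurzweil_Integration.integral_combine[symmetric]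
        integrable_continuous_real[OF cont]) auto
  also have "integral {t..b} (\<lambda>s. max 0 (t - s) * p s) = integral {t..b} (\<lambda>_. 0)"
    by (rule Henstock_Kurzweil_Integration.integral_cong) auto
  also have "integral {a..t} (\<lambda>s. max 0 (t - s) * p s) = integral {a..t} (\<lambda>s. (t - s) * p s)"
    by (rule Henstock_Kurzweil_Integration.integral_cong) auto
  also have "((\<lambda>s. (t - s) * p s) has_integral (P t - P a)) {a..t}"
    using t P by (intro fundamental_theorem_of_calculus)
      (auto simp flip: has_real_derivative_iff_has_vector_derivative intro: has_field_derivative_at_within)
  then have "integral {a..t} (\<lambda>s. (t - s) * p s) = P t - P a" by (rule integral_unique)
  finally show ?thesis by simp
qed

lemma Taylor_interval_test:
  assumes \<psi>: "\<psi> \<in> interval_test a b" and t: "t \<in> {a<..<b}"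
  shows "(\<integral>s. max 0 (t - s) * vderiv (vderiv \<psi>) s \<partial>lebesgue_on {a<..<b}) = \<psi> t"
proof -
  have sm: "smooth \<psi>" by (rule smooth_interval_test[OF \<psi>])
  define P where "P s = (t - s) * vderiv \<psi> s + \<psi> s" for s
  have d: "(f has_real_derivative vderiv f s) (at s)" if "smooth f" for f :: "real \<Rightarrow> real" and s
    using smooth_has_vector_derivative[OF that] by (simp add: has_real_derivative_iff_has_vector_derivative)
  have "(\<integral>s. max 0 (t - s) * vderiv (vderiv \<psi>) s \<partial>lebesgue_on {a<..<b}) = P t - P a"
  proof (rule integral_positive_part_kernel[OF t])
    show "continuous_on {a..b} (vderiv (vderiv \<psi>))" by (intro smooth_continuous_on smooth_vderiv sm)
    fix s
    have "((\<lambda>s. (t - s) * vderiv \<psi> s + \<psi> s) has_real_derivative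
        ((0 - 1) * vderiv \<psi> s + vderiv (vderiv \<psi>) s * (t - s)) + vderiv \<psi> s) (at s)"
      by (intro DERIV_add DERIV_mult DERIV_diff DERIV_const DERIV_ident d smooth_vderiv sm)
    then show "(P has_real_derivative (t - s) * vderiv (vderiv \<psi>) s) (at s)"
      by (simp add: P_def[abs_def] algebra_simps)
  qed
  also have "\<dots> = \<psi> t"
    using interval_test_outside[OF \<psi>, of a] interval_test_outside[OF interval_test_vderiv[OF \<psi>], of a]
    by (simp add: P_def)
  finally show ?thesis .
qed

text \<open>Weyl's lemma in one dimension: a distributional solution of \<open>v'' = q\<close> is affine plus the second
  primitive of \<open>q\<close>.\<close>

lemma weak_solution_representation:
  fixes v q :: "real \<Rightarrow> 'a::euclidean_space"
  assumes ab: "a < b" and v: "integrable (lebesgue_on {a<..<b}) v"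
    and q: "integrable (lebesgue_on {a<..<b}) q"
    and weak: "\<And>\<psi>. \<psi> \<in> interval_test a b \<Longrightarrow>
      (\<integral>t. vderiv (vderiv \<psi>) t *\<^sub>R v t \<partial>lebesgue_on {a<..<b}) = (\<integral>t. \<psi> t *\<^sub>R q t \<partial>lebesgue_on {a<..<b})"
  obtains c d where "AE s in lebesgue_on {a<..<b}. v s = c + s *\<^sub>R d + second_primitive a b q s"
proof -
  let ?M = "lebesgue_on {a<..<b}" and ?G = "second_primitive a b q"
  have G: "integrable ?M ?G" by (rule integrable_second_primitive[OF q continuous_on_const[of _ 0]])
  obtain c d where "AE s in ?M. v s - ?G s = c + s *\<^sub>R d"
  proof (rule du_Bois_Reymond_2[OF ab])
    show "integrable ?M (\<lambda>s. v s - ?G s)" by (rule Bochner_Integration.integrable_diff[OF v G])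
    fix \<psi> assume \<psi>: "\<psi> \<in> interval_test a b"
    have cont: "continuous_on {a..b} (vderiv (vderiv \<psi>))"
      by (intro smooth_continuous_on smooth_vderiv smooth_interval_test[OF \<psi>])
    have "(\<integral>s. vderiv (vderiv \<psi>) s *\<^sub>R ?G s \<partial>?M)
        = (\<integral>t. (\<integral>s. max 0 (t - s) * vderiv (vderiv \<psi>) s \<partial>?M) *\<^sub>R q t \<partial>?M)"
      by (rule integral_second_primitive[OF q cont])
    also have "\<dots> = (\<integral>t. \<psi> t *\<^sub>R q t \<partial>?M)"
      by (intro Bochner_Integration.integral_cong refl) (simp add: Taylor_interval_test[OF \<psi>])
    also have "\<dots> = (\<integral>t. vderiv (vderiv \<psi>) t *\<^sub>R v t \<partial>?M)" by (rule weak[OF \<psi>, symmetric])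
    finally show "(\<integral>s. vderiv (vderiv \<psi>) s *\<^sub>R (v s - ?G s) \<partial>?M) = 0"
      using integrable_continuous_scaleR[OF cont v] integrable_continuous_scaleR[OF cont G]
      by (simp add: scaleR_right_diff_distrib)
  qed
  then have "AE s in ?M. v s = c + s *\<^sub>R d + ?G s"
    by eventually_elim (simp add: diff_eq_eq)
  then show thesis by (rule that)
qed

text \<open>A Gronwall argument in the weighted norm with weight \<open>exp (l s)\<close>: there the second primitive has
  operator norm at most \<open>1 / l\<^sup>2\<close>, so for large \<open>l\<close> the solution operator is a contraction.\<close>

lemma second_primitive_unique:
  fixes v q :: "real \<Rightarrow> 'a::euclidean_space"
  assumes v: "integrable (lebesgue_on {a<..<b}) v" and q: "integrable (lebesgue_on {a<..<b}) q"
    and bound: "\<And>t. t \<in> {a<..<b} \<Longrightarrow> norm (q t) \<le> C * norm (v t)"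
    and eq: "AE s in lebesgue_on {a<..<b}. v s = second_primitive a b q s"
  shows "AE s in lebesgue_on {a<..<b}. v s = 0"
proof -
  let ?M = "lebesgue_on {a<..<b}"
  define l where "l = sqrt (2 * (\<bar>C\<bar> + 1))"
  have l: "l > 0" "l\<^sup>2 = 2 * (\<bar>C\<bar> + 1)" by (simp_all add: l_def)
  define p where "p s = exp (l * s)" for s
  have p: "continuous_on {a..b} p" unfolding p_def by (intro continuous_intros)
  have nv: "integrable ?M (\<lambda>t. norm (v t))" and nq: "integrable ?M (\<lambda>t. norm (q t))"
    using v q by simp_all
  have pv: "integrable ?M (\<lambda>t. p t * norm (v t))" and pq: "integrable ?M (\<lambda>t. p t * norm (q t))"
    using integrable_continuous_scaleR[OF p nv] integrable_continuous_scaleR[OF p nq] by simp_all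
  let ?G = "second_primitive a b (\<lambda>t. norm (q t))"
  have pG: "integrable ?M (\<lambda>t. p t * ?G t)"
    using integrable_continuous_scaleR[OF p integrable_second_primitive[OF nq p]] by simp
  have vG: "AE s in ?M. norm (v s) \<le> ?G s"
    using eq
  proof eventually_elim
    case (elim s)
    have "norm (v s) \<le> (\<integral>t. norm (max 0 (t - s) *\<^sub>R q t) \<partial>?M)"
      unfolding elim second_primitive_def by (rule integral_norm_bound)
    then show ?case by (simp add: second_primitive_def)
  qed
  have ker: "(\<integral>s. max 0 (t - s) * p s \<partial>?M) \<le> p t / l\<^sup>2" if t: "t \<in> {a<..<b}" for t
  proof -
    define P where "P s = (t - s) * p s / l + p s / l\<^sup>2" for s
    have "(\<integral>s. max 0 (t - s) * p s \<partial>?M) = P t - P a"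
    proof (rule integral_positive_part_kernel[OF t p])
      fix s show "(P has_real_derivative (t - s) * p s) (at s)"
        unfolding P_def p_def using l(1)
        by (auto intro!: derivative_eq_intros simp: field_simps power2_eq_square)
    qed
    moreover have "P a \<ge> 0" using t l by (simp add: P_def p_def)
    ultimately show ?thesis by (simp add: P_def)
  qed
  have "(\<integral>s. p s * norm (v s) \<partial>?M) \<le> (\<integral>s. p s * ?G s \<partial>?M)"
    by (rule integral_mono_AE[OF pv pG])
      (use vG in eventually_elim, simp add: p_def)
  also have "\<dots> = (\<integral>t. (\<integral>s. max 0 (t - s) * p s \<partial>?M) * norm (q t) \<partial>?M)"
    using integral_second_primitive[OF nq p] by simp
  also have "\<dots> \<le> (\<integral>t. (\<bar>C\<bar> / l\<^sup>2) * (p t * norm (v t)) \<partial>?M)"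
  proof (rule integral_mono_AE')
    show "integrable ?M (\<lambda>t. (\<bar>C\<bar> / l\<^sup>2) * (p t * norm (v t)))" by (rule integrable_mult_right[OF pv])
    show "AE t in ?M. (\<integral>s. max 0 (t - s) * p s \<partial>?M) * norm (q t) \<le> (\<bar>C\<bar> / l\<^sup>2) * (p t * norm (v t))"
    proof (rule AE_I2)
      fix t assume "t \<in> space ?M"
      then have t: "t \<in> {a<..<b}" by simp
      have "norm (q t) \<le> C * norm (v t)" by (rule bound[OF t])
      also have "\<dots> \<le> \<bar>C\<bar> * norm (v t)" by (intro mult_right_mono) auto
      finally have "(\<integral>s. max 0 (t - s) * p s \<partial>?M) * norm (q t) \<le> (p t / l\<^sup>2) * (\<bar>C\<bar> * norm (v t))"
        by (intro mult_mono ker[OF t]) (auto simp: p_def)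
      then show "(\<integral>s. max 0 (t - s) * p s \<partial>?M) * norm (q t) \<le> (\<bar>C\<bar> / l\<^sup>2) * (p t * norm (v t))"
        by (simp add: mult_ac)
    qed
    show "AE t in ?M. 0 \<le> (\<bar>C\<bar> / l\<^sup>2) * (p t * norm (v t))" by (simp add: p_def)
  qed
  also have "\<dots> = (\<bar>C\<bar> / l\<^sup>2) * (\<integral>t. p t * norm (v t) \<partial>?M)" by simp
  finally have le: "(\<integral>s. p s * norm (v s) \<partial>?M) \<le> (\<bar>C\<bar> / l\<^sup>2) * (\<integral>t. p t * norm (v t) \<partial>?M)" .
  have "\<bar>C\<bar> / l\<^sup>2 \<le> 1 / 2" by (simp add: l(2) field_simps)
  moreover have nn: "0 \<le> (\<integral>s. p s * norm (v s) \<partial>?M)"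
    by (rule Bochner_Integration.integral_nonneg) (simp add: p_def)
  ultimately have "(\<bar>C\<bar> / l\<^sup>2) * (\<integral>t. p t * norm (v t) \<partial>?M) \<le> (1 / 2) * (\<integral>t. p t * norm (v t) \<partial>?M)"
    by (rule mult_right_mono)
  then have "(\<integral>s. p s * norm (v s) \<partial>?M) = 0" using le nn by linarith
  then have "AE s in ?M. p s * norm (v s) = 0"
    using integral_nonneg_eq_0_iff_AE[OF pv] by (simp add: p_def)
  then show ?thesis by eventually_elim (simp add: p_def)
qed

section \<open>The annihilator of the range is finite-dimensional\<close>

lemma AE_lebesgue_on_iff:
  "S \<in> sets lebesgue \<Longrightarrow> (AE t in lebesgue_on S. Q t) \<longleftrightarrow> (AE t in lebesgue. t \<in> S \<longrightarrow> Q t)"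
  by (rule AE_restrict_space_iff) simp

lemma AE_lebesgue_on_subset:
  assumes "AE t in lebesgue_on S. Q t" "T \<subseteq> S" "S \<in> sets lebesgue" "T \<in> sets lebesgue"
  shows "AE t in lebesgue_on T. Q t"
  using assms(1) unfolding AE_lebesgue_on_iff[OF assms(3)] AE_lebesgue_on_iff[OF assms(4)]
  by eventually_elim (use assms(2) in auto)

lemma integrable_lebesgue_on_subset:
  fixes f :: "real \<Rightarrow> 'a::euclidean_space"
  assumes "integrable (lebesgue_on S) f" "T \<subseteq> S" "S \<in> sets lebesgue" "T \<in> sets lebesgue"
  shows "integrable (lebesgue_on T) f"
proof -
  have "set_integrable lebesgue S f"
    using assms(1,3) integrable_restrict_space[of S lebesgue f] by (simp add: set_integrable_def)
  then have "set_integrable lebesgue T f" by (rule set_integrable_subset) (use assms in auto)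
  then show ?thesis
    using assms(4) integrable_restrict_space[of T lebesgue f] by (simp add: set_integrable_def)
qed

lemma integral_lebesgue_on_support:
  fixes g :: "real \<Rightarrow> 'a::euclidean_space"
  assumes "S \<in> sets lebesgue" "T \<in> sets lebesgue" "\<And>t. t \<in> S \<Longrightarrow> t \<notin> T \<Longrightarrow> g t = 0" "T \<subseteq> S"
  shows "(\<integral>t. g t \<partial>lebesgue_on S) = (\<integral>t. g t \<partial>lebesgue_on T)"
proof -
  have "(\<integral>t. g t \<partial>lebesgue_on S) = (\<integral>t. indicat_real S t *\<^sub>R g t \<partial>lebesgue)"
    using assms(1) by (intro integral_restrict_space) simp
  also have "\<dots> = (\<integral>t. indicat_real T t *\<^sub>R g t \<partial>lebesgue)"
    by (rule Bochner_Integration.integral_cong) (use assms in \<open>auto simp: indicator_def\<close>)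
  also have "\<dots> = (\<integral>t. g t \<partial>lebesgue_on T)"
    using assms(2) by (intro integral_restrict_space[symmetric]) simp
  finally show ?thesis .
qed

definition potential_term :: "(real \<Rightarrow> real^'n^'n) \<Rightarrow> (real \<Rightarrow> real^'n) \<Rightarrow> real \<Rightarrow> real^'n" where
  "potential_term R f t = (1 / t\<^sup>2) *\<^sub>R (R t *v f t)"

definition annihilator ::
  "(real \<Rightarrow> real^'n^'n) \<Rightarrow> real set \<Rightarrow> (real^'n) L2 set" where
  "annihilator R P = {k. \<forall>(u, w)\<in>test_graph R P. inner k w = 0}"

context
  fixes R :: "real \<Rightarrow> real^'n^'n"
  assumes R: "continuous_on {0..1} R" and sym: "\<And>t. t \<in> {0..1} \<Longrightarrow> transpose (R t) = R t"
begin

lemma integrable_rep: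
  assumes "0 \<le> \<alpha>" "b \<le> 1"
  shows "integrable (lebesgue_on {\<alpha><..<b}) (rep_L2 u)"
  by (rule integrable_lebesgue_on_subset[OF square_integrable_integrable[OF square_integrable_rep[of u]]])
    (use assms in auto)

text \<open>The constant deteriorates as \<open>\<alpha>\<close> tends to the singular endpoint, which is why solutions are
  studied on intervals that stay away from it.\<close>

lemma potential_term_bound:
  assumes "0 < \<alpha>" "b \<le> 1"
  obtains C where "\<And>t f. t \<in> {\<alpha><..<b} \<Longrightarrow> norm (potential_term R f t) \<le> C * norm (f t)"
proof -
  obtain M where M: "M \<ge> 0" "\<And>t v. t \<in> {0..1} \<Longrightarrow> norm (R t *v v) \<le> M * norm v"
    using matrix_norm_bound[OF R] by blast
  have "norm (potential_term R f t) \<le> (M / \<alpha>\<^sup>2) * norm (f t)" if t: "t \<in> {\<alpha><..<b}" for t f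
  proof -
    have "norm (potential_term R f t) = norm (R t *v f t) / t\<^sup>2" by (simp add: potential_term_def)
    also have "\<dots> \<le> (M * norm (f t)) / \<alpha>\<^sup>2"
      using M t assms by (intro frac_le power_mono) auto
    finally show ?thesis by simp
  qed
  then show thesis using that by blast
qed

lemma integrable_potential_term:
  assumes "0 < \<alpha>" "b \<le> 1"
  shows "integrable (lebesgue_on {\<alpha><..<b}) (potential_term R (rep_L2 u))"
proof -
  let ?M = "lebesgue_on {\<alpha><..<b}" and ?f = "rep_L2 u"
  have fi: "integrable ?M ?f" by (rule integrable_rep) (use assms in auto)
  obtain C where C: "\<And>t f. t \<in> {\<alpha><..<b} \<Longrightarrow> norm (potential_term R f t) \<le> C * norm (f t)"
    using potential_term_bound[OF assms] by blast
  \<comment> \<open>measurability: move the symmetric matrix to the constant vector\<close>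
  have "(\<lambda>t. inner (potential_term R ?f t) e) \<in> borel_measurable ?M" for e
  proof -
    have Re: "(\<lambda>t. (1 / t\<^sup>2) *\<^sub>R (R t *v e)) \<in> borel_measurable ?M"
    proof (rule continuous_imp_measurable_on_sets_lebesgue)
      have "continuous_on {\<alpha><..<b} R" by (rule continuous_on_subset[OF R]) (use assms in auto)
      from continuous_on_matrix_vector_mult[OF this continuous_on_const]
      show "continuous_on {\<alpha><..<b} (\<lambda>t. (1 / t\<^sup>2) *\<^sub>R (R t *v e))"
        using assms by (intro continuous_on_scaleR continuous_intros) auto
    qed simp
    have eq: "inner (potential_term R ?f t) e = inner (?f t) ((1 / t\<^sup>2) *\<^sub>R (R t *v e))"
      if "t \<in> space ?M" for t
      using that assms inner_symmetric_matrix[OF sym[of t], of "?f t" e] by (simp add: potential_term_def)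
    show ?thesis
      by (rule measurable_cong[THEN iffD2, OF _ borel_measurable_inner[OF borel_measurable_integrable[OF fi] Re]])
        (rule eq)
  qed
  then have meas: "potential_term R ?f \<in> borel_measurable ?M"
    by (simp add: borel_measurable_euclidean_space[of "potential_term R ?f"])
  show ?thesis
  proof (rule Bochner_Integration.integrable_bound[OF _ meas])
    show "integrable ?M (\<lambda>t. C * norm (?f t))" using fi by simp
    show "AE t in ?M. norm (potential_term R ?f t) \<le> norm (C * norm (?f t))"
    proof (rule AE_I2)
      fix t assume "t \<in> space ?M"
      then have "norm (potential_term R ?f t) \<le> C * norm (?f t)" using C by simp
      then show "norm (potential_term R ?f t) \<le> norm (C * norm (?f t))" by simp
    qed
  qed
qed

text \<open>Orthogonality to \<open>l (\<psi> e)\<close> for all constant vectors \<open>e\<close>, combined with the symmetry of \<open>R\<close>, is the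
  vector-valued weak equation.\<close>

lemma annihilator_weak_solution:
  assumes u: "u \<in> annihilator R P" and \<alpha>b: "0 < \<alpha>" "\<alpha> < b" "b \<le> 1" "{\<alpha><..<b} \<inter> P = {}"
    and \<psi>: "\<psi> \<in> interval_test \<alpha> b"
  shows "(\<integral>t. vderiv (vderiv \<psi>) t *\<^sub>R rep_L2 u t \<partial>lebesgue_on {\<alpha><..<b})
    = (\<integral>t. \<psi> t *\<^sub>R potential_term R (rep_L2 u) t \<partial>lebesgue_on {\<alpha><..<b})"
proof -
  let ?M = "lebesgue_on {\<alpha><..<b}" and ?f = "rep_L2 u" and ?q = "potential_term R (rep_L2 u)"
  have sm: "smooth \<psi>" by (rule smooth_interval_test[OF \<psi>])
  have zero: "\<psi> t = 0" "vderiv \<psi> t = 0" "vderiv (vderiv \<psi>) t = 0" if "t \<notin> {\<alpha><..<b}" for t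
    by (rule interval_test_outside[OF \<psi> that],
        rule interval_test_outside[OF interval_test_vderiv[OF \<psi>] that],
        rule interval_test_outside[OF interval_test_vderiv[OF interval_test_vderiv[OF \<psi>]] that])
  have i1: "integrable ?M (\<lambda>t. \<psi> t *\<^sub>R ?q t)"
    by (intro integrable_continuous_scaleR integrable_potential_term smooth_continuous_on sm \<alpha>b)
  have i2: "integrable ?M (\<lambda>t. vderiv (vderiv \<psi>) t *\<^sub>R ?f t)"
    by (intro integrable_continuous_scaleR integrable_rep smooth_continuous_on smooth_vderiv sm \<alpha>b)
      (use \<alpha>b in simp)
  define J where "J = (\<integral>t. \<psi> t *\<^sub>R ?q t - vderiv (vderiv \<psi>) t *\<^sub>R ?f t \<partial>?M)"
  have "inner J e = 0" for e
  proof -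
    define \<phi> where "\<phi> t = \<psi> t *\<^sub>R e" for t
    obtain c d where cd: "\<alpha> < c" "c < d" "d < b" "\<And>t. t \<notin> {c<..<d} \<Longrightarrow> \<psi> t = 0"
      using interval_testE[OF \<psi>] by blast
    have sm\<phi>: "smooth \<phi>"
      unfolding \<phi>_def by (rule smooth_bounded_linear[OF bounded_linear_scaleR_left sm])
    have \<phi>: "\<phi> \<in> test_functions"
    proof (rule test_functionI[OF sm\<phi>, of c d])
      fix t assume "\<phi> t \<noteq> 0"
      then have "\<psi> t \<noteq> 0" by (auto simp: \<phi>_def)
      then have "t \<in> {c<..<d}" using cd(4)[of t] by blast
      then show "c \<le> t \<and> t \<le> d" by simp
    qed (use cd \<alpha>b in auto)
    have "\<phi> t = 0" if "t \<in> P" for t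
    proof -
      have "t \<notin> {\<alpha><..<b}" using that \<alpha>b(4) by blast
      then show ?thesis by (simp add: \<phi>_def zero(1))
    qed
    then have "(to_L2 \<phi>, to_L2 (bessel_expression R \<phi>)) \<in> test_graph R P" by (rule test_graphI[OF \<phi>])
    then have "0 = inner u (to_L2 (bessel_expression R \<phi>))" using u by (auto simp: annihilator_def)
    also have "\<dots> = inner (to_L2 ?f) (to_L2 (bessel_expression R \<phi>))" by (simp add: to_L2_rep)
    also have "\<dots> = (\<integral>t. inner (?f t) (bessel_expression R \<phi> t) \<partial>unit_interval)"
      by (rule inner_to_L2[OF square_integrable_rep square_integrable_bessel_expression[OF R \<phi>]])
    also have "\<dots> = (\<integral>t. inner (\<psi> t *\<^sub>R ?q t - vderiv (vderiv \<psi>) t *\<^sub>R ?f t) e \<partial>unit_interval)"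
    proof (intro Bochner_Integration.integral_cong refl)
      fix t assume "t \<in> space unit_interval"
      then have t: "t \<in> {0..1}" by simp
      have "vderiv (vderiv \<phi>) = (\<lambda>t. vderiv (vderiv \<psi>) t *\<^sub>R e)"
        unfolding \<phi>_def[abs_def]
        by (simp add: vderiv_bounded_linear[OF bounded_linear_scaleR_left sm]
            vderiv_bounded_linear[OF bounded_linear_scaleR_left smooth_vderiv[OF sm]])
      then show "inner (?f t) (bessel_expression R \<phi> t)
          = inner (\<psi> t *\<^sub>R ?q t - vderiv (vderiv \<psi>) t *\<^sub>R ?f t) e"
        using inner_symmetric_matrix[OF sym[OF t], of "?f t" e]
        by (simp add: bessel_expression_def potential_term_def \<phi>_def matrix_vector_mult_scaleR
            inner_diff_left inner_diff_right inner_add_right)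
    qed
    also have "\<dots> = (\<integral>t. inner (\<psi> t *\<^sub>R ?q t - vderiv (vderiv \<psi>) t *\<^sub>R ?f t) e \<partial>?M)"
      by (rule integral_lebesgue_on_support) (use \<alpha>b zero in auto)
    also have "\<dots> = inner J e"
      unfolding J_def by (rule integral_inner_left[OF Bochner_Integration.integrable_diff[OF i1 i2]])
    finally show ?thesis by simp
  qed
  then have "J = 0" using inner_eq_zero_iff by blast
  then show ?thesis using i1 i2 by (simp add: J_def)
qed

text \<open>Unique continuation up to the singular endpoint. A member of the annihilator that vanishes on the
  right part of the interval has, on every larger interval away from \<open>a\<close>, a representation whose affine
  part vanishes as well; then \<open>second_primitive_unique\<close> applies again.\<close>

lemma annihilator_unique:
  assumes u: "u \<in> annihilator R P" and ab: "0 \<le> a" "a < m" "m < b" "b \<le> 1" "{a<..<b} \<inter> P = {}"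
    and eq: "AE s in lebesgue_on {m<..<b}.
      rep_L2 u s = second_primitive m b (potential_term R (rep_L2 u)) s"
  shows "AE s in lebesgue_on {a<..<b}. rep_L2 u s = 0"
proof -
  let ?f = "rep_L2 u" and ?q = "potential_term R (rep_L2 u)"
  have vanish: "AE s in lebesgue_on {\<alpha><..<b}. ?f s = 0"
    if \<alpha>: "0 < \<alpha>" "\<alpha> < b" and eq: "AE s in lebesgue_on {\<alpha><..<b}. ?f s = second_primitive \<alpha> b ?q s" for \<alpha>
  proof -
    obtain C where C: "\<And>t f. t \<in> {\<alpha><..<b} \<Longrightarrow> norm (potential_term R f t) \<le> C * norm (f t)"
      using potential_term_bound[OF \<alpha>(1) ab(4)] by blast
    show ?thesis
      by (rule second_primitive_unique[OF integrable_rep integrable_potential_term C eq])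
        (use \<alpha> ab in auto)
  qed
  have right: "AE s in lebesgue_on {m<..<b}. ?f s = 0"
    by (rule vanish[OF _ ab(3) eq]) (use ab in auto)
  have left: "AE s in lebesgue_on {\<alpha><..<b}. ?f s = 0" if \<alpha>: "a < \<alpha>" "\<alpha> < m" for \<alpha>
  proof -
    have "{\<alpha><..<b} \<subseteq> {a<..<b}" using \<alpha> by auto
    then have \<alpha>b: "0 < \<alpha>" "\<alpha> < b" "{\<alpha><..<b} \<inter> P = {}" using \<alpha> ab by auto
    obtain c d where cd: "AE s in lebesgue_on {\<alpha><..<b}. ?f s = c + s *\<^sub>R d + second_primitive \<alpha> b ?q s"
    proof (rule weak_solution_representation[OF \<alpha>b(2)])
      show "integrable (lebesgue_on {\<alpha><..<b}) ?f" by (rule integrable_rep) (use \<alpha>b ab in auto)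
      show "integrable (lebesgue_on {\<alpha><..<b}) ?q" by (rule integrable_potential_term[OF \<alpha>b(1) ab(4)])
    qed (rule annihilator_weak_solution[OF u \<alpha>b(1,2) ab(4) \<alpha>b(3)])
    have sp0: "second_primitive \<alpha> b ?q s = 0" if s: "s \<in> {m<..<b}" for s
    proof -
      have "AE t in lebesgue. t \<in> {m<..<b} \<longrightarrow> ?f t = 0" using right by (simp add: AE_lebesgue_on_iff)
      then have "AE t in lebesgue. t \<in> {\<alpha><..<b} \<longrightarrow> max 0 (t - s) *\<^sub>R ?q t = 0"
        by eventually_elim (use s in \<open>auto simp: potential_term_def max_def\<close>)
      then have "AE t in lebesgue_on {\<alpha><..<b}. max 0 (t - s) *\<^sub>R ?q t = 0"
        by (simp add: AE_lebesgue_on_iff)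
      then show ?thesis unfolding second_primitive_def by (rule integral_eq_zero_AE)
    qed
    have "AE s in lebesgue_on {m<..<b}. c + s *\<^sub>R d = 0"
    proof -
      have "AE s in lebesgue_on {m<..<b}. ?f s = c + s *\<^sub>R d + second_primitive \<alpha> b ?q s"
        by (rule AE_lebesgue_on_subset[OF cd]) (use \<alpha> in auto)
      with right AE_space show ?thesis by eventually_elim (simp add: sp0)
    qed
    then have AE0: "AE s in lebesgue. s \<in> {m<..<b} \<longrightarrow> c + s *\<^sub>R d = 0"
      by (simp add: AE_lebesgue_on_iff)
    \<comment> \<open>an affine function vanishing almost everywhere on an interval has two zeros\<close>
    have ex: "\<exists>s. x < s \<and> s < y \<and> c + s *\<^sub>R d = 0" if xy: "m \<le> x" "x < y" "y \<le> b" for x y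
    proof (rule ccontr)
      assume no: "\<not> ?thesis"
      obtain N where N: "negligible N" "{s. \<not> (s \<in> {m<..<b} \<longrightarrow> c + s *\<^sub>R d = 0)} \<subseteq> N"
        using AE0 unfolding eventually_ae_filter_negligible by blast
      have "{x<..<y} \<subseteq> N" using N(2) no xy by force
      then have "negligible {x<..<y}" using N(1) negligible_subset by blast
      then show False using xy open_not_negligible[of "{x<..<y}"] by auto
    qed
    obtain s1 where s1: "s1 < (m + b) / 2" "c + s1 *\<^sub>R d = 0" using ex[of m "(m + b) / 2"] ab by auto
    obtain s2 where s2: "(m + b) / 2 < s2" "c + s2 *\<^sub>R d = 0" using ex[of "(m + b) / 2" b] ab by auto
    have "(s2 - s1) *\<^sub>R d = (c + s2 *\<^sub>R d) - (c + s1 *\<^sub>R d)" by (simp add: scaleR_left_diff_distrib)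
    then have "d = 0" using s1 s2 by simp
    moreover from this have "c = 0" using s1 by simp
    ultimately have "AE s in lebesgue_on {\<alpha><..<b}. ?f s = second_primitive \<alpha> b ?q s" using cd by simp
    then show ?thesis by (rule vanish[OF \<alpha>b(1,2)])
  qed
  define \<alpha> where "\<alpha> n = a + (m - a) / (real n + 2)" for n :: nat
  have \<alpha>: "a < \<alpha> n" "\<alpha> n < m" for n
  proof -
    have "(m - a) / (real n + 2) < (m - a) / 1"
      using ab(2) by (intro divide_strict_left_mono) auto
    then show "a < \<alpha> n" "\<alpha> n < m" using ab(2) by (simp_all add: \<alpha>_def)
  qed
  have "AE s in lebesgue. \<forall>n. s \<in> {\<alpha> n<..<b} \<longrightarrow> ?f s = 0"
    unfolding AE_all_countable using left[OF \<alpha>] by (simp add: AE_lebesgue_on_iff)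
  then have "AE s in lebesgue. s \<in> {a<..<b} \<longrightarrow> ?f s = 0"
  proof eventually_elim
    case (elim s)
    show ?case
    proof
      assume s: "s \<in> {a<..<b}"
      obtain n :: nat where "(m - a) / (s - a) < real n" using reals_Archimedean2 by blast
      then have "(m - a) / (real n + 2) < s - a" using s ab(2) by (simp add: field_simps)
      then have "\<alpha> n < s" by (simp add: \<alpha>_def)
      then show "?f s = 0" using elim s by auto
    qed
  qed
  then show ?thesis by (simp add: AE_lebesgue_on_iff)
qed

lemma rep_add: "AE t in unit_interval. rep_L2 (u + v) t = rep_L2 u t + rep_L2 v t"
  using rep_to_L2[OF square_integrable_add[OF square_integrable_rep square_integrable_rep], of u v]
  by (simp add: add_to_L2[OF square_integrable_rep square_integrable_rep, symmetric] to_L2_rep)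

lemma rep_scaleR: "AE t in unit_interval. rep_L2 (r *\<^sub>R u) t = r *\<^sub>R rep_L2 u t"
  using rep_to_L2[OF square_integrable_scaleR[OF square_integrable_rep], of r u]
  by (simp add: scaleR_to_L2[OF square_integrable_rep, symmetric] to_L2_rep)

lemma rep_zero: "AE t in unit_interval. rep_L2 0 t = 0"
  using rep_to_L2[OF square_integrable_zero] by (simp add: zero_to_L2)

lemma subspace_annihilator: "subspace (annihilator R P)"
  by (rule subspaceI) (force simp: annihilator_def inner_add_left)+

text \<open>Vanishing almost everywhere on an interval costs finitely many linear conditions within the
  annihilator, namely the \<open>2 n\<close> coefficients of the affine part.\<close>

lemma finite_dim_annihilator_step:
  assumes K: "subspace K" "K \<subseteq> annihilator R P" and ab: "0 \<le> a" "a < b" "b \<le> 1" "{a<..<b} \<inter> P = {}"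
    and B: "finite B" "{u \<in> K. AE s in lebesgue_on {a<..<b}. rep_L2 u s = 0} \<subseteq> span B"
  obtains B' where "finite B'" "K \<subseteq> span B'"
proof -
  define m where "m = (a + b) / 2"
  have m: "a < m" "m < b" "0 < m" "{m<..<b} \<inter> P = {}" using ab by (force simp: m_def)+
  let ?M = "lebesgue_on {m<..<b}"
  have sub: "AE s in ?M. Q s" if "AE s in unit_interval. Q s" for Q
    by (rule AE_lebesgue_on_subset[OF that]) (use m ab in auto)
  define G where "G u = second_primitive m b (potential_term R (rep_L2 u))" for u
  have ker_int: "integrable ?M (\<lambda>t. max 0 (t - s) *\<^sub>R potential_term R (rep_L2 u) t)" for s u
    by (rule integrable_continuous_scaleR[OF _ integrable_potential_term[OF m(3) ab(3)]])
      (intro continuous_intros)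
  have ker_m: "(\<lambda>t. max 0 (t - s) *\<^sub>R potential_term R (rep_L2 u) t) \<in> borel_measurable ?M" for s u
    by (rule borel_measurable_integrable[OF ker_int])
  have G_add: "G (u + v) s = G u s + G v s" for u v s
  proof -
    have "G (u + v) s = (\<integral>t. max 0 (t - s) *\<^sub>R potential_term R (rep_L2 u) t
        + max 0 (t - s) *\<^sub>R potential_term R (rep_L2 v) t \<partial>?M)"
      unfolding G_def second_primitive_def
    proof (rule integral_cong_AE)
      show "AE t in ?M. max 0 (t - s) *\<^sub>R potential_term R (rep_L2 (u + v)) t
          = max 0 (t - s) *\<^sub>R potential_term R (rep_L2 u) t + max 0 (t - s) *\<^sub>R potential_term R (rep_L2 v) t"
        using sub[OF rep_add[of u v]]
        by eventually_elim (simp add: potential_term_def matrix_vector_right_distrib scaleR_add_right)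
    qed (intro ker_m borel_measurable_add)+
    then show ?thesis
      unfolding G_def second_primitive_def by (simp only: Bochner_Integration.integral_add[OF ker_int ker_int])
  qed
  have G_scale: "G (r *\<^sub>R u) s = r *\<^sub>R G u s" for u r s
  proof -
    have "G (r *\<^sub>R u) s = (\<integral>t. r *\<^sub>R (max 0 (t - s) *\<^sub>R potential_term R (rep_L2 u) t) \<partial>?M)"
      unfolding G_def second_primitive_def
    proof (rule integral_cong_AE)
      show "AE t in ?M. max 0 (t - s) *\<^sub>R potential_term R (rep_L2 (r *\<^sub>R u)) t
          = r *\<^sub>R (max 0 (t - s) *\<^sub>R potential_term R (rep_L2 u) t)"
        using sub[OF rep_scaleR[of r u]]
        by eventually_elim (simp add: potential_term_def matrix_vector_mult_scaleR mult_ac)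
    qed (intro ker_m borel_measurable_scaleR borel_measurable_const)+
    then show ?thesis
      unfolding G_def second_primitive_def by (simp only: integral_scaleR_right)
  qed
  define Z where "Z = {(u, c, d). u \<in> K \<and> (AE s in ?M. rep_L2 u s = c + s *\<^sub>R d + G u s)}"
  have "subspace Z"
  proof (rule subspaceI)
    have "AE s in ?M. rep_L2 0 s = 0 + s *\<^sub>R 0 + G 0 s"
      using sub[OF rep_zero] G_scale[of 0 0] by simp
    then show "0 \<in> Z" using subspace_0[OF K(1)] by (simp add: Z_def zero_prod_def)
  next
    fix x y assume "x \<in> Z" "y \<in> Z"
    then obtain u c d u' c' d' where xy: "x = (u, c, d)" "y = (u', c', d')" "u \<in> K" "u' \<in> K"
      "AE s in ?M. rep_L2 u s = c + s *\<^sub>R d + G u s" "AE s in ?M. rep_L2 u' s = c' + s *\<^sub>R d' + G u' s"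
      unfolding Z_def by blast
    have "AE s in ?M. rep_L2 (u + u') s = (c + c') + s *\<^sub>R (d + d') + G (u + u') s"
      using xy(5,6) sub[OF rep_add[of u u']]
      by eventually_elim (simp add: G_add scaleR_add_right)
    then show "x + y \<in> Z" using subspace_add[OF K(1) xy(3,4)] by (simp add: Z_def xy)
  next
    fix r x assume "x \<in> Z"
    then obtain u c d where x: "x = (u, c, d)" "u \<in> K"
      "AE s in ?M. rep_L2 u s = c + s *\<^sub>R d + G u s" unfolding Z_def by blast
    have "AE s in ?M. rep_L2 (r *\<^sub>R u) s = r *\<^sub>R c + s *\<^sub>R (r *\<^sub>R d) + G (r *\<^sub>R u) s"
      using x(3) sub[OF rep_scaleR[of r u]]
      by eventually_elim (simp add: G_scale scaleR_add_right mult.commute)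
    then show "r *\<^sub>R x \<in> Z" using subspace_mul[OF K(1) x(2)] by (simp add: Z_def x)
  qed
  moreover have "{u. (u, 0) \<in> Z} \<subseteq> span B"
  proof (rule subset_trans[OF _ B(2)], rule subsetI)
    fix u assume "u \<in> {u. (u, 0) \<in> Z}"
    then have u: "u \<in> K" "AE s in ?M. rep_L2 u s = G u s" by (auto simp: Z_def zero_prod_def)
    have "AE s in lebesgue_on {a<..<b}. rep_L2 u s = 0"
      by (rule annihilator_unique[OF subsetD[OF K(2) u(1)] ab(1) m(1,2) ab(3,4) u(2)[unfolded G_def]])
    then show "u \<in> {u \<in> K. AE s in lebesgue_on {a<..<b}. rep_L2 u s = 0}" using u(1) by simp
  qed
  moreover have "finite (Basis :: ((real^'n) \<times> (real^'n)) set)" "snd ` Z \<subseteq> span Basis"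
    by (simp_all only: span_Basis finite_Basis subset_UNIV)
  ultimately obtain B' where B': "finite B'" "fst ` Z \<subseteq> span B'"
    by (rule finite_dim_of_linear_relation[OF _ B(1)])
  have "K \<subseteq> fst ` Z"
  proof
    fix u assume u: "u \<in> K"
    obtain c d where "AE s in ?M. rep_L2 u s = c + s *\<^sub>R d + second_primitive m b (potential_term R (rep_L2 u)) s"
    proof (rule weak_solution_representation[OF m(2)])
      show "integrable ?M (rep_L2 u)" by (rule integrable_rep) (use m ab in auto)
      show "integrable ?M (potential_term R (rep_L2 u))" by (rule integrable_potential_term[OF m(3) ab(3)])
    qed (rule annihilator_weak_solution[OF subsetD[OF K(2) u] m(3,2) ab(3) m(4)])
    then have "(u, c, d) \<in> Z" using u by (simp add: Z_def G_def)
    then show "u \<in> fst ` Z" by force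
  qed
  then show thesis using B' that by blast
qed

text \<open>The intervals are treated one at a time: \<open>K j\<close> collects the members of the annihilator that vanish
  on the first \<open>j\<close> intervals. The last of these spaces is zero, and each one is finite-dimensional if its successor is.\<close>

lemma finite_dim_annihilator:
  fixes \<tau> :: "nat \<Rightarrow> real"
  assumes \<tau>: "\<tau> 0 = 0" "\<tau> N = 1" "\<And>i. i < N \<Longrightarrow> \<tau> i < \<tau> (Suc i)"
  obtains B where "finite B" "annihilator R (\<tau> ` {..N}) \<subseteq> span B"
proof -
  let ?P = "\<tau> ` {..N}"
  have mono: "\<tau> i \<le> \<tau> j" if "i \<le> j" "j \<le> N" for i j
    using that
  proof (induction j rule: dec_induct)
    case (step j)
    then show ?case using \<tau>(3)[of j] by simp
  qed simp
  define K where "K j = {u \<in> annihilator R ?P. \<forall>i<j. AE s in lebesgue_on {\<tau> i<..<\<tau> (Suc i)}. rep_L2 u s = 0}" for j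
  have K_sub: "subspace (K j)" if j: "j \<le> N" for j
  proof (rule subspaceI)
    have sub: "AE s in lebesgue_on {\<tau> i<..<\<tau> (Suc i)}. Q s" if "AE s in unit_interval. Q s" "i < j" for Q i
      by (rule AE_lebesgue_on_subset[OF that(1)])
        (use mono[of 0 i] mono[of "Suc i" N] \<tau>(1,2) that(2) j in auto)
    have "AE s in lebesgue_on {\<tau> i<..<\<tau> (Suc i)}. rep_L2 (0 :: (real^'n) L2) s = 0" if "i < j" for i
      by (rule sub[OF rep_zero that])
    then show "0 \<in> K j" using subspace_0[OF subspace_annihilator] by (simp add: K_def)
    fix u assume u: "u \<in> K j"
    { fix v assume v: "v \<in> K j"
      have "AE s in lebesgue_on {\<tau> i<..<\<tau> (Suc i)}. rep_L2 (u + v) s = 0" if "i < j" for i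
      proof -
        have "AE s in lebesgue_on {\<tau> i<..<\<tau> (Suc i)}. rep_L2 u s = 0"
          "AE s in lebesgue_on {\<tau> i<..<\<tau> (Suc i)}. rep_L2 v s = 0"
          using u v that by (auto simp: K_def)
        then show ?thesis using sub[OF rep_add[of u v] that] by eventually_elim simp
      qed
      then show "u + v \<in> K j"
        using u v subspace_add[OF subspace_annihilator] by (simp add: K_def) }
    fix r
    have "AE s in lebesgue_on {\<tau> i<..<\<tau> (Suc i)}. rep_L2 (r *\<^sub>R u) s = 0" if "i < j" for i
    proof -
      have "AE s in lebesgue_on {\<tau> i<..<\<tau> (Suc i)}. rep_L2 u s = 0" using u that by (auto simp: K_def)
      then show ?thesis using sub[OF rep_scaleR[of r u] that] by eventually_elim simp
    qed
    then show "r *\<^sub>R u \<in> K j"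
      using u subspace_mul[OF subspace_annihilator] by (simp add: K_def)
  qed
  have "\<exists>B. finite B \<and> K j \<subseteq> span B" if "j \<le> N" for j
    using that
  proof (induction j rule: inc_induct)
    case base
    have "K N \<subseteq> {0}"
    proof
      fix u assume u: "u \<in> K N"
      have "AE s in lebesgue. \<forall>i. i < N \<longrightarrow> s \<in> {\<tau> i<..<\<tau> (Suc i)} \<longrightarrow> rep_L2 u s = 0"
        unfolding AE_all_countable using u by (auto simp: K_def AE_lebesgue_on_iff)
      moreover have "AE s in lebesgue. s \<notin> ?P"
      proof -
        have "negligible ?P" by (rule negligible_finite) simp
        then show ?thesis unfolding eventually_ae_filter_negligible by (intro exI[of _ ?P]) auto
      qed
      ultimately have "AE s in lebesgue. s \<in> {0<..<1} \<longrightarrow> rep_L2 u s = 0"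
      proof eventually_elim
        case (elim s)
        show ?case
        proof
          assume s: "s \<in> {0<..<1}"
          define i where "i = (LEAST i. s \<le> \<tau> i)"
          have ex: "s \<le> \<tau> N" using s \<tau>(2) by simp
          have si: "s \<le> \<tau> i" unfolding i_def by (rule LeastI[where P = "\<lambda>i. s \<le> \<tau> i", OF ex])
          have iN: "i \<le> N" unfolding i_def by (rule Least_le[where P = "\<lambda>i. s \<le> \<tau> i", OF ex])
          obtain j where j: "i = Suc j" using si s \<tau>(1) by (cases i) auto
          have "\<not> s \<le> \<tau> j" by (rule not_less_Least) (simp add: j flip: i_def)
          moreover have "s \<noteq> \<tau> i" using elim(2) iN by auto
          ultimately show "rep_L2 u s = 0" using elim(1)[rule_format, of j] si iN j by simp
        qed
      qed
      then have "AE s in unit_interval. rep_L2 u s = 0" by (simp add: AE_lebesgue_on_iff)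
      then have "to_L2 (rep_L2 u) = to_L2 (\<lambda>_. 0)"
        by (simp add: to_L2_eq_iff square_integrable_rep square_integrable_zero)
      then show "u \<in> {0}" by (simp add: to_L2_rep zero_to_L2)
    qed
    then show ?case by (intro exI[of _ "{}"]) simp
  next
    case (step j)
    then obtain B where B: "finite B" "K (Suc j) \<subseteq> span B" by blast
    have jN: "j < N" using step by simp
    obtain B' where "finite B'" "K j \<subseteq> span B'"
    proof (rule finite_dim_annihilator_step[OF K_sub _ _ \<tau>(3)[OF jN] _ _ B(1)])
      show "K j \<subseteq> annihilator R ?P" by (auto simp: K_def)
      show "0 \<le> \<tau> j" using mono[of 0 j] jN \<tau>(1) by simp
      show "\<tau> (Suc j) \<le> 1" using mono[of "Suc j" N] jN \<tau>(2) by simp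
      have "\<not> (\<tau> j < \<tau> i \<and> \<tau> i < \<tau> (Suc j))" if "i \<le> N" for i
        using mono[of i j] mono[of "Suc j" i] jN that by (cases "i \<le> j") auto
      then show "{\<tau> j<..<\<tau> (Suc j)} \<inter> ?P = {}" by auto
      show "{u \<in> K j. AE s in lebesgue_on {\<tau> j<..<\<tau> (Suc j)}. rep_L2 u s = 0} \<subseteq> span B"
        by (rule subset_trans[OF _ B(2)]) (auto simp: K_def less_Suc_eq)
    qed (use jN in simp)
    then show ?case by blast
  qed
  from this[of 0] show thesis using that by (auto simp: K_def)
qed

end

section \<open>Oscillating test functions\<close>

text \<open>Profiles in the logarithmic variable \<open>ln t\<close>, slowed down by \<open>\<epsilon>\<close>, translated by \<open>k\<close> and weighted by a
  power of \<open>t\<close>. With the power \<open>1/2\<close> the substitution turns the form of $-d^2/dt^2 + c/t^2$ into that of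
  $-d^2/ds^2 + (c + 1/4)$, and translations become dilations shrinking to the singular endpoint.\<close>

definition log_profile :: "real \<Rightarrow> real \<Rightarrow> real \<Rightarrow> (real \<Rightarrow> real) \<Rightarrow> real \<Rightarrow> real" where
  "log_profile \<epsilon> k a h t = (if t > 0 then t powr a * h (\<epsilon> * ln t + k) else 0)"

lemma log_profile_eq_0:
  assumes h: "h \<in> interval_test 0 1" and "0 < t \<Longrightarrow> \<epsilon> * ln t + k \<notin> {0<..<1}"
  shows "log_profile \<epsilon> k a h t = 0"
  using interval_test_outside[OF h] assms(2) by (auto simp: log_profile_def)

lemma log_profile_deriv:
  assumes \<epsilon>: "\<epsilon> > 0" and h: "h \<in> interval_test 0 1"
  shows "(log_profile \<epsilon> k a h has_vector_derivative
    log_profile \<epsilon> k (a - 1) (\<lambda>s. a * h s + \<epsilon> * vderiv h s) t) (at t)"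
proof (cases "t > 0")
  case True
  have "(h has_real_derivative vderiv h (\<epsilon> * ln t + k)) (at (\<epsilon> * ln t + k))"
    using smooth_has_vector_derivative[OF smooth_interval_test[OF h]]
    by (simp add: has_real_derivative_iff_has_vector_derivative)
  moreover have "((\<lambda>t. \<epsilon> * ln t + k) has_real_derivative \<epsilon> * (1 / t)) (at t)"
    using True by (auto intro!: derivative_eq_intros)
  ultimately have h': "((\<lambda>t. h (\<epsilon> * ln t + k)) has_real_derivative vderiv h (\<epsilon> * ln t + k) * (\<epsilon> * (1 / t))) (at t)"
    by (rule DERIV_chain2)
  have "((\<lambda>t. t powr a) has_real_derivative a * t powr (a - 1)) (at t)"
    using True by (rule has_real_derivative_powr)
  from DERIV_mult[OF this h']
  have "((\<lambda>t. t powr a * h (\<epsilon> * ln t + k)) has_real_derivative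
      log_profile \<epsilon> k (a - 1) (\<lambda>s. a * h s + \<epsilon> * vderiv h s) t) (at t)"
    by (rule DERIV_cong) (use True in \<open>simp add: log_profile_def powr_diff field_simps\<close>)
  then show ?thesis
    unfolding has_real_derivative_iff_has_vector_derivative
    by (rule has_vector_derivative_transform_within_open[of _ _ _ "{0<..}"])
      (use True in \<open>auto simp: log_profile_def\<close>)
next
  case False
  have zero: "log_profile \<epsilon> k a h x = 0" if "x < exp (- k / \<epsilon>)" for x
  proof (rule log_profile_eq_0[OF h])
    assume "0 < x"
    then have "ln x < - k / \<epsilon>" using that by (metis exp_less_cancel_iff exp_ln)
    then have "\<epsilon> * ln x + k < 0" using \<epsilon> by (simp add: field_simps)
    then show "\<epsilon> * ln x + k \<notin> {0<..<1}" by simp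
  qed
  have "t < exp (- k / \<epsilon>)" using False by (intro le_less_trans[OF _ exp_gt_zero]) simp
  then have t: "t \<in> {..<exp (- k / \<epsilon>)}" by simp
  have "((\<lambda>_. 0) has_vector_derivative 0) (at t)" by simp
  then have "(log_profile \<epsilon> k a h has_vector_derivative 0) (at t)"
    by (rule has_vector_derivative_transform_within_open[OF _ open_lessThan t]) (simp add: zero)
  then show ?thesis using False by (simp add: log_profile_def)
qed

lemma interval_test_profile_deriv:
  assumes "h \<in> interval_test 0 1"
  shows "(\<lambda>s. a * h s + \<epsilon> * vderiv h s) \<in> interval_test 0 1"
proof -
  have "(\<lambda>s. h s + (a - 1) * h s) \<in> interval_test 0 1"
    by (rule interval_test_add_scale[OF assms assms])
  from interval_test_add_scale[OF this interval_test_vderiv[OF assms], of \<epsilon>]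
  show ?thesis by (simp add: algebra_simps)
qed

lemma smooth_log_profile:
  assumes \<epsilon>: "\<epsilon> > 0" and h: "h \<in> interval_test 0 1"
  shows "smooth (log_profile \<epsilon> k a h)"
proof (rule smooth_coinduct[of _ "(\<lambda>(a, h). log_profile \<epsilon> k a h) ` (UNIV \<times> interval_test 0 1)"])
  show "log_profile \<epsilon> k a h \<in> (\<lambda>(a, h). log_profile \<epsilon> k a h) ` (UNIV \<times> interval_test 0 1)"
    by (rule image_eqI[of _ _ "(a, h)"]) (use h in auto)
next
  fix g assume "g \<in> (\<lambda>(a, h). log_profile \<epsilon> k a h) ` (UNIV \<times> interval_test 0 1)"
  then obtain a h where g: "g = log_profile \<epsilon> k a h" "h \<in> interval_test 0 1" by auto
  show "\<exists>g'\<in>(\<lambda>(a, h). log_profile \<epsilon> k a h) ` (UNIV \<times> interval_test 0 1). \<forall>t. (g has_vector_derivative g' t) (at t)"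
  proof (rule bexI)
    show "\<forall>t. (g has_vector_derivative log_profile \<epsilon> k (a - 1) (\<lambda>s. a * h s + \<epsilon> * vderiv h s) t) (at t)"
      unfolding g(1) using log_profile_deriv[OF \<epsilon> g(2)] by blast
    show "log_profile \<epsilon> k (a - 1) (\<lambda>s. a * h s + \<epsilon> * vderiv h s)
        \<in> (\<lambda>(a, h). log_profile \<epsilon> k a h) ` (UNIV \<times> interval_test 0 1)"
      by (rule image_eqI[of _ _ "(a - 1, \<lambda>s. a * h s + \<epsilon> * vderiv h s)"])
        (use interval_test_profile_deriv[OF g(2)] in auto)
  qed
qed

lemma vderiv_log_profile:
  "\<epsilon> > 0 \<Longrightarrow> h \<in> interval_test 0 1 \<Longrightarrow>
    vderiv (log_profile \<epsilon> k a h) = log_profile \<epsilon> k (a - 1) (\<lambda>s. a * h s + \<epsilon> * vderiv h s)"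
  by (rule vderiv_eq) (rule log_profile_deriv)

text \<open>The weight \<open>sqrt t\<close> is chosen so that the terms with the first derivative of \<open>h\<close> cancel.\<close>

lemma vderiv2_log_profile:
  assumes \<epsilon>: "\<epsilon> > 0" and h: "h \<in> interval_test 0 1"
  shows "vderiv (vderiv (log_profile \<epsilon> k (1 / 2) h))
    = log_profile \<epsilon> k (- 3 / 2) (\<lambda>s. \<epsilon>\<^sup>2 * vderiv (vderiv h) s - h s / 4)"
proof -
  have sm: "smooth h" "smooth (vderiv h)" using smooth_interval_test[OF h] smooth_vderiv by blast+
  have "vderiv (\<lambda>s. 1 / 2 * h s + \<epsilon> * vderiv h s) = (\<lambda>s. 1 / 2 * vderiv h s + \<epsilon> * vderiv (vderiv h) s)"
    using vderiv_add_scale[OF smooth_bounded_linear[OF bounded_linear_mult_right sm(1)] sm(2), of "1 / 2" \<epsilon>]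
      vderiv_bounded_linear[OF bounded_linear_mult_right sm(1), of "1 / 2"] by simp
  then show ?thesis
    using vderiv_log_profile[OF \<epsilon> interval_test_profile_deriv[OF h, of "1/2" \<epsilon>], of k "1/2 - 1"]
    unfolding vderiv_log_profile[OF \<epsilon> h] by (simp add: algebra_simps power2_eq_square)
qed

lemma bessel_log_profile:
  fixes e :: "real^'n"
  assumes \<epsilon>: "\<epsilon> > 0" and h: "h \<in> interval_test 0 1"
  shows "bessel_expression R (\<lambda>t. log_profile \<epsilon> k (1 / 2) h t *\<^sub>R e) t
    = - (log_profile \<epsilon> k (- 3 / 2) (\<lambda>s. \<epsilon>\<^sup>2 * vderiv (vderiv h) s - h s / 4) t *\<^sub>R e)
      + (log_profile \<epsilon> k (1 / 2) h t / t\<^sup>2) *\<^sub>R (R t *v e)"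
proof -
  have sm: "smooth (log_profile \<epsilon> k (1 / 2) h)" by (rule smooth_log_profile[OF \<epsilon> h])
  have "vderiv (vderiv (\<lambda>t. log_profile \<epsilon> k (1 / 2) h t *\<^sub>R e))
      = (\<lambda>t. vderiv (vderiv (log_profile \<epsilon> k (1 / 2) h)) t *\<^sub>R e)"
    by (simp only: vderiv_bounded_linear[OF bounded_linear_scaleR_left sm]
        vderiv_bounded_linear[OF bounded_linear_scaleR_left smooth_vderiv[OF sm]])
  then show ?thesis
    by (simp add: bessel_expression_def vderiv2_log_profile[OF \<epsilon> h] matrix_vector_mult_scaleR)
qed

lemma test_function_log_profile:
  fixes e :: "'a::euclidean_space"
  assumes \<epsilon>: "\<epsilon> > 0" and h: "h \<in> interval_test 0 1" and k: "k > 1"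
  shows "(\<lambda>t. log_profile \<epsilon> k a h t *\<^sub>R e) \<in> test_functions"
proof (rule test_functionI)
  show "smooth (\<lambda>t. log_profile \<epsilon> k a h t *\<^sub>R e)"
    by (rule smooth_bounded_linear[OF bounded_linear_scaleR_left smooth_log_profile[OF \<epsilon> h]])
  show "0 < exp (- k / \<epsilon>)" "exp ((1 - k) / \<epsilon>) < 1" using \<epsilon> k by (simp_all add: divide_neg_pos)
  fix t assume ne: "log_profile \<epsilon> k a h t *\<^sub>R e \<noteq> 0"
  then have t: "t > 0" by (auto simp: log_profile_def split: if_splits)
  then have "\<epsilon> * ln t + k \<in> {0<..<1}" using log_profile_eq_0[OF h] ne by fastforce
  then have "- k / \<epsilon> \<le> ln t" "ln t \<le> (1 - k) / \<epsilon>" using \<epsilon> by (simp_all add: field_simps)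
  then show "exp (- k / \<epsilon>) \<le> t \<and> t \<le> exp ((1 - k) / \<epsilon>)"
    using t by (metis exp_le_cancel_iff exp_ln)
qed

text \<open>Profiles whose translations differ by at least one have disjoint supports.\<close>

lemma log_profile_orthogonal:
  fixes R :: "real \<Rightarrow> real^'n^'n"
  assumes R: "continuous_on {0..1} R" and \<epsilon>: "\<epsilon> > 0" and h: "h \<in> interval_test 0 1"
    and jk: "j > 1" "k > 1" "\<bar>j - k\<bar> \<ge> 1"
  shows "inner (to_L2 (bessel_expression R (\<lambda>t. log_profile \<epsilon> j (1 / 2) h t *\<^sub>R e)))
    (to_L2 (\<lambda>t. log_profile \<epsilon> k (1 / 2) h t *\<^sub>R e)) = 0"
proof -
  note tj = test_function_log_profile[OF \<epsilon> h jk(1), of "1/2" e]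
    and tk = test_function_log_profile[OF \<epsilon> h jk(2), of "1/2" e]
  have "(\<lambda>s. \<epsilon>\<^sup>2 * vderiv (vderiv h) s + (- 1 / 4) * h s) \<in> interval_test 0 1"
    using interval_test_add_scale[OF interval_test_add_scale[OF interval_test_vderiv[OF interval_test_vderiv[OF h]]
        interval_test_vderiv[OF interval_test_vderiv[OF h]], of "\<epsilon>\<^sup>2 - 1"] h, of "- 1 / 4"]
    by (simp add: algebra_simps)
  then have h2: "(\<lambda>s. \<epsilon>\<^sup>2 * vderiv (vderiv h) s - h s / 4) \<in> interval_test 0 1" by simp
  have "inner (bessel_expression R (\<lambda>t. log_profile \<epsilon> j (1 / 2) h t *\<^sub>R e) t)
      (log_profile \<epsilon> k (1 / 2) h t *\<^sub>R e) = 0" for t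
  proof (cases "\<epsilon> * ln t + k \<in> {0<..<1}")
    case True
    then have "\<epsilon> * ln t + j \<notin> {0<..<1}" using jk(3) by auto
    then show ?thesis
      by (simp add: bessel_log_profile[OF \<epsilon> h] log_profile_eq_0[OF h] log_profile_eq_0[OF h2])
  next
    case False
    then show ?thesis by (simp add: log_profile_eq_0[OF h])
  qed
  then show ?thesis
    unfolding inner_to_L2[OF square_integrable_bessel_expression[OF R tj] square_integrable_test_function[OF tk]]
    by (simp only: Bochner_Integration.integral_zero)
qed

text \<open>Where \<open>R\<close> is at most \<open>c\<close> in the direction \<open>e\<close>, the substitution \<open>s = \<epsilon> ln t + k\<close> bounds the form from
  above by \<open>1 / \<epsilon>\<close> times the integral of \<open>- \<epsilon>\<^sup>2 h'' h + (c + 1/4) h\<^sup>2\<close>.\<close>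

lemma log_profile_negative:
  fixes R :: "real \<Rightarrow> real^'n^'n"
  assumes R: "continuous_on {0..1} R" and \<epsilon>: "\<epsilon> > 0" and h: "h \<in> interval_test 0 1" and k: "k > 1"
    and e: "norm e = 1"
    and upper: "\<And>t. 0 < t \<Longrightarrow> t \<le> exp ((1 - k) / \<epsilon>) \<Longrightarrow> inner (R t *v e) e \<le> c"
    and neg: "integral {0..1} (\<lambda>s. - (\<epsilon>\<^sup>2 * vderiv (vderiv h) s * h s) + (c + 1 / 4) * (h s)\<^sup>2) < 0"
  shows "inner (to_L2 (bessel_expression R (\<lambda>t. log_profile \<epsilon> k (1 / 2) h t *\<^sub>R e)))
    (to_L2 (\<lambda>t. log_profile \<epsilon> k (1 / 2) h t *\<^sub>R e)) < 0"
proof -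
  define \<phi> where "\<phi> t = log_profile \<epsilon> k (1 / 2) h t *\<^sub>R e" for t
  define g where "g s = - (\<epsilon>\<^sup>2 * vderiv (vderiv h) s * h s) + (c + 1 / 4) * (h s)\<^sup>2" for s
  have \<phi>: "\<phi> \<in> test_functions"
    unfolding \<phi>_def by (rule test_function_log_profile[OF \<epsilon> h k])
  define a where "a = exp (- k / \<epsilon>)"
  define b where "b = exp ((1 - k) / \<epsilon>)"
  have ab: "0 < a" "a < b" "b < 1"
    using \<epsilon> k divide_strict_right_mono[of "- k" "1 - k" \<epsilon>] by (simp_all add: a_def b_def divide_neg_pos)
  have lnab: "\<epsilon> * ln a + k = 0" "\<epsilon> * ln b + k = 1" using \<epsilon> by (simp_all add: a_def b_def)
  have e2: "inner e e = 1" using e by (simp flip: power2_norm_eq_inner)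
  have out: "\<phi> t = 0" if "t \<notin> {a<..<b}" for t
  proof -
    have "\<epsilon> * ln t + k \<notin> {0<..<1}" if t: "t > 0"
    proof
      assume "\<epsilon> * ln t + k \<in> {0<..<1}"
      then have "- k / \<epsilon> < ln t" "ln t < (1 - k) / \<epsilon>" using \<epsilon> by (simp_all add: field_simps)
      then have "a < t" "t < b" using t unfolding a_def b_def by (metis exp_less_cancel_iff exp_ln)+
      then show False using \<open>t \<notin> {a<..<b}\<close> by simp
    qed
    then show ?thesis by (simp add: \<phi>_def log_profile_eq_0[OF h])
  qed
  have cont: "continuous_on {a..b} (\<lambda>t. inner (bessel_expression R \<phi> t) (\<phi> t))"
    by (intro continuous_on_inner continuous_on_bessel_expression[OF R test_function_smooth[OF \<phi>]]
        smooth_continuous_on test_function_smooth \<phi>) (use ab in auto)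
  have "inner (to_L2 (bessel_expression R \<phi>)) (to_L2 \<phi>)
      = (\<integral>t. inner (bessel_expression R \<phi> t) (\<phi> t) \<partial>unit_interval)"
    by (rule inner_to_L2[OF square_integrable_bessel_expression[OF R \<phi>] square_integrable_test_function[OF \<phi>]])
  also have "\<dots> = (\<integral>t. inner (bessel_expression R \<phi> t) (\<phi> t) \<partial>lebesgue_on {a<..<b})"
    by (rule integral_lebesgue_on_support) (use out ab in auto)
  also have "\<dots> = integral {a..b} (\<lambda>t. inner (bessel_expression R \<phi> t) (\<phi> t))"
    by (rule integral_continuous_open[OF cont])
  also have "\<dots> \<le> integral {0..1} g / \<epsilon>"
  proof (rule has_integral_le[OF integrable_integral[OF integrable_continuous_real[OF cont]]])
    have contg: "continuous_on {0..1} g"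
      unfolding g_def
      by (intro continuous_intros smooth_continuous_on smooth_vderiv smooth_interval_test[OF h])
    have "((\<lambda>t. (\<epsilon> * (1 / t)) *\<^sub>R g (\<epsilon> * ln t + k)) has_integral
        integral {\<epsilon> * ln a + k..\<epsilon> * ln b + k} g) {a..b}"
    proof (rule has_integral_substitution[OF _ _ _ contg])
      show "(\<lambda>t. \<epsilon> * ln t + k) ` {a..b} \<subseteq> {0..1}"
      proof safe
        fix t assume "t \<in> {a..b}"
        then have "ln a \<le> ln t" "ln t \<le> ln b" using ab by auto
        then have "\<epsilon> * ln a + k \<le> \<epsilon> * ln t + k" "\<epsilon> * ln t + k \<le> \<epsilon> * ln b + k" using \<epsilon> by auto
        then show "\<epsilon> * ln t + k \<in> {0..1}" using lnab by simp
      qed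
      show "((\<lambda>t. \<epsilon> * ln t + k) has_real_derivative \<epsilon> * (1 / t)) (at t within {a..b})"
        if "t \<in> {a..b}" for t
        using that ab by (auto intro!: derivative_eq_intros)
    qed (use ab lnab in auto)
    from has_integral_mult_right[OF this, of "1 / \<epsilon>"]
    show "((\<lambda>t. g (\<epsilon> * ln t + k) / t) has_integral integral {0..1} g / \<epsilon>) {a..b}"
      using \<epsilon> unfolding lnab by simp
  next
    fix t assume t: "t \<in> {a..b}"
    then have t0: "t > 0" using ab by simp
    define s where "s = \<epsilon> * ln t + k"
    have "t powr (- 3 / 2) * t powr (1 / 2) = t powr (- 3 / 2 + 1 / 2)"
      by (simp only: powr_add)
    also have "\<dots> = 1 / t" using t0 by (simp add: powr_minus_divide)
    finally have pw: "t powr (- 3 / 2) * t powr (1 / 2) = 1 / t" "(t powr (1 / 2))\<^sup>2 = t"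
      using t0 by (simp_all add: powr_half_sqrt)
    have "inner (bessel_expression R \<phi> t) (\<phi> t)
        = - (t powr (- 3 / 2) * t powr (1 / 2)) * (\<epsilon>\<^sup>2 * vderiv (vderiv h) s - h s / 4) * h s
          + inner (R t *v e) e * ((t powr (1 / 2))\<^sup>2 * (h s)\<^sup>2 / t\<^sup>2)"
      unfolding \<phi>_def[abs_def] bessel_log_profile[OF \<epsilon> h] using t0
      by (simp add: log_profile_def s_def inner_add_left inner_diff_left e2 power2_eq_square algebra_simps)
    also have "\<dots> \<le> - (t powr (- 3 / 2) * t powr (1 / 2)) * (\<epsilon>\<^sup>2 * vderiv (vderiv h) s - h s / 4) * h s
          + c * ((t powr (1 / 2))\<^sup>2 * (h s)\<^sup>2 / t\<^sup>2)"
      using upper[OF t0] t by (intro add_left_mono mult_right_mono) (auto simp: b_def)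
    also have "\<dots> = g s / t"
      unfolding pw using t0 by (simp add: g_def field_simps power2_eq_square)
    finally show "inner (bessel_expression R \<phi> t) (\<phi> t) \<le> g (\<epsilon> * ln t + k) / t" by (simp add: s_def)
  qed
  also have "\<dots> < 0" using neg \<epsilon> by (simp add: g_def[abs_def] divide_neg_pos)
  finally show ?thesis by (simp add: \<phi>_def[abs_def])
qed

text \<open>Any nonzero profile will do, once it varies slowly enough: as \<open>\<epsilon>\<close> decreases, the derivative term becomes
  negligible against the negative potential term.\<close>

lemma small_frequency:
  assumes c: "c < - 1 / 4"
  obtains \<epsilon> h where "\<epsilon> > 0" "h \<in> interval_test 0 1"
    "integral {0..1} (\<lambda>s. - (\<epsilon>\<^sup>2 * vderiv (vderiv h) s * h s) + (c + 1 / 4) * (h s)\<^sup>2) < 0"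
proof -
  define h where "h = bump 1 (1 / 4) (3 / 4)"
  have h: "h \<in> interval_test 0 1" unfolding h_def by (rule interval_test_bump) auto
  note cont = smooth_continuous_on[OF smooth_interval_test[OF h]]
    smooth_continuous_on[OF smooth_vderiv[OF smooth_vderiv[OF smooth_interval_test[OF h]]]]
  define I where "I = integral {0..1} (\<lambda>s. vderiv (vderiv h) s * h s)"
  define J where "J = integral {0..1} (\<lambda>s. (h s)\<^sup>2)"
  have contJ: "continuous_on {0..1} (\<lambda>s. (h s)\<^sup>2)" by (intro continuous_on_power cont)
  have "J \<noteq> 0"
  proof
    assume "J = 0"
    then have "(h (1 / 2))\<^sup>2 = 0"
      using integral_eq_0_iff[OF contJ] by (auto simp: J_def)
    moreover have "h (1 / 2) > 0" unfolding h_def by (rule bump_pos) auto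
    ultimately show False by simp
  qed
  moreover have "J \<ge> 0" unfolding J_def by (rule Henstock_Kurzweil_Integration.integral_nonneg)
      (auto intro: integrable_continuous_real contJ)
  ultimately have J: "J > 0" by simp
  define \<delta> where "\<delta> = - (c + 1 / 4)"
  have \<delta>: "\<delta> > 0" using c by (simp add: \<delta>_def)
  define \<epsilon> where "\<epsilon> = sqrt (\<delta> * J / (\<bar>I\<bar> + 1))"
  have \<epsilon>: "\<epsilon> > 0" "\<epsilon>\<^sup>2 = \<delta> * J / (\<bar>I\<bar> + 1)" using \<delta> J by (simp_all add: \<epsilon>_def)
  have "integral {0..1} (\<lambda>s. - \<epsilon>\<^sup>2 * (vderiv (vderiv h) s * h s) + (c + 1 / 4) * (h s)\<^sup>2)
      = - \<epsilon>\<^sup>2 * I + (c + 1 / 4) * J"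
    unfolding I_def J_def
    by (subst Henstock_Kurzweil_Integration.integral_add)
      (auto intro!: integrable_continuous_real continuous_on_minus continuous_on_mult
        continuous_on_const contJ cont)
  also have "\<dots> \<le> \<epsilon>\<^sup>2 * \<bar>I\<bar> - \<delta> * J"
  proof -
    have "\<epsilon>\<^sup>2 * (- I) \<le> \<epsilon>\<^sup>2 * \<bar>I\<bar>" by (intro mult_left_mono) auto
    then show ?thesis by (simp add: \<delta>_def algebra_simps)
  qed
  also have "\<dots> < 0"
  proof -
    have "\<bar>I\<bar> / (\<bar>I\<bar> + 1) < 1" by simp
    then have "(\<delta> * J) * (\<bar>I\<bar> / (\<bar>I\<bar> + 1)) < (\<delta> * J) * 1"
      using \<delta> J by (intro mult_strict_left_mono) auto
    then show ?thesis by (simp add: \<epsilon>(2))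
  qed
  finally show thesis using that[OF \<epsilon>(1) h] by (simp add: mult.assoc)
qed

section \<open>Proof of the dichotomy\<close>

text \<open>The first interval lies where the eigenvalue bound for \<open>R\<close> holds; the remaining ones
  have equal length \<open>h\<close>, chosen so small that the Poincare constant \<open>1 / h\<^sup>2\<close> exceeds the bound \<open>M / \<eta>\<^sup>2\<close> of the potential.\<close>

lemma finite_morse_index_above_Hardy:
  fixes R :: "real \<Rightarrow> real^'n^'n"
  assumes R: "continuous_on {0..1} R" and sym: "\<And>t. t \<in> {0..1} \<Longrightarrow> transpose (R t) = R t"
    and lim: "ereal (- 1 / 4) < Liminf (at_right 0) (\<lambda>t. ereal (smallest_eigenvalue (R t)))"
    and A: "self_adjoint_extension (minimal_operator R) A" and E: "spectral_measure_of A E"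
  shows "morse_index E < \<infinity>"
proof -
  have sa: "self_adjoint A" "minimal_operator R \<subseteq> A"
    using A by (simp_all add: self_adjoint_extension_def)
  obtain r where r: "- 1 / 4 < r" "ereal r < Liminf (at_right 0) (\<lambda>t. ereal (smallest_eigenvalue (R t)))"
    using ereal_dense2[OF lim] by auto
  have "\<forall>\<^sub>F t in at_right 0. r < smallest_eigenvalue (R t)"
    using less_LiminfD[OF r(2)] by simp
  then obtain b where b: "b > 0" "\<And>t. 0 < t \<Longrightarrow> t < b \<Longrightarrow> r < smallest_eigenvalue (R t)"
    unfolding eventually_at_right_field by auto
  define \<eta> where "\<eta> = min (b / 2) (1 / 2)"
  have \<eta>: "0 < \<eta>" "\<eta> < b" "\<eta> < 1" using b(1) by (auto simp: \<eta>_def)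
  have near: "r * (norm v)\<^sup>2 \<le> inner (R t *v v) v" if t: "0 < t" "t \<le> \<eta>" for t v
  proof -
    have "r * (norm v)\<^sup>2 \<le> smallest_eigenvalue (R t) * (norm v)\<^sup>2"
      using b(2)[of t] t \<eta> by (intro mult_right_mono) auto
    also have "\<dots> \<le> inner (R t *v v) v" by (rule smallest_eigenvalue_le[OF sym]) (use t \<eta> in auto)
    finally show ?thesis .
  qed
  obtain M where M: "M \<ge> 0" "\<And>t v. t \<in> {0..1} \<Longrightarrow> norm (R t *v v) \<le> M * norm v"
    using matrix_norm_bound[OF R] by blast
  define \<delta> where "\<delta> = r + 1 / 4"
  have \<delta>: "\<delta> > 0" using r(1) by (simp add: \<delta>_def)
  obtain n0 :: nat where n0: "\<delta> + M / \<eta>\<^sup>2 \<le> real n0" using real_arch_simple by blast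
  define n where "n = Suc n0"
  define h where "h = (1 - \<eta>) / real n"
  have h: "h > 0" using \<eta> by (simp add: h_def n_def)
  have large: "\<delta> + M / \<eta>\<^sup>2 \<le> 1 / h\<^sup>2"
  proof -
    have "\<delta> + M / \<eta>\<^sup>2 \<le> real n" using n0 by (simp add: n_def)
    also have "\<dots> \<le> (real n)\<^sup>2" by (rule self_le_power) (simp_all add: n_def)
    also have "real n \<le> 1 / h" using \<eta> by (simp add: h_def n_def field_simps)
    then have "(real n)\<^sup>2 \<le> (1 / h)\<^sup>2" by (intro power_mono) auto
    finally show ?thesis by (simp add: power_divide)
  qed
  define \<tau> where "\<tau> i = (if i = 0 then 0 else \<eta> + real (i - 1) * h)" for i :: nat
  define N where "N = Suc n"
  have \<tau>: "\<tau> 0 = 0" "\<tau> N = 1" "\<And>i. i < N \<Longrightarrow> \<tau> i < \<tau> (Suc i)"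
  proof -
    show "\<tau> N = 1" by (simp add: \<tau>_def N_def h_def n_def)
    show "\<tau> i < \<tau> (Suc i)" if "i < N" for i
      using \<eta> h by (cases i) (auto simp: \<tau>_def algebra_simps)
  qed (simp add: \<tau>_def)
  have Riccati: "\<exists>w w'. \<forall>t. \<tau> i \<le> t \<longrightarrow> t \<le> \<tau> (Suc i) \<longrightarrow> 0 < t \<longrightarrow>
      (w has_real_derivative w' t) (at t) \<and>
      (\<forall>v. (\<delta> + w' t + (w t)\<^sup>2) * (norm v)\<^sup>2 \<le> inner (R t *v v) v / t\<^sup>2)" if i: "i < N" for i
  proof (cases i)
    case 0
    \<comment> \<open>Hardy's weight\<close>
    have "((\<lambda>t. 1 / (2 * t)) has_real_derivative - 1 / (2 * t\<^sup>2)) (at t) \<and>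
        (\<forall>v. (\<delta> + - 1 / (2 * t\<^sup>2) + (1 / (2 * t))\<^sup>2) * (norm v)\<^sup>2 \<le> inner (R t *v v) v / t\<^sup>2)"
      if "t \<le> \<tau> (Suc i)" and t0: "0 < t" for t
    proof (intro conjI allI)
      from that(1) have t: "t \<le> \<eta>" using 0 by (simp add: \<tau>_def)
      show "((\<lambda>t. 1 / (2 * t)) has_real_derivative - 1 / (2 * t\<^sup>2)) (at t)"
        using t0 by (auto intro!: derivative_eq_intros simp: field_simps power2_eq_square)
      fix v :: "real^'n"
      have "t\<^sup>2 \<le> 1" using t0 t \<eta> by (simp add: power_le_one)
      then have "\<delta> * t\<^sup>2 \<le> \<delta>" using \<delta> by simp
      then have "\<delta> \<le> \<delta> / t\<^sup>2" using t0 by (simp add: pos_le_divide_eq)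
      moreover have "- 1 / (2 * t\<^sup>2) + (1 / (2 * t))\<^sup>2 = - ((1 / 4) / t\<^sup>2)"
        using t0 by (simp add: field_simps power2_eq_square)
      moreover have "\<delta> / t\<^sup>2 = r / t\<^sup>2 + (1 / 4) / t\<^sup>2"
        by (simp add: \<delta>_def add_divide_distrib)
      ultimately have "\<delta> + - 1 / (2 * t\<^sup>2) + (1 / (2 * t))\<^sup>2 \<le> r / t\<^sup>2" by linarith
      then have "(\<delta> + - 1 / (2 * t\<^sup>2) + (1 / (2 * t))\<^sup>2) * (norm v)\<^sup>2 \<le> r / t\<^sup>2 * (norm v)\<^sup>2"
        by (rule mult_right_mono) simp
      also have "\<dots> = r * (norm v)\<^sup>2 / t\<^sup>2" by simp
      also have "\<dots> \<le> inner (R t *v v) v / t\<^sup>2" by (intro divide_right_mono near t0 t) simp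
      finally show "(\<delta> + - 1 / (2 * t\<^sup>2) + (1 / (2 * t))\<^sup>2) * (norm v)\<^sup>2 \<le> inner (R t *v v) v / t\<^sup>2" .
    qed
    note Hardy = this
    show ?thesis
      by (intro Hardy exI[of _ "\<lambda>t. 1 / (2 * t)"] exI[of _ "\<lambda>t. - 1 / (2 * t\<^sup>2)"] allI impI)
  next
    case (Suc j)
    \<comment> \<open>an affine weight, odd about the midpoint of the short interval\<close>
    define m where "m = (\<tau> i + \<tau> (Suc i)) / 2"
    define k where "k = 2 / h\<^sup>2"
    have \<tau>i: "\<tau> i = \<eta> + real j * h" "\<tau> (Suc i) = \<tau> i + h"
      using Suc by (simp_all add: \<tau>_def algebra_simps)
    have jn: "real j + 1 \<le> real n" using i Suc by (simp add: N_def)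
    have "((\<lambda>t. - k * (t - m)) has_real_derivative - k) (at t) \<and>
        (\<forall>v. (\<delta> + - k + (- k * (t - m))\<^sup>2) * (norm v)\<^sup>2 \<le> inner (R t *v v) v / t\<^sup>2)"
      if t: "\<tau> i \<le> t" "t \<le> \<tau> (Suc i)" and t0: "0 < t" for t
    proof (intro conjI allI)
      show "((\<lambda>t. - k * (t - m)) has_real_derivative - k) (at t)"
        by (auto intro!: derivative_eq_intros)
      fix v :: "real^'n"
      have "real j * h \<ge> 0" using h by simp
      then have t\<eta>: "\<eta> \<le> t" using t(1) \<tau>i(1) by linarith
      have "(real j + 1) * h \<le> real n * h" using jn h by (intro mult_right_mono) auto
      also have "\<dots> = 1 - \<eta>" by (simp add: h_def n_def)
      finally have t1: "t \<le> 1" using t(2) \<tau>i by (simp add: algebra_simps)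
      have "\<bar>t - m\<bar> \<le> h / 2" using t \<tau>i(2) by (simp add: m_def abs_le_iff field_simps)
      then have "(t - m)\<^sup>2 \<le> (h / 2)\<^sup>2" using power_mono[of "\<bar>t - m\<bar>" "h / 2" 2] by simp
      then have "k\<^sup>2 * (t - m)\<^sup>2 \<le> k\<^sup>2 * (h / 2)\<^sup>2" by (rule mult_left_mono) simp
      also have "\<dots> = 1 / h\<^sup>2" using h by (simp add: k_def power2_eq_square field_simps)
      finally have "(- k * (t - m))\<^sup>2 \<le> 1 / h\<^sup>2" by (simp add: power_mult_distrib)
      moreover have "k = 1 / h\<^sup>2 + 1 / h\<^sup>2" by (simp add: k_def)
      ultimately have "\<delta> + - k + (- k * (t - m))\<^sup>2 \<le> - (M / \<eta>\<^sup>2)"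
        using large by linarith
      then have "(\<delta> + - k + (- k * (t - m))\<^sup>2) * (norm v)\<^sup>2 \<le> - (M / \<eta>\<^sup>2) * (norm v)\<^sup>2"
        by (rule mult_right_mono) simp
      also have "\<dots> = - (M * (norm v)\<^sup>2 / \<eta>\<^sup>2)" by simp
      also have "\<dots> \<le> - (M * (norm v)\<^sup>2 / t\<^sup>2)"
        using M(1) \<eta> t\<eta> by (intro le_imp_neg_le divide_left_mono power_mono mult_nonneg_nonneg mult_pos_pos) auto
      also have "\<dots> \<le> inner (R t *v v) v / t\<^sup>2"
      proof -
        have "\<bar>inner (R t *v v) v\<bar> \<le> norm (R t *v v) * norm v" by (rule Cauchy_Schwarz_ineq2)
        also have "\<dots> \<le> (M * norm v) * norm v" using M(2)[of t v] t0 t1 by (intro mult_right_mono) auto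
        finally have "- (M * (norm v)\<^sup>2) \<le> inner (R t *v v) v" by (simp add: power2_eq_square)
        then have "- (M * (norm v)\<^sup>2) / t\<^sup>2 \<le> inner (R t *v v) v / t\<^sup>2" by (rule divide_right_mono) simp
        then show ?thesis by simp
      qed
      finally show "(\<delta> + - k + (- k * (t - m))\<^sup>2) * (norm v)\<^sup>2 \<le> inner (R t *v v) v / t\<^sup>2" .
    qed
    note Poincare = this
    show ?thesis
      by (intro Poincare exI[of _ "\<lambda>t. - k * (t - m)"] exI[of _ "\<lambda>t. - k"] allI impI)
  qed
  let ?P = "\<tau> ` {..N}"
  obtain B where B: "finite B" "annihilator R ?P \<subseteq> span B"
    using finite_dim_annihilator[OF R sym \<tau>] by blast
  show ?thesis
  proof (rule finite_morse_index[OF sa(1) E subspace_test_graph[OF R] _ \<delta> _ B(1)])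
    show "test_graph R ?P \<subseteq> A" using test_graph_subset_minimal_operator sa(2) by (rule subset_trans)
    show "{k. \<forall>(u, w)\<in>test_graph R ?P. inner k w = 0} \<subseteq> span B"
      using B(2) by (simp add: annihilator_def)
    fix u w assume "(u, w) \<in> test_graph R ?P"
    then obtain \<phi> where \<phi>: "u = to_L2 \<phi>" "w = to_L2 (bessel_expression R \<phi>)" "\<phi> \<in> test_functions"
      "\<forall>t\<in>?P. \<phi> t = 0" unfolding test_graph_def by blast
    show "\<delta> * (norm u)\<^sup>2 \<le> inner w u"
      unfolding \<phi>(1,2) by (rule form_coercive_of_Riccati[OF R \<phi>(3) \<tau> _ Riccati]) (use \<phi>(4) in auto)
  qed
qed

text \<open>The test functions have values in a fixed line spanned by \<open>e\<close>, on which \<open>R\<close> is bounded by its largest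
  eigenvalue.\<close>

lemma infinite_morse_index_below_Hardy:
  fixes R :: "real \<Rightarrow> real^'n^'n"
  assumes R: "continuous_on {0..1} R" and sym: "\<And>t. t \<in> {0..1} \<Longrightarrow> transpose (R t) = R t"
    and lim: "Limsup (at_right 0) (\<lambda>t. ereal (largest_eigenvalue (R t))) < ereal (- 1 / 4)"
    and A: "self_adjoint_extension (minimal_operator R) A" and E: "spectral_measure_of A E"
  shows "morse_index E = \<infinity>"
proof -
  have sa: "self_adjoint A" "minimal_operator R \<subseteq> A"
    using A by (simp_all add: self_adjoint_extension_def)
  obtain c where c: "Limsup (at_right 0) (\<lambda>t. ereal (largest_eigenvalue (R t))) < ereal c" "c < - 1 / 4"
    using ereal_dense2[OF lim] by auto
  have "\<forall>\<^sub>F t in at_right 0. largest_eigenvalue (R t) < c"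
    using Limsup_lessD[OF c(1)] by simp
  then obtain b where b: "b > 0" "\<And>t. 0 < t \<Longrightarrow> t < b \<Longrightarrow> largest_eigenvalue (R t) < c"
    unfolding eventually_at_right_field by auto
  obtain e :: "real^'n" where e: "norm e = 1" using vector_choose_size[of 1] by auto
  have upper: "inner (R t *v e) e \<le> c" if "0 < t" "t < b" "t \<le> 1" for t
    using largest_eigenvalue_ge[OF sym, of t e] b(2)[of t] that e by simp
  obtain \<epsilon> h where \<epsilon>: "\<epsilon> > 0" and h: "h \<in> interval_test 0 1"
    and neg: "integral {0..1} (\<lambda>s. - (\<epsilon>\<^sup>2 * vderiv (vderiv h) s * h s) + (c + 1 / 4) * (h s)\<^sup>2) < 0"
    using small_frequency[OF c(2)] by blast
  \<comment> \<open>start the sequence of dilations so close to the endpoint that the bound on \<open>R\<close> applies\<close>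
  obtain k0 :: nat where k0: "1 - \<epsilon> * ln b < real k0" using reals_Archimedean2 by blast
  define k where "k n = real (k0 + n + 2)" for n :: nat
  have k1: "k n > 1" for n by (simp add: k_def)
  have small: "exp ((1 - k n) / \<epsilon>) < b" "exp ((1 - k n) / \<epsilon>) \<le> 1" for n
  proof -
    have "1 - k n < \<epsilon> * ln b" using k0 by (simp add: k_def)
    then have "(1 - k n) / \<epsilon> < ln b" using \<epsilon> by (simp add: field_simps)
    then show "exp ((1 - k n) / \<epsilon>) < b" using b(1) by (metis exp_less_cancel_iff exp_ln)
    show "exp ((1 - k n) / \<epsilon>) \<le> 1" using k1[of n] \<epsilon> by (simp add: divide_nonpos_pos)
  qed
  define \<phi> where "\<phi> n t = log_profile \<epsilon> (k n) (1 / 2) h t *\<^sub>R e" for n t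
  show ?thesis
  proof (rule infinite_morse_index[OF sa(1) E])
    fix n
    have "(to_L2 (\<phi> n), to_L2 (bessel_expression R (\<phi> n))) \<in> test_graph R {}"
      unfolding \<phi>_def by (rule test_graphI[OF test_function_log_profile[OF \<epsilon> h k1]]) simp
    then show "(to_L2 (\<phi> n), to_L2 (bessel_expression R (\<phi> n))) \<in> A"
      using test_graph_subset_minimal_operator sa(2) by blast
    show "inner (to_L2 (bessel_expression R (\<phi> n))) (to_L2 (\<phi> n)) < 0"
      unfolding \<phi>_def
    proof (rule log_profile_negative[OF R \<epsilon> h k1 e _ neg])
      fix t assume "0 < t" "t \<le> exp ((1 - k n) / \<epsilon>)"
      then show "inner (R t *v e) e \<le> c" using upper[of t] small[of n] by linarith
    qed
  next
    fix i j :: nat assume "i \<noteq> j"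
    then have "\<bar>k i - k j\<bar> \<ge> 1" by (simp add: k_def)
    then show "inner (to_L2 (bessel_expression R (\<phi> i))) (to_L2 (\<phi> j)) = 0"
      unfolding \<phi>_def by (intro log_profile_orthogonal[OF R \<epsilon> h k1 k1])
  qed
qed

theorem theorem6:
  fixes R :: "real \<Rightarrow> real^'n^'n"
  assumes "continuous_on {0..1} R"
    and "\<And>t. t \<in> {0..1} \<Longrightarrow> transpose (R t) = R t"
  shows
    "(Liminf (at_right 0) (\<lambda>t. ereal (smallest_eigenvalue (R t))) > ereal (- 1 / 4) \<longrightarrow>
        (\<forall>A E. self_adjoint_extension (minimal_operator R) A \<longrightarrow> spectral_measure_of A E \<longrightarrow>
           morse_index E < \<infinity>)) \<and>
     (Limsup (at_right 0) (\<lambda>t. ereal (largest_eigenvalue (R t))) < ereal (- 1 / 4) \<longrightarrow>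
        (\<forall>A E. self_adjoint_extension (minimal_operator R) A \<longrightarrow> spectral_measure_of A E \<longrightarrow>
           morse_index E = \<infinity>))"
  using finite_morse_index_above_Hardy[OF assms] infinite_morse_index_below_Hardy[OF assms] by blast

end
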